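(* Let $m\ge 4$ be even, and let $P_m$ be the $3$-polytope constructed in the context, with $Q_m$ a regular $m$-gon. Then: (i) $P_m$ is a simplicial $3$-polytope with $m+4$ vertices; (ii) the maximal dissection of $P_m$ has at least $4m-6$ tetrahedra; (iii) the maximal triangulation of $P_m$ has at most $\frac{7m}{2}+1$ tetrahedra. In particular, the gap between the sizes of the maximal dissection and the maximal triangulation of $P_m$ grows (at least) linearly in the number of vertices as $m\to\infty$.
   Context: A dissection of a convex $3$-polytope $P$ is a set of tetrahedra whose vertices are among the vertices of $P$, such that no two of them have an interior point in common and their union is $P$. A dissection is a triangulation if any two of its tetrahedra intersect in a common face (possibly empty). The size of a dissection is its number of tetrahedra; maximal means of maximum size. Construction of $P_m$: let $Q_m\subset\mathbb{R}^3$ be a (planar) convex $m$-gon with $m$ even. Let $v_1v_2$ and $u_1u_2$ be two segments parallel to the plane containing $Q_m$, orthogonal to each other, lying on opposite sides of that plane, and such that each of the four segments $v_iu_j$ ($i,j\in\{1,2\}$) intersects the (relative) interior of $Q_m$. Suppose that neither $v_1v_2$ nor $u_1u_2$ is parallel to any diagonal or edge of $Q_m$. Then $P_m$ is the convex hull of $Q_m\cup\{v_1,v_2,u_1,u_2\}$. *)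

theory Defs
  imports "HOL-Analysis.Analysis"
begin

type_synonym space = "real ^ 3"

definition vertices :: "space set \<Rightarrow> space set" where
  "vertices P = {x. x extreme_point_of P}"

definition simplicial_3polytope :: "space set \<Rightarrow> bool" where
  "simplicial_3polytope P \<longleftrightarrow>
     polytope P \<and> aff_dim P = 3 \<and> (\<forall>F. F facet_of P \<longrightarrow> 2 simplex F)"

definition dissection :: "space set \<Rightarrow> space set set \<Rightarrow> bool" where
  "dissection P D \<longleftrightarrow>
     finite D \<and>
     (\<forall>T\<in>D. 3 simplex T \<and> vertices T \<subseteq> vertices P) \<and>
     (\<forall>S\<in>D. \<forall>T\<in>D. S \<noteq> T \<longrightarrow> interior S \<inter> interior T = {}) \<and>
     \<Union>D = P"

text \<open>The library's \<open>triangulation\<close> requires the intersection of any two members to be a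
  face of both; the empty set counts as a face.\<close>

definition triangulation_of :: "space set \<Rightarrow> space set set \<Rightarrow> bool" where
  "triangulation_of P D \<longleftrightarrow> dissection P D \<and> triangulation D"

definition max_dissection_size :: "space set \<Rightarrow> nat" where
  "max_dissection_size P = Max {card D |D. dissection P D}"

definition max_triangulation_size :: "space set \<Rightarrow> nat" where
  "max_triangulation_size P = Max {card D |D. triangulation_of P D}"

definition convex_polygon :: "nat \<Rightarrow> space set \<Rightarrow> bool" where
  "convex_polygon m Q \<longleftrightarrow> polytope Q \<and> aff_dim Q = 2 \<and> card (vertices Q) = m"

text \<open>The hull of \<open>m\<close> equally spaced points on a circle with centre \<open>c\<close> and radius \<open>r\<close>;
  \<open>e\<close> and \<open>f\<close> form an orthonormal basis of the direction plane of the circle.\<close>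

definition regular_polygon :: "nat \<Rightarrow> space set \<Rightarrow> bool" where
  "regular_polygon m Q \<longleftrightarrow> m \<ge> 3 \<and>
     (\<exists>c e f r. norm e = 1 \<and> norm f = 1 \<and> orthogonal e f \<and> r > 0 \<and>
        Q = convex hull
          ((\<lambda>k. c + r *\<^sub>R (cos (2 * pi * real k / real m) *\<^sub>R e
                         + sin (2 * pi * real k / real m) *\<^sub>R f)) ` {..<m}))"

definition parallel :: "space \<Rightarrow> space \<Rightarrow> bool" where
  "parallel x y \<longleftrightarrow> (\<exists>t. t \<noteq> 0 \<and> y = t *\<^sub>R x)"

text \<open>\<open>Pm_construction m Q P\<close>: the set \<open>P\<close> is one of the polytopes \<open>P\<^sub>m\<close> built over the
  \<open>m\<close>-gon \<open>Q\<close>. The plane of \<open>Q\<close> is \<open>{x. n \<bullet> x = b}\<close>; since \<open>(n, b)\<close> may be replaced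
  by \<open>(- n, - b)\<close>, putting \<open>v\<^sub>1v\<^sub>2\<close> on its positive side loses no generality. Pairs of
  distinct vertices of \<open>Q\<close> are exactly its edges and diagonals.\<close>

definition Pm_construction :: "nat \<Rightarrow> space set \<Rightarrow> space set \<Rightarrow> bool" where
  "Pm_construction m Q P \<longleftrightarrow>
     even m \<and> convex_polygon m Q \<and>
     (\<exists>v1 v2 u1 u2 n b.
        v1 \<noteq> v2 \<and> u1 \<noteq> u2 \<and>
        n \<noteq> 0 \<and> affine hull Q = {x. n \<bullet> x = b} \<and>
        n \<bullet> v1 = n \<bullet> v2 \<and> n \<bullet> u1 = n \<bullet> u2 \<and>
        orthogonal (v2 - v1) (u2 - u1) \<and>
        n \<bullet> v1 > b \<and> n \<bullet> u1 < b \<and>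
        (\<forall>v\<in>{v1, v2}. \<forall>u\<in>{u1, u2}. closed_segment v u \<inter> rel_interior Q \<noteq> {}) \<and>
        (\<forall>p\<in>vertices Q. \<forall>q\<in>vertices Q. p \<noteq> q \<longrightarrow>
           \<not> parallel (v2 - v1) (q - p) \<and> \<not> parallel (u2 - u1) (q - p)) \<and>
        P = convex hull (Q \<union> {v1, v2, u1, u2}))"

end

theory Submission
  imports Defs
begin

text \<open>Sort the vertices of the regular polygon by the coordinate orthogonal to \<open>v1 v2\<close>; the resulting
  path zigzags between both sides of the polygon. Above the polygon there are \<open>2 m - 3\<close> tetrahedra:
  those spanned by \<open>v1 v2\<close> and one of the \<open>m - 1\<close> steps of the path, and the cones from \<open>v1\<close> or \<open>v2\<close> over
  the \<open>m - 2\<close> triangles formed by two successive steps. Doing the same below with \<open>u1 u2\<close> gives a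
  dissection of size \<open>4 m - 6\<close>, as both halves need not agree on the polygon.

  In a triangulation they have to agree. Its tetrahedra around \<open>v1 v2\<close> and around \<open>u1 u2\<close> rest on chords
  of the polygon that cover disjoint parts of the zigzag path above, respectively below. A chord
  covering only one step is a diagonal or one of four sides, and it is not a step of both paths.
  All these chords being noncrossing, there are at most about \<open>3 m / 2\<close> of them. The remaining
  tetrahedra are seen in the section by the plane of the polygon, where generic sweeping bounds
  the number of triangles.\<close>

subsection \<open>Affine functionals and strict convex combinations\<close>

text \<open>Origin of \<open>7 * m / 2 + 1\<close>. Let T count the base triangles, X the tetrahedra
  with apices on both sides of the plane, l and l' the chords of the two links, and k <= 4 the edges
  \<open>{v, u}\<close>. Every base triangle carries at most one tetrahedron on either side, so a
  triangulation has at most 2T + X + l + l' members. The section by the plane gives T + X <= m + 2k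
  - 2. A link chord weighs as many path steps as it covers, at most m - 1 per link; chords of weight
  1 number at most m + 1 in all, so 2(l + l') <= 3m - 1. There remains one T to bound: T <= m - 2,
  and T <= m - 3 as soon as an edge \<open>{v, u}\<close> pierces the polygon, for no base triangle
  covers that point. The obstacle is k = 4, where this yields only 7m + 5 for twice the size. An
  extra unit, from T or from both links, lowers it to 7m + 3, and since m is even to 7m + 2.

  Overlaps are always refuted in the same way: one point is written with positive weights on a face
  A and also as a point of the hull of a face B, which in a triangulation forces A to be contained
  in B.\<close>

definition affine_fun :: "(space \<Rightarrow> real) \<Rightarrow> bool" where
  "affine_fun f \<longleftrightarrow> (\<exists>a b. \<forall>p. f p = a \<bullet> p + b)"

definition coord :: "space \<Rightarrow> space \<Rightarrow> space \<Rightarrow> real" where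
  "coord c e p = (p - c) \<bullet> e"

lemma affine_fun_coord [simp, intro]: "affine_fun (coord c e)"
  unfolding affine_fun_def coord_def
  by (rule exI[of _ e], rule exI[of _ "- (c \<bullet> e)"]) (simp add: inner_diff_left inner_commute[of e])

lemma affine_fun_const [simp, intro]: "affine_fun (\<lambda>p. k)"
  unfolding affine_fun_def by (intro exI[of _ 0] exI[of _ k]) simp

lemma affine_fun_add [intro]:
  "affine_fun f \<Longrightarrow> affine_fun g \<Longrightarrow> affine_fun (\<lambda>p. f p + g p)"
  unfolding affine_fun_def by (metis (no_types, lifting) add.assoc add.left_commute inner_add_left)

lemma affine_fun_scale [intro]: "affine_fun f \<Longrightarrow> affine_fun (\<lambda>p. k * f p)"
  unfolding affine_fun_def by (metis distrib_left inner_scaleR_left)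

lemma affine_fun_scale_right [intro]: "affine_fun f \<Longrightarrow> affine_fun (\<lambda>p. f p * k)"
  using affine_fun_scale[of f k] by (simp add: mult.commute)

lemma affine_fun_minus [intro]: "affine_fun f \<Longrightarrow> affine_fun (\<lambda>p. - f p)"
  using affine_fun_scale[of f "-1"] by simp

lemma affine_fun_diff [intro]:
  "affine_fun f \<Longrightarrow> affine_fun g \<Longrightarrow> affine_fun (\<lambda>p. f p - g p)"
  using affine_fun_add[OF _ affine_fun_minus, of f g] by simp

lemma affine_fun_sum:
  assumes "affine_fun f" "sum u A = 1"
  shows "f (\<Sum>x\<in>A. u x *\<^sub>R x) = (\<Sum>x\<in>A. u x * f x)"
proof -
  obtain a b where f: "\<And>p. f p = a \<bullet> p + b"
    using assms(1) unfolding affine_fun_def by blast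
  have "(\<Sum>x\<in>A. u x * f x) = (\<Sum>x\<in>A. u x * (a \<bullet> x)) + (\<Sum>x\<in>A. u x * b)"
    by (simp add: f distrib_left sum.distrib)
  also have "(\<Sum>x\<in>A. u x * b) = b"
    using assms(2) by (simp flip: sum_distrib_right)
  finally show ?thesis
    by (simp add: f inner_sum_right)
qed

lemma affine_fun_segment:
  assumes "affine_fun f"
  shows "f ((1 - t) *\<^sub>R x + t *\<^sub>R y) = (1 - t) * f x + t * f y"
  using assms unfolding affine_fun_def by (auto simp: inner_add_right algebra_simps)

lemma affine_fun_hull_le:
  assumes "affine_fun f" "\<And>x. x \<in> S \<Longrightarrow> f x \<le> k" "y \<in> convex hull S"
  shows "f y \<le> k"
proof -
  obtain a b where f: "\<And>p. f p = a \<bullet> p + b"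
    using assms(1) unfolding affine_fun_def by blast
  have "convex hull S \<subseteq> {x. a \<bullet> x \<le> k - b}"
    by (rule hull_minimal, use assms(2) in \<open>force simp: f\<close>, rule convex_halfspace_le)
  then show ?thesis
    using assms(3) by (auto simp: f)
qed

lemma affine_fun_hull_ge:
  assumes "affine_fun f" "\<And>x. x \<in> S \<Longrightarrow> k \<le> f x" "y \<in> convex hull S"
  shows "k \<le> f y"
  using affine_fun_hull_le[OF affine_fun_minus[OF assms(1)], of S "- k" y] assms by force

lemma affine_fun_hull_eq:
  assumes "affine_fun f" "\<And>x. x \<in> S \<Longrightarrow> f x = k" "y \<in> convex hull S"
  shows "f y = k"
  using affine_fun_hull_le[of f S k y] affine_fun_hull_ge[of f S k y] assms by force

lemma affine_fun_affine_hull: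
  assumes "affine_fun f" "\<And>x. x \<in> S \<Longrightarrow> f x = 0" "y \<in> affine hull S"
  shows "f y = 0"
proof -
  obtain a b where f: "\<And>p. f p = a \<bullet> p + b"
    using assms(1) unfolding affine_fun_def by blast
  have "affine hull S \<subseteq> {x. a \<bullet> x = - b}"
    by (rule hull_minimal, use assms(2) in \<open>force simp: f\<close>, rule affine_hyperplane)
  then show ?thesis
    using assms(3) by (auto simp: f)
qed

lemma affine_independent_insert_fun:
  assumes "\<not> affine_dependent S" "affine_fun f" "\<And>x. x \<in> S \<Longrightarrow> f x = 0" "f w \<noteq> 0"
  shows "\<not> affine_dependent (insert w S)"
  using affine_independent_insert[OF assms(1)] affine_fun_affine_hull[OF assms(2,3)] assms(4) by blast

text \<open>For finite affinely independent \<open>A\<close> this is the relative interior of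
  \<open>convex hull A\<close>. Positive weights are used directly because they can be merged and
  split along unions of vertex sets, whether or not these are independent.\<close>

definition strict_hull :: "space set \<Rightarrow> space set" where
  "strict_hull A = {y. \<exists>u. (\<forall>x\<in>A. 0 < u x) \<and> sum u A = 1 \<and> (\<Sum>x\<in>A. u x *\<^sub>R x) = y}"

lemma strict_hull_singleton [simp]: "strict_hull {x} = {x}"
proof -
  have "x \<in> strict_hull {x}"
    unfolding strict_hull_def by (intro CollectI exI[of _ "\<lambda>_. 1"]) simp
  then show ?thesis
    by (auto simp: strict_hull_def)
qed

lemma strict_hull_subset: "finite A \<Longrightarrow> strict_hull A \<subseteq> convex hull A"
  by (auto simp: strict_hull_def convex_hull_finite intro: less_imp_le)

text \<open>\<open>A\<close> and \<open>B\<close> may overlap, which happens for edges of a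
  tetrahedron that share an apex: the scaled weights are added, and every point gets a positive
  share from at least one of them.\<close>

lemma strict_hull_combine:
  assumes "finite A" "finite B" "g \<in> strict_hull A" "h \<in> strict_hull B" "0 < t" "t < 1"
  shows "(1 - t) *\<^sub>R g + t *\<^sub>R h \<in> strict_hull (A \<union> B)"
proof -
  obtain u where u: "\<forall>x\<in>A. 0 < u x" "sum u A = 1" "(\<Sum>x\<in>A. u x *\<^sub>R x) = g"
    using assms(3) by (auto simp: strict_hull_def)
  obtain w where w: "\<forall>x\<in>B. 0 < w x" "sum w B = 1" "(\<Sum>x\<in>B. w x *\<^sub>R x) = h"
    using assms(4) by (auto simp: strict_hull_def)
  let ?z = "\<lambda>x. (1 - t) * (if x \<in> A then u x else 0) + t * (if x \<in> B then w x else 0)"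
  have *: "\<forall>x\<in>A \<union> B. 0 < ?z x"
  proof
    fix x assume "x \<in> A \<union> B"
    then show "0 < ?z x"
      using u(1) w(1) assms(5,6) by (cases "x \<in> A"; cases "x \<in> B") (auto intro: add_pos_pos)
  qed
  have a: "(\<Sum>x\<in>A \<union> B. if x \<in> A then u x else 0) = 1"
    using assms(1,2) u(2) by (simp add: sum.If_cases Int_absorb1)
  have b: "(\<Sum>x\<in>A \<union> B. if x \<in> B then w x else 0) = 1"
    using assms(1,2) w(2) by (simp add: sum.If_cases Int_absorb1)
  have s: "sum ?z (A \<union> B) = 1"
    by (simp add: sum.distrib a b flip: sum_distrib_left)
  have c: "(\<Sum>x\<in>A \<union> B. (if x \<in> A then u x else 0) *\<^sub>R x) = g"
  proof -
    have "(\<Sum>x\<in>A \<union> B. (if x \<in> A then u x else 0) *\<^sub>R x) = (\<Sum>x\<in>A. u x *\<^sub>R x)"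
      using assms(1,2) by (intro sum.mono_neutral_cong_right) auto
    then show ?thesis using u(3) by simp
  qed
  have d: "(\<Sum>x\<in>A \<union> B. (if x \<in> B then w x else 0) *\<^sub>R x) = h"
  proof -
    have "(\<Sum>x\<in>A \<union> B. (if x \<in> B then w x else 0) *\<^sub>R x) = (\<Sum>x\<in>B. w x *\<^sub>R x)"
      using assms(1,2) by (intro sum.mono_neutral_cong_right) auto
    then show ?thesis using w(3) by simp
  qed
  have "(\<Sum>x\<in>A \<union> B. ?z x *\<^sub>R x) =
      (1 - t) *\<^sub>R (\<Sum>x\<in>A \<union> B. (if x \<in> A then u x else 0) *\<^sub>R x)
      + t *\<^sub>R (\<Sum>x\<in>A \<union> B. (if x \<in> B then w x else 0) *\<^sub>R x)"
    by (simp only: scaleR_left_distrib sum.distrib scaleR_sum_right scaleR_scaleR)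
  then show ?thesis
    unfolding strict_hull_def c d using * s by (intro CollectI exI[of _ ?z]) blast
qed

lemma strict_hull_split:
  assumes "finite A" "finite B" "A \<noteq> {}" "B \<noteq> {}" "A \<inter> B = {}" "z \<in> strict_hull (A \<union> B)"
  obtains t g h where "0 < t" "t < 1" "g \<in> strict_hull A" "h \<in> strict_hull B"
    "z = (1 - t) *\<^sub>R g + t *\<^sub>R h"
proof -
  obtain u where u: "\<forall>x\<in>A \<union> B. 0 < u x" "sum u (A \<union> B) = 1" "(\<Sum>x\<in>A \<union> B. u x *\<^sub>R x) = z"
    using assms(6) by (auto simp: strict_hull_def)
  define t where "t = sum u B"
  have s: "sum u A = 1 - t"
    using u(2) assms by (simp add: sum.union_disjoint t_def)
  have t: "0 < t" "0 < 1 - t"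
    using u(1) assms unfolding t_def s[symmetric, unfolded t_def] by (auto intro!: sum_pos)
  define g where "g = (\<Sum>x\<in>A. (u x / (1 - t)) *\<^sub>R x)"
  define h where "h = (\<Sum>x\<in>B. (u x / t) *\<^sub>R x)"
  have "g \<in> strict_hull A"
    unfolding strict_hull_def g_def using u(1) t s
    by (intro CollectI exI[of _ "\<lambda>x. u x / (1 - t)"]) (auto simp flip: sum_divide_distrib)
  moreover have "h \<in> strict_hull B"
    unfolding strict_hull_def h_def using u(1) t
    by (intro CollectI exI[of _ "\<lambda>x. u x / t"]) (auto simp: t_def simp flip: sum_divide_distrib)
  moreover have "z = (1 - t) *\<^sub>R g + t *\<^sub>R h"
    using u(3) assms t by (simp add: g_def h_def sum.union_disjoint scaleR_sum_right)
  ultimately show ?thesis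
    using that t by simp
qed

lemma strict_hull_pair:
  assumes "p \<noteq> q" "z \<in> strict_hull {p, q}"
  obtains t where "0 < t" "t < 1" "z = (1 - t) *\<^sub>R p + t *\<^sub>R q"
proof (rule strict_hull_split[of "{p}" "{q}" z])
  show "z \<in> strict_hull ({p} \<union> {q})"
    using assms(2) by (simp add: insert_commute)
qed (use assms that in auto)

lemma strict_hull_pairI:
  assumes "0 < t" "t < 1"
  shows "(1 - t) *\<^sub>R p + t *\<^sub>R q \<in> strict_hull {p, q}"
  using strict_hull_combine[of "{p}" "{q}" p q t] assms by (simp add: insert_commute)

text \<open>Lets disjointness of strict hulls stand in for the disjointness of interiors that a
  dissection demands.\<close>

lemma strict_hull_simplex_interior:
  fixes S :: "space set"
  assumes "\<not> affine_dependent S" "z \<in> interior (convex hull S)"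
  shows "z \<in> strict_hull S"
proof -
  have "z \<in> rel_interior (convex hull S)"
    using assms(2) interior_subset_rel_interior by blast
  then show ?thesis
    using rel_interior_convex_hull_explicit[OF assms(1)] by (simp add: strict_hull_def)
qed

lemma affine_fun_strict_hull_pos:
  assumes "finite A" "affine_fun f" "\<And>x. x \<in> A \<Longrightarrow> 0 \<le> f x" "\<exists>x\<in>A. 0 < f x" "z \<in> strict_hull A"
  shows "0 < f z"
proof -
  obtain u where u: "\<forall>x\<in>A. 0 < u x" "sum u A = 1" "(\<Sum>x\<in>A. u x *\<^sub>R x) = z"
    using assms(5) by (auto simp: strict_hull_def)
  have "f z = (\<Sum>x\<in>A. u x * f x)"
    using affine_fun_sum[OF assms(2) u(2)] u(3) by simp
  also have "\<dots> > 0"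
    using assms(1,3,4) u(1) by (meson less_eq_real_def mult_nonneg_nonneg mult_pos_pos sum_pos2)
  finally show ?thesis .
qed


subsection \<open>Simplices meeting face to face\<close>

lemma simplex_vertices:
  assumes "3 simplex T"
  shows "finite (vertices T)" "\<not> affine_dependent (vertices T)" "card (vertices T) = 4"
    "convex hull (vertices T) = T"
proof -
  obtain C where C: "\<not> affine_dependent C" "int (card C) = 3 + 1" "T = convex hull C"
    using assms by (auto simp: simplex_def)
  have "vertices T = C"
    unfolding vertices_def C(3) using extreme_point_of_convex_hull_affine_independent[OF C(1)] by blast
  then show "finite (vertices T)" "\<not> affine_dependent (vertices T)" "card (vertices T) = 4"
    "convex hull (vertices T) = T"
    using C aff_independent_finite by auto
qed

text \<open>The triangulation property in the form used from here on: \<open>K\<close> consists of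
  vertex sets instead of tetrahedra, and two simplices meet in the hull of their common
  vertices.\<close>

definition face_to_face :: "space set set \<Rightarrow> bool" where
  "face_to_face K \<longleftrightarrow> (\<forall>S\<in>K. \<not> affine_dependent S) \<and>
     (\<forall>S\<in>K. \<forall>S'\<in>K. convex hull S \<inter> convex hull S' \<subseteq> convex hull (S \<inter> S'))"

text \<open>The common face is spanned by a subset of either vertex set. Both subsets consist of its
  extreme points, so they coincide and lie in both vertex sets.\<close>

lemma triangulation_face_to_face:
  assumes "triangulation_of P D"
  shows "face_to_face (vertices ` D)"
proof -
  have s: "\<And>T. T \<in> D \<Longrightarrow> 3 simplex T" and tri: "triangulation D"
    using assms by (auto simp: triangulation_of_def dissection_def)
  have "T \<inter> T' \<subseteq> convex hull (vertices T \<inter> vertices T')" if T: "T \<in> D" "T' \<in> D" for T T'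
  proof -
    note v = simplex_vertices[OF s[OF T(1)]] and v' = simplex_vertices[OF s[OF T(2)]]
    have "(T \<inter> T') face_of T" "(T \<inter> T') face_of T'"
      using tri T unfolding triangulation_def by (blast, metis Int_commute)
    then obtain c c' where c: "c \<subseteq> vertices T" "T \<inter> T' = convex hull c"
        "c' \<subseteq> vertices T'" "T \<inter> T' = convex hull c'"
      using face_of_convex_hull_affine_independent[OF v(2)]
        face_of_convex_hull_affine_independent[OF v'(2)] v(4) v'(4) by metis
    have "\<not> affine_dependent c" "\<not> affine_dependent c'"
      using c v(2) v'(2) affine_independent_subset by blast+
    then have "c = c'"
      using c(2,4) extreme_point_of_convex_hull_affine_independent by (metis subsetI subset_antisym)
    then show ?thesis
      using c hull_mono[of c "vertices T \<inter> vertices T'" convex] by auto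
  qed
  then show ?thesis
    unfolding face_to_face_def using simplex_vertices[OF s] by auto
qed

text \<open>Independence inside \<open>S\<close> and inside \<open>S'\<close> pushes
  \<open>g\<close> into the hull of \<open>A \<inter> S'\<close> and then of
  \<open>A \<inter> B\<close>. If \<open>A\<close> were not contained in \<open>B\<close>, this
  would be a proper face of \<open>convex hull A\<close>, and such a face misses the relative
  interior, where \<open>g\<close> lies.\<close>

lemma face_to_face_strict:
  assumes K: "face_to_face K" and S: "S \<in> K" "A \<subseteq> S" "S' \<in> K" "B \<subseteq> S'"
    and g: "g \<in> strict_hull A" "g \<in> convex hull B"
  shows "A \<subseteq> B"
proof -
  have i: "\<not> affine_dependent S" "\<not> affine_dependent S'"
    and m: "convex hull S \<inter> convex hull S' \<subseteq> convex hull (S \<inter> S')"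
    using K S unfolding face_to_face_def by auto
  have iA: "\<not> affine_dependent A"
    using i S(2) affine_independent_subset by blast
  have fin: "finite A"
    using iA aff_independent_finite by blast
  have gA: "g \<in> convex hull A"
    using g(1) strict_hull_subset[OF fin] by blast
  have "g \<in> convex hull (S \<inter> S')"
    using m gA g(2) S hull_mono[of A S convex] hull_mono[of B S' convex] by blast
  moreover have "convex hull A \<inter> convex hull (S \<inter> S') = convex hull (A \<inter> (S \<inter> S'))"
    using affine_independent_subset[OF i(1), of "A \<union> (S \<inter> S')"] S(2) by (intro convex_hull_Int[symmetric]) blast
  ultimately have g1: "g \<in> convex hull (A \<inter> (S \<inter> S'))"
    using gA by blast
  have "convex hull (A \<inter> (S \<inter> S')) \<inter> convex hull B = convex hull ((A \<inter> (S \<inter> S')) \<inter> B)"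
    using affine_independent_subset[OF i(2), of "(A \<inter> (S \<inter> S')) \<union> B"] S(4) by (intro convex_hull_Int[symmetric]) blast
  moreover have "(A \<inter> (S \<inter> S')) \<inter> B = A \<inter> B"
    using S by blast
  ultimately have g2: "g \<in> convex hull (A \<inter> B)"
    using g1 g(2) by auto
  show "A \<subseteq> B"
  proof (rule ccontr)
    assume "\<not> A \<subseteq> B"
    then obtain a where a: "a \<in> A" "a \<notin> A \<inter> B" by blast
    have f: "convex hull (A \<inter> B) face_of convex hull A"
      using face_of_convex_hull_affine_independent[OF iA] by blast
    have "\<not> affine_dependent (A \<inter> B)"
      using iA affine_independent_subset by blast
    then have "convex hull (A \<inter> B) \<noteq> convex hull A"
      using a extreme_point_of_convex_hull_affine_independent iA by metis
    then have "convex hull (A \<inter> B) \<inter> rel_interior (convex hull A) = {}"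
      using face_of_disjoint_rel_interior[OF f] by auto
    moreover have "g \<in> rel_interior (convex hull A)"
      using g(1) rel_interior_convex_hull_explicit[OF iA] by (simp add: strict_hull_def)
    ultimately show False
      using g2 by blast
  qed
qed


subsection \<open>Coning a simplicial polytope from a vertex\<close>

text \<open>The facet is the one whose inequality the ray from \<open>w\<close> through
  \<open>z\<close> violates first. As \<open>z\<close> still satisfies it, the exit parameter is at
  least 1; for \<open>w\<close> on the facet it would be 0.\<close>

lemma polytope_ray_facet:
  fixes P :: "space set"
  assumes "polytope P" "aff_dim P = 3" "w \<in> P" "z \<in> P" "z \<noteq> w"
  obtains F t b where "F facet_of P" "w \<notin> F" "b \<in> F" "1 \<le> t" "b = w + t *\<^sub>R (z - w)"
proof -
  have aff: "affine hull P = UNIV"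
    using assms(2) aff_dim_eq_full[of P] by simp
  obtain H where H: "finite H" "P = (affine hull P) \<inter> \<Inter>H"
      "\<forall>h\<in>H. \<exists>a b. a \<noteq> 0 \<and> h = {x. a \<bullet> x \<le> b}"
      "\<forall>H'. H' \<subset> H \<longrightarrow> P \<subset> (affine hull P) \<inter> \<Inter>H'"
    using polytope_imp_polyhedron[OF assms(1)] unfolding polyhedron_Int_affine_minimal by blast
  obtain a b where ab: "\<And>h. h \<in> H \<Longrightarrow> a h \<noteq> 0 \<and> h = {x. a h \<bullet> x \<le> b h}"
    using H(3) by metis
  have fac: "C facet_of P \<longleftrightarrow> (\<exists>h. h \<in> H \<and> C = P \<inter> {x. a h \<bullet> x = b h})" for C
    using facet_of_polyhedron_explicit[OF H(1,2) ab] H(4) by blast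
  have inP: "x \<in> P \<longleftrightarrow> (\<forall>h\<in>H. a h \<bullet> x \<le> b h)" for x
    using H(2) ab aff by blast
  \<comment> \<open>The inequalities that get tighter along the ray; without any, the whole ray
    would lie in the bounded set \<open>P\<close>.\<close>
  define G where "G = {h \<in> H. 0 < a h \<bullet> (z - w)}"
  have finG: "finite G"
    using H(1) by (simp add: G_def)
  have "G \<noteq> {}"
  proof
    assume e: "G = {}"
    have ray: "w + t *\<^sub>R (z - w) \<in> P" if "t \<ge> 0" for t
      unfolding inP
    proof
      fix h assume h: "h \<in> H"
      have "a h \<bullet> (z - w) \<le> 0"
        using e h by (auto simp: G_def not_less)
      then have "t * (a h \<bullet> (z - w)) \<le> 0"
        using that by (simp add: mult_nonneg_nonpos)
      moreover have "a h \<bullet> w \<le> b h"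
        using assms(3) h inP by blast
      ultimately show "a h \<bullet> (w + t *\<^sub>R (z - w)) \<le> b h"
        by (simp add: inner_add_right)
    qed
    have "bounded P"
      using assms(1) polytope_imp_bounded by blast
    then obtain B where B: "\<And>x. x \<in> P \<Longrightarrow> norm x \<le> B"
      unfolding bounded_iff by blast
    have nz: "norm (z - w) > 0"
      using assms(5) by simp
    define t where "t = (B + norm w + 1) / norm (z - w)"
    have B0: "B \<ge> 0"
      using B[OF assms(3)] norm_ge_zero order_trans by blast
    have "t \<ge> 0"
      unfolding t_def using nz B0 by simp
    then have "norm (w + t *\<^sub>R (z - w)) \<le> B"
      using ray B by blast
    moreover have "norm (t *\<^sub>R (z - w)) = B + norm w + 1"
      using nz B0 by (simp add: t_def)
    moreover have "norm (t *\<^sub>R (z - w)) \<le> norm (w + t *\<^sub>R (z - w)) + norm w"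
      by (metis add_diff_cancel_left' norm_triangle_ineq4)
    ultimately show False by simp
  qed
  define \<tau> where "\<tau> = (\<lambda>h. (b h - a h \<bullet> w) / (a h \<bullet> (z - w)))"
  define k where "k = arg_min_on \<tau> G"
  have k: "k \<in> G" "\<And>h. h \<in> G \<Longrightarrow> \<tau> k \<le> \<tau> h"
    using arg_min_if_finite(1)[OF finG \<open>G \<noteq> {}\<close>] arg_min_least[OF finG \<open>G \<noteq> {}\<close>] by (auto simp: k_def)
  have kH: "k \<in> H" and kp: "0 < a k \<bullet> (z - w)"
    using k(1) by (auto simp: G_def)
  have "a k \<bullet> z \<le> b k"
    using assms(4) inP kH by blast
  then have k1: "1 \<le> \<tau> k"
    unfolding \<tau>_def using kp by (simp add: inner_diff_right)
  define y where "y = w + \<tau> k *\<^sub>R (z - w)"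
  have yk: "a k \<bullet> y = b k"
    unfolding y_def \<tau>_def using kp by (simp add: inner_add_right)
  have yP: "y \<in> P"
    unfolding inP
  proof
    fix h assume h: "h \<in> H"
    have w: "a h \<bullet> w \<le> b h"
      using assms(3) h inP by blast
    show "a h \<bullet> y \<le> b h"
    proof (cases "h \<in> G")
      case True
      then have "\<tau> k * (a h \<bullet> (z - w)) \<le> \<tau> h * (a h \<bullet> (z - w))"
        using k(2)[OF True] by (auto simp: G_def intro!: mult_right_mono)
      also have "\<dots> = b h - a h \<bullet> w"
        using True by (simp add: \<tau>_def G_def)
      finally show ?thesis
        by (simp add: y_def inner_add_right)
    next
      case False
      then have "\<tau> k * (a h \<bullet> (z - w)) \<le> 0"
        using h k1 by (auto simp: G_def intro!: mult_nonneg_nonpos)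
      then show ?thesis
        using w by (simp add: y_def inner_add_right)
    qed
  qed
  have "w \<notin> {x. a k \<bullet> x = b k}"
  proof
    assume "w \<in> {x. a k \<bullet> x = b k}"
    then have "\<tau> k = 0" by (simp add: \<tau>_def)
    then show False using k1 by simp
  qed
  moreover have "(P \<inter> {x. a k \<bullet> x = b k}) facet_of P"
    using fac kH by blast
  ultimately show ?thesis
    using that[of "P \<inter> {x. a k \<bullet> x = b k}" y "\<tau> k"] yk yP k1 by (auto simp: y_def)
qed

text \<open>Guarantees that the maximum over all triangulations is taken over a nonempty set. A
  vertex \<open>w\<close> is joined to the facets that miss it; as these are triangles, the cones
  are tetrahedra.\<close>

lemma simplicial_polytope_triangulation:
  assumes "simplicial_3polytope P"
  obtains D where "triangulation_of P D"
proof -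
  have P: "polytope P" "aff_dim P = 3" and simp2: "\<And>F. F facet_of P \<Longrightarrow> 2 simplex F"
    using assms by (auto simp: simplicial_3polytope_def)
  have cvx: "convex P" and "compact P"
    using P polytope_imp_convex polytope_imp_compact by blast+
  have "P \<noteq> {}"
    using P(2) by auto
  then obtain w where w: "w extreme_point_of P"
    using extreme_point_exists_convex[OF \<open>compact P\<close> cvx] by blast
  have wP: "w \<in> P"
    using w extreme_point_of_def by blast
  define \<F> where "\<F> = {F. F facet_of P \<and> w \<notin> F}"
  define cn where "cn = (\<lambda>F. convex hull (insert w F))"
  have finF: "finite \<F>"
    using finite_polytope_facets[OF P(1)] by (simp add: \<F>_def)
  have base: "\<exists>C. \<not> affine_dependent (insert w C) \<and> card C = 3 \<and> w \<notin> C \<and> F = convex hull C"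
    if F: "F \<in> \<F>" for F
  proof -
    obtain C where C: "\<not> affine_dependent C" "int (card C) = 2 + 1" "F = convex hull C"
      using simp2[of F] F by (auto simp: \<F>_def simplex_def)
    have ff: "F face_of P" "w \<notin> F"
      using F by (auto simp: \<F>_def facet_of_def)
    have "w \<notin> affine hull F"
      using face_of_imp_eq_affine_Int[OF cvx ff(1)] ff(2) wP by blast
    then have "w \<notin> affine hull C"
      by (simp add: C(3) affine_hull_convex_hull)
    then show ?thesis
      using affine_independent_insert[OF C(1)] C hull_inc by (intro exI[of _ C]) fastforce
  qed
  have cnC: "cn (convex hull C) = convex hull (insert w C)" for C
    unfolding cn_def by (rule hull_insert[symmetric])
  have simp3: "3 simplex (cn F)" and vert: "vertices (cn F) \<subseteq> vertices P"
    and cnsub: "cn F \<subseteq> P" if F: "F \<in> \<F>" for F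
  proof -
    obtain C where C: "\<not> affine_dependent (insert w C)" "card C = 3" "w \<notin> C" "F = convex hull C"
      using base[OF F] by blast
    have "finite C" using C(2) by (simp add: card_ge_0_finite)
    then show "3 simplex (cn F)"
      unfolding simplex_def C(4) cnC using C by (intro exI[of _ "insert w C"]) auto
    have fP: "F face_of P"
      using F by (simp add: \<F>_def facet_of_def)
    have indC: "\<not> affine_dependent C"
      using C(1) affine_independent_subset by blast
    show "vertices (cn F) \<subseteq> vertices P"
    proof
      fix x assume "x \<in> vertices (cn F)"
      then have "x = w \<or> x \<in> C"
        unfolding vertices_def C(4) cnC
        using extreme_point_of_convex_hull_affine_independent[OF C(1)] by auto
      moreover have "x \<in> vertices P" if "x \<in> C"
      proof -
        have "x extreme_point_of F"
          using that extreme_point_of_convex_hull_affine_independent[OF indC] C(4) by blast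
        then show ?thesis
          using extreme_point_of_face[OF fP] by (simp add: vertices_def)
      qed
      ultimately show "x \<in> vertices P"
        using w by (auto simp: vertices_def)
    qed
    show "cn F \<subseteq> P"
      unfolding cn_def by (rule hull_minimal)
        (use wP cvx face_of_imp_subset[OF fP] in auto)
  qed
  have elt: "\<exists>s f. 0 \<le> s \<and> f \<in> F \<and> z = w + s *\<^sub>R (f - w)" if F: "F \<in> \<F>" and z: "z \<in> cn F" for F z
  proof -
    have "convex F" "F \<noteq> {}"
      using F by (auto simp: \<F>_def facet_of_def face_of_imp_convex)
    then obtain u v b where "0 \<le> u" "0 \<le> v" "b \<in> F" "u + v = 1" "z = u *\<^sub>R w + v *\<^sub>R b"
      using z unfolding cn_def convex_hull_insert[OF \<open>F \<noteq> {}\<close>] by (auto simp: hull_same)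
    then show ?thesis
      by (intro exI[of _ v] exI[of _ b]) (auto simp: algebra_simps simp flip: scaleR_left_distrib)
  qed
  \<comment> \<open>A facet that misses \<open>w\<close> meets a ray from \<open>w\<close> only
    where the ray leaves \<open>P\<close>: a point \<open>g\<close> further out would put
    \<open>f\<close> into the open segment from \<open>w\<close> to \<open>g\<close>, and the face
    would contain \<open>w\<close>.\<close>
  have ray: "f = g" if F: "F \<in> \<F>" and f: "f \<in> F" and g: "g \<in> P" and r: "g = w + r *\<^sub>R (f - w)" "r \<ge> 1" for F f g r
  proof (rule ccontr)
    assume "f \<noteq> g"
    then have "r > 1" using r by (cases "r = 1") auto
    have "f \<noteq> w" using F f by (auto simp: \<F>_def)
    have "f \<in> open_segment w g"
    proof -
      have "f = (1 - 1 / r) *\<^sub>R w + (1 / r) *\<^sub>R g"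
        using \<open>r > 1\<close> by (simp add: r(1) algebra_simps)
      moreover have "w \<noteq> g"
        using r \<open>f \<noteq> w\<close> by auto
      ultimately show ?thesis
        using \<open>r > 1\<close> by (auto simp: in_segment intro!: exI[of _ "1 / r"])
    qed
    moreover have "F face_of P"
      using F by (simp add: \<F>_def facet_of_def)
    ultimately have "w \<in> F"
      using f g wP by (meson face_ofD)
    then show False using F by (simp add: \<F>_def)
  qed
  have inter: "cn F \<inter> cn G \<subseteq> convex hull (insert w (F \<inter> G))" if F: "F \<in> \<F>" and G: "G \<in> \<F>" for F G
  proof
    fix z assume z: "z \<in> cn F \<inter> cn G"
    obtain s f where s: "0 \<le> s" "f \<in> F" "z = w + s *\<^sub>R (f - w)"
      using elt[OF F] z by blast
    obtain s' g where s': "0 \<le> s'" "g \<in> G" "z = w + s' *\<^sub>R (g - w)"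
      using elt[OF G] z by blast
    have fg: "f \<in> P" "g \<in> P"
      using F G s(2) s'(2) by (auto simp: \<F>_def facet_of_def dest: face_of_imp_subset)
    show "z \<in> convex hull (insert w (F \<inter> G))"
    proof (cases "z = w")
      case True
      then show ?thesis by (simp add: hull_inc)
    next
      case False
      then have pos: "s > 0" "s' > 0"
        using s s' by (auto simp: order_le_less)
      have eq: "s *\<^sub>R (f - w) = s' *\<^sub>R (g - w)"
        using s(3) s'(3) by simp
      have e1: "g = w + (s / s') *\<^sub>R (f - w)"
      proof -
        have "(s / s') *\<^sub>R (f - w) = (1 / s') *\<^sub>R (s *\<^sub>R (f - w))" by simp
        also have "\<dots> = g - w" unfolding eq using pos by simp
        finally show ?thesis by simp
      qed
      have e2: "f = w + (s' / s) *\<^sub>R (g - w)"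
      proof -
        have "(s' / s) *\<^sub>R (g - w) = (1 / s) *\<^sub>R (s' *\<^sub>R (g - w))" by simp
        also have "\<dots> = f - w" unfolding eq[symmetric] using pos by simp
        finally show ?thesis by simp
      qed
      have "f = g"
      proof (cases "s' \<le> s")
        case True
        then show ?thesis
          using ray[OF F s(2) fg(2) e1] pos by simp
      next
        case False
        then show ?thesis
          using ray[OF G s'(2) fg(1) e2] pos by simp
      qed
      have "s \<le> 1"
      proof (rule ccontr)
        assume "\<not> s \<le> 1"
        then have "f = z"
          using ray[OF F s(2) _ s(3)] z cnsub[OF F] by auto
        then have "(1 - s) *\<^sub>R (f - w) = 0"
          using s(3) by (simp add: algebra_simps)
        then show False
          using \<open>\<not> s \<le> 1\<close> False \<open>f = z\<close> by auto
      qed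
      then have "z = (1 - s) *\<^sub>R w + s *\<^sub>R f"
        using s(3) by (simp add: algebra_simps)
      moreover have "w \<in> convex hull (insert w (F \<inter> G))" "f \<in> convex hull (insert w (F \<inter> G))"
        using \<open>f = g\<close> s(2) s'(2) by (auto intro: hull_inc)
      ultimately show ?thesis
        using convexD_alt[OF convex_convex_hull, of w "insert w (F \<inter> G)" f s] s(1) \<open>s \<le> 1\<close> by simp
    qed
  qed
  have face: "(cn F \<inter> cn G) face_of cn F" if F: "F \<in> \<F>" and G: "G \<in> \<F>" for F G
  proof -
    obtain C where C: "\<not> affine_dependent (insert w C)" "F = convex hull C"
      using base[OF F] by blast
    have indC: "\<not> affine_dependent C"
      using C(1) affine_independent_subset by blast
    have "(F \<inter> G) face_of P"
      using F G by (auto simp: \<F>_def facet_of_def intro: face_of_Int)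
    then have "(F \<inter> G) face_of F"
      by (rule face_of_subset) (use F in \<open>auto simp: \<F>_def dest: facet_of_imp_subset\<close>)
    then obtain c where c: "c \<subseteq> C" "F \<inter> G = convex hull c"
      using face_of_convex_hull_affine_independent[OF indC] C(2) by blast
    have e: "convex hull (insert w (F \<inter> G)) = convex hull (insert w c)"
      unfolding c(2) by (rule hull_insert[symmetric])
    have "cn F \<inter> cn G = convex hull (insert w c)"
    proof
      show "cn F \<inter> cn G \<subseteq> convex hull (insert w c)"
        using inter[OF F G] e by simp
      show "convex hull (insert w c) \<subseteq> cn F \<inter> cn G"
        unfolding e[symmetric] cn_def by (intro Int_greatest hull_mono insert_mono) auto
    qed
    moreover have "insert w c \<subseteq> insert w C" using c(1) by blast
    moreover have "cn F = convex hull (insert w C)"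
      using cnC C(2) by simp
    moreover have "(convex hull (insert w c)) face_of (convex hull (insert w C))"
      using face_of_convex_hull_affine_independent[OF C(1)] \<open>insert w c \<subseteq> insert w C\<close> by blast
    ultimately show ?thesis by simp
  qed
  have ad3: "aff_dim (cn F) = 3" if "F \<in> \<F>" for F
    using simp3[OF that] aff_dim_simplex by auto
  \<comment> \<open>Overlapping interiors make the intersection three-dimensional; being a face of
    both cones, it then equals both.\<close>
  have disj: "interior (cn F) \<inter> interior (cn G) = {}"
    if F: "F \<in> \<F>" and G: "G \<in> \<F>" and ne: "cn F \<noteq> cn G" for F G
  proof (rule ccontr)
    assume "interior (cn F) \<inter> interior (cn G) \<noteq> {}"
    then have "interior (cn F \<inter> cn G) \<noteq> {}" by simp
    then have "aff_dim (cn F \<inter> cn G) = 3"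
      using aff_dim_nonempty_interior[of "cn F \<inter> cn G"] by simp
    then have "\<not> aff_dim (cn F \<inter> cn G) < aff_dim (cn F)" "\<not> aff_dim (cn G \<inter> cn F) < aff_dim (cn G)"
      using ad3[OF F] ad3[OF G] by (auto simp: Int_commute)
    moreover have "convex (cn F)" "convex (cn G)" by (simp_all add: cn_def)
    ultimately have "cn F \<inter> cn G = cn F" "cn G \<inter> cn F = cn G"
      using face_of_aff_dim_lt[OF _ face[OF F G]] face_of_aff_dim_lt[OF _ face[OF G F]] by blast+
    then show False using ne by blast
  qed
  have cover: "\<Union> (cn ` \<F>) = P"
  proof
    show "\<Union> (cn ` \<F>) \<subseteq> P" using cnsub by blast
    have other: "z \<in> \<Union> (cn ` \<F>)" if z: "z \<in> P" "z \<noteq> w" for z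
    proof -
      obtain F t b where F: "F facet_of P" "w \<notin> F" "b \<in> F" "1 \<le> t" "b = w + t *\<^sub>R (z - w)"
        using polytope_ray_facet[OF P wP z] by blast
      have "z = (1 - 1 / t) *\<^sub>R w + (1 / t) *\<^sub>R b"
        using F(4) by (simp add: F(5) algebra_simps)
      moreover have "w \<in> cn F" "b \<in> cn F"
        using F(3) by (auto simp: cn_def intro: hull_inc)
      ultimately have "z \<in> cn F"
        using convexD_alt[of "cn F" w b "1 / t"] F(4) by (simp add: cn_def)
      then show ?thesis
        using F by (auto simp: \<F>_def)
    qed
    have "\<exists>z\<in>P. z \<noteq> w"
    proof (rule ccontr)
      assume "\<not> ?thesis"
      then have "P = {w}" using wP by blast
      then show False using P(2) by simp
    qed
    then obtain F where "F \<in> \<F>" using other by blast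
    then have "w \<in> \<Union> (cn ` \<F>)" by (auto simp: cn_def intro: hull_inc)
    then show "P \<subseteq> \<Union> (cn ` \<F>)" using other by blast
  qed
  have "triangulation_of P (cn ` \<F>)"
    unfolding triangulation_of_def dissection_def triangulation_def
  proof (intro conjI ballI allI impI)
    show "finite (cn ` \<F>)" "finite (cn ` \<F>)" using finF by auto
    show "\<Union> (cn ` \<F>) = P" by (rule cover)
    show "3 simplex T" "vertices T \<subseteq> vertices P" if "T \<in> cn ` \<F>" for T
      using that simp3 vert by blast+
    show "\<exists>n. n simplex T" if "T \<in> cn ` \<F>" for T
      using that simp3 by blast
    show "interior S \<inter> interior T = {}" if "S \<in> cn ` \<F>" "T \<in> cn ` \<F>" "S \<noteq> T" for S T
      using that disj by blast
    show "(T \<inter> T') face_of T" if "T \<in> cn ` \<F> \<and> T' \<in> cn ` \<F>" for T T'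
      using that face by blast
  qed
  then show ?thesis using that by blast
qed

text \<open>A tetrahedron is the hull of its vertices, so every dissection is a subset of one fixed
  finite set of hulls.\<close>

lemma finite_dissection_cards:
  assumes "finite (vertices P)"
  shows "finite {card D |D. dissection P D}"
proof -
  let ?U = "(hull) convex ` Pow (vertices P)"
  have "D \<subseteq> ?U" if "dissection P D" for D
  proof
    fix T assume "T \<in> D"
    then have "3 simplex T" "vertices T \<subseteq> vertices P"
      using that by (auto simp: dissection_def)
    then show "T \<in> ?U"
      using simplex_vertices(4)[of T] by (intro image_eqI[of _ _ "vertices T"]) auto
  qed
  moreover have "finite ?U" using assms by simp
  ultimately have "card D \<le> card ?U" if "dissection P D" for D
    using that by (simp add: card_mono)
  then have "{card D |D. dissection P D} \<subseteq> {..card ?U}"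
    by auto
  then show ?thesis
    by (rule finite_subset) simp
qed

subsection \<open>Noncrossing chords and triangles\<close>

text \<open>Indices number the vertices around the polygon, so two chords cross exactly when their
  ends alternate. Every pair of elements of a member counts as a chord, which treats edges and
  triangles alike.\<close>

definition noncrossing :: "nat set set \<Rightarrow> bool" where
  "noncrossing F \<longleftrightarrow> (\<forall>s\<in>F. \<forall>t\<in>F. \<forall>a\<in>s. \<forall>c\<in>t. \<forall>b\<in>s. \<forall>d\<in>t. \<not> (a < c \<and> c < b \<and> b < d))"

lemma noncrossingD:
  "noncrossing F \<Longrightarrow> s \<in> F \<Longrightarrow> t \<in> F \<Longrightarrow> a \<in> s \<Longrightarrow> c \<in> t \<Longrightarrow> b \<in> s \<Longrightarrow> d \<in> t
    \<Longrightarrow> a < c \<Longrightarrow> c < b \<Longrightarrow> b < d \<Longrightarrow> False"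
  unfolding noncrossing_def by (drule bspec, assumption)+ simp

lemma noncrossing_subset: "noncrossing F \<Longrightarrow> G \<subseteq> F \<Longrightarrow> noncrossing G"
  unfolding noncrossing_def by (meson subsetD)

lemma card_3_sorted:
  fixes t :: "nat set"
  assumes "card t = 3"
  obtains i j k where "i < j" "j < k" "t = {i, j, k}"
proof -
  obtain a b c where abc: "t = {a, b, c}" "a \<noteq> b" "b \<noteq> c" "a \<noteq> c"
    using assms by (auto simp: card_3_iff)
  consider "a < b \<and> b < c" | "a < c \<and> c < b" | "b < a \<and> a < c" | "b < c \<and> c < a"
    | "c < a \<and> a < b" | "c < b \<and> b < a"
    using abc by linarith
  then show ?thesis
    using that abc(1) by cases (metis insert_commute)+
qed

text \<open>A triangle is determined by its middle vertex.\<close>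

lemma card_triangles_le:
  assumes "finite I" "2 \<le> card I" "noncrossing F" "\<And>t. t \<in> F \<Longrightarrow> t \<subseteq> I \<and> card t = 3"
  shows "card F + 2 \<le> card I"
proof -
  have "\<forall>t\<in>F. \<exists>j. \<exists>i k. i < j \<and> j < k \<and> t = {i, j, k}"
    using assms(4) card_3_sorted by metis
  then obtain mid where mid: "\<And>t. t \<in> F \<Longrightarrow> \<exists>i k. i < mid t \<and> mid t < k \<and> t = {i, mid t, k}"
    by metis
  have ne: "I \<noteq> {}" using assms(2) by auto
  have "inj_on mid F"
  proof (rule inj_onI)
    fix s t assume st: "s \<in> F" "t \<in> F" "mid s = mid t"
    define j where "j = mid s"
    obtain i k where s: "i < j" "j < k" "s = {i, j, k}" using mid[OF st(1)] unfolding j_def by blast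
    obtain i' k' where t: "i' < j" "j < k'" "t = {i', j, k'}"
      using mid[OF st(2)] unfolding j_def st(3) by blast
    have "\<not> i < i'"
      using noncrossingD[OF assms(3) st(1,2), of i i' j k'] s t by auto
    moreover have "\<not> i' < i"
      using noncrossingD[OF assms(3) st(2,1), of i' i j k] s t by auto
    moreover have "\<not> k < k'"
      using noncrossingD[OF assms(3) st(1,2), of i j k k'] s t noncrossingD[OF assms(3) st(2,1), of i' i j k]
        noncrossingD[OF assms(3) st(1,2), of j j k k'] by force
    moreover have "\<not> k' < k"
      using noncrossingD[OF assms(3) st(2,1), of i' j k' k] s t by force
    ultimately show "s = t" using s t by simp
  qed
  moreover have "mid ` F \<subseteq> I - {Min I, Max I}"
  proof
    fix j assume "j \<in> mid ` F"
    then obtain t i k where t: "t \<in> F" "i < j" "j < k" "t = {i, j, k}" using mid by blast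
    then have "i \<in> I" "j \<in> I" "k \<in> I" using assms(4) by auto
    then have "Min I \<le> i" "k \<le> Max I" using assms(1) by auto
    then show "j \<in> I - {Min I, Max I}" using t \<open>j \<in> I\<close> by auto
  qed
  ultimately have "card F \<le> card (I - {Min I, Max I})"
    using assms(1) by (metis card_image card_mono finite_Diff)
  moreover have "Min I \<noteq> Max I"
  proof
    assume e: "Min I = Max I"
    have "I \<subseteq> {Max I}"
    proof
      fix x assume "x \<in> I"
      then have "Min I \<le> x" "x \<le> Max I" using assms(1) by auto
      then show "x \<in> {Max I}" using e by simp
    qed
    then have "card I \<le> 1" using card_mono[of "{Max I}" I] by simp
    then show False using assms(2) by simp
  qed
  moreover have "card (I - {Min I, Max I}) = card I - card {Min I, Max I}"
    using assms(1) ne by (intro card_Diff_subset) auto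
  ultimately show ?thesis using assms(2) by simp
qed

text \<open>\<open>R J\<close> will say that a given point lies in the hull of the vertices indexed by \<open>J\<close>.\<close>

lemma card_triangles_avoiding_le:
  assumes "finite I" "3 \<le> card I" "noncrossing F" "\<And>t. t \<in> F \<Longrightarrow> t \<subseteq> I \<and> card t = 3" "R I"
    and split: "\<And>J s t. J \<subseteq> I \<Longrightarrow> s \<in> J \<Longrightarrow> t \<in> J \<Longrightarrow> s < t \<Longrightarrow> R J
      \<Longrightarrow> R (J \<inter> {s..t}) \<or> R (J - {s<..<t})"
    and avoid: "\<And>t s. t \<in> F \<Longrightarrow> R s \<Longrightarrow> \<not> s \<subseteq> t"
  shows "card F + 3 \<le> card I"
  using assms
proof (induction "card I" arbitrary: I F rule: less_induct)
  case less
  note fin = less.prems(1) and nc = less.prems(3) and tri = less.prems(4)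
  have finF: "finite F"
    using tri fin by (auto intro: finite_subset[of F "Pow I"])
  show ?case
  proof (cases "F = {}")
    case True
    then show ?thesis using less.prems(2) by simp
  next
    case False
    then obtain t where t: "t \<in> F" by blast
    obtain i j k where ijk: "i < j" "j < k" "t = {i, j, k}"
      using card_3_sorted tri[OF t] by metis
    have inI: "i \<in> I" "j \<in> I" "k \<in> I" using tri[OF t] ijk by auto
    \<comment> \<open>The triangle \<open>t\<close> leaves three subpolygons, each sharing two
      vertices with it, so their sizes sum to \<open>card I + 3\<close>. The plain bound takes 2 off
      each, which together with \<open>t\<close> itself gives \<open>card I - 2\<close>; the
      subpolygon that satisfies \<open>R\<close> loses 3.\<close>
    define Ia where "Ia = I \<inter> {i..j}"
    define Ib where "Ib = I \<inter> {j..k}"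
    define Ic where "Ic = I - {i<..<k}"
    define G where "G = (\<lambda>J. {s \<in> F. s \<subseteq> J})"
    have cards: "card Ia + card Ib + card Ic = card I + 3"
    proof -
      have 1: "card (I \<inter> {i..k}) + 1 = card Ia + card Ib"
      proof -
        have "Ia \<union> Ib = I \<inter> {i..k}" "Ia \<inter> Ib = {j}"
          using ijk inI by (auto simp: Ia_def Ib_def)
        then show ?thesis
          using card_Un_Int[of Ia Ib] fin by (simp add: Ia_def Ib_def)
      qed
      have 2: "card (I \<inter> {i..k}) + card Ic = card I + 2"
      proof -
        have "(I \<inter> {i..k}) \<union> Ic = I" "(I \<inter> {i..k}) \<inter> Ic = {i, k}"
          using ijk inI by (auto simp: Ic_def)
        then show ?thesis
          using card_Un_Int[of "I \<inter> {i..k}" Ic] fin ijk by (simp add: Ic_def)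
      qed
      show ?thesis using 1 2 by simp
    qed
    have two: "2 \<le> card J" if "J \<in> {Ia, Ib, Ic}" for J
    proof -
      have "\<exists>x y. x \<noteq> y \<and> {x, y} \<subseteq> J"
        using that ijk inI by (auto simp: Ia_def Ib_def Ic_def) (metis less_or_eq_imp_le nat_less_le order.strict_trans less_irrefl)+
      then obtain x y where "x \<noteq> y" "{x, y} \<subseteq> J" by blast
      moreover have "finite J" using that fin by (auto simp: Ia_def Ib_def Ic_def)
      ultimately show ?thesis using card_mono[of J "{x, y}"] by simp
    qed
    have sub: "J \<subseteq> I" if "J \<in> {Ia, Ib, Ic}" for J
      using that by (auto simp: Ia_def Ib_def Ic_def)
    have cover: "F \<subseteq> {t} \<union> (G Ia \<union> G Ib \<union> G Ic)"
    proof
      fix s assume s: "s \<in> F"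
      have sI: "s \<subseteq> I" using tri[OF s] by blast
      note c1 = noncrossingD[OF nc s t] and c2 = noncrossingD[OF nc t s]
      have loc: "s \<subseteq> {p..q}" if "x \<in> s" "p < x" "x < q" "p \<in> t" "q \<in> t" for x p q
      proof
        fix y assume "y \<in> s"
        then show "y \<in> {p..q}"
          using c1[of y p x q] c2[of p x q y] that by (auto simp: not_less not_le) (meson leI)+
      qed
      consider (a) x where "x \<in> s" "i < x" "x < j" | (b) x where "x \<in> s" "j < x" "x < k"
        | (c) "\<forall>x\<in>s. \<not> (i < x \<and> x < j) \<and> \<not> (j < x \<and> x < k)" by blast
      then show "s \<in> {t} \<union> (G Ia \<union> G Ib \<union> G Ic)"
      proof cases
        case a
        then show ?thesis using loc[of x i j] ijk s sI by (auto simp: G_def Ia_def)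
      next
        case b
        then show ?thesis using loc[of x j k] ijk s sI by (auto simp: G_def Ib_def)
      next
        case c
        show ?thesis
        proof (cases "j \<in> s")
          case True
          then have "s \<subseteq> {i..k}" using loc[of j i k] ijk by simp
          have "s \<subseteq> t"
          proof
            fix x assume x: "x \<in> s"
            then have "i \<le> x" "x \<le> k" using \<open>s \<subseteq> {i..k}\<close> by auto
            moreover have "\<not> (i < x \<and> x < j)" "\<not> (j < x \<and> x < k)" using c x by blast+
            ultimately have "x = i \<or> x = j \<or> x = k" by linarith
            then show "x \<in> t" using ijk by blast
          qed
          moreover have "finite t" using ijk by simp
          ultimately have "s = t"
            using tri[OF s] tri[OF t] card_subset_eq[of t s] by simp
          then show ?thesis by simp
        next
          case False
          have "s \<subseteq> Ic"
          proof
            fix x assume x: "x \<in> s"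
            then have "\<not> (i < x \<and> x < j)" "\<not> (j < x \<and> x < k)" "x \<noteq> j" using c False by blast+
            then have "\<not> (i < x \<and> x < k)" by linarith
            then show "x \<in> Ic" using x sI by (auto simp: Ic_def)
          qed
          then show ?thesis using s by (simp add: G_def)
        qed
      qed
    qed
    have finG: "finite (G J)" for J using finF by (simp add: G_def)
    have cF: "card F \<le> 1 + (card (G Ia) + card (G Ib) + card (G Ic))"
    proof -
      have "card F \<le> card ({t} \<union> (G Ia \<union> G Ib \<union> G Ic))"
        using cover finG by (intro card_mono) auto
      also have "\<dots> \<le> card {t} + card (G Ia \<union> G Ib \<union> G Ic)" by (rule card_Un_le)
      also have "\<dots> \<le> 1 + (card (G Ia) + card (G Ib) + card (G Ic))"
        using card_Un_le[of "G Ia \<union> G Ib" "G Ic"] card_Un_le[of "G Ia" "G Ib"] by simp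
      finally show ?thesis .
    qed
    have b2: "card (G J) + 2 \<le> card J" if J: "J \<in> {Ia, Ib, Ic}" for J
    proof (rule card_triangles_le)
      show "finite J" using sub[OF J] fin finite_subset by blast
      show "2 \<le> card J" using two[OF J] .
      show "noncrossing (G J)" using noncrossing_subset[OF nc] by (auto simp: G_def)
      show "s \<subseteq> J \<and> card s = 3" if "s \<in> G J" for s using that tri by (auto simp: G_def)
    qed
    have b3: "card (G J) + 3 \<le> card J" if J: "J \<in> {Ia, Ib, Ic}" and R: "R J" for J
    proof (rule less.hyps)
      show "card J < card I" using cards two[of Ia] two[of Ib] two[of Ic] J by auto
      show "finite J" using sub[OF J] fin finite_subset by blast
      \<comment> \<open>A two-element \<open>J\<close> would be an edge of \<open>t\<close>, and
        \<open>R J\<close> would contradict the avoidance hypothesis.\<close>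
      show "3 \<le> card J"
      proof (rule ccontr)
        assume "\<not> 3 \<le> card J"
        then have c2: "card J = 2" using two[OF J] by simp
        have "\<exists>x y. x \<noteq> y \<and> {x, y} \<subseteq> J \<and> {x, y} \<subseteq> t"
        proof -
          have "{i, j} \<subseteq> Ia" "{j, k} \<subseteq> Ib" "{i, k} \<subseteq> Ic"
            using ijk inI by (auto simp: Ia_def Ib_def Ic_def)
          moreover have "i \<noteq> j" "j \<noteq> k" "i \<noteq> k" using ijk by auto
          ultimately show ?thesis using J ijk(3)
            by (metis insertE insert_iff empty_iff insert_subset subset_insertI singletonD)
        qed
        then obtain x y where xy: "x \<noteq> y" "{x, y} \<subseteq> J" "{x, y} \<subseteq> t" by blast
        moreover have "finite J" using sub[OF J] fin finite_subset by blast
        ultimately have "J = {x, y}" using c2 card_subset_eq[of J "{x, y}"] by auto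
        then show False using less.prems(7)[OF t R] xy by simp
      qed
      show "noncrossing (G J)" using noncrossing_subset[OF nc] by (auto simp: G_def)
      show "s \<subseteq> J \<and> card s = 3" if "s \<in> G J" for s using that tri by (auto simp: G_def)
      show "R J" by (rule R)
      show "R (K \<inter> {a..b}) \<or> R (K - {a<..<b})" if "K \<subseteq> J" "a \<in> K" "b \<in> K" "a < b" "R K" for K a b
        using less.prems(6)[of K a b] that sub[OF J] by blast
      show "\<not> s' \<subseteq> s" if "s \<in> G J" "R s'" for s s' using less.prems(7) that by (auto simp: G_def)
    qed
    \<comment> \<open>Cuts along the three edges of \<open>t\<close> in turn; what remains if all
      three subpolygons fail is \<open>t\<close> itself, which avoidance excludes.\<close>
    have "R Ia \<or> R Ib \<or> R Ic"
    proof (rule ccontr)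
      assume n: "\<not> ?thesis"
      have "R (I \<inter> {i..k})"
        using less.prems(6)[of I i k] less.prems(5) inI ijk n by (auto simp: Ic_def)
      then have "R ((I \<inter> {i..k}) \<inter> {i..j}) \<or> R ((I \<inter> {i..k}) - {i<..<j})"
        using ijk inI by (intro less.prems(6)) auto
      moreover have "(I \<inter> {i..k}) \<inter> {i..j} = Ia" using ijk by (auto simp: Ia_def)
      ultimately have "R ((I \<inter> {i..k}) - {i<..<j})" using n by simp
      then have "R (((I \<inter> {i..k}) - {i<..<j}) \<inter> {j..k}) \<or> R ((I \<inter> {i..k}) - {i<..<j} - {j<..<k})"
        using ijk inI by (intro less.prems(6)) auto
      moreover have "((I \<inter> {i..k}) - {i<..<j}) \<inter> {j..k} = Ib" using ijk by (auto simp: Ib_def)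
      ultimately have "R ((I \<inter> {i..k}) - {i<..<j} - {j<..<k})" using n by simp
      then show False using less.prems(7)[OF t] ijk by fastforce
    qed
    then show ?thesis using cF cards b2[of Ia] b2[of Ib] b2[of Ic] b3[of Ia] b3[of Ib] b3[of Ic] by auto
  qed
qed

text \<open>A chord \<open>{i, j}\<close> with \<open>i < j\<close> is determined by the largest \<open>l < j\<close> that is joined to
  \<open>i\<close> by a chord, or \<open>i + 1\<close> if there is none.\<close>

lemma card_diagonals_le:
  assumes "3 \<le> m" "noncrossing E" "\<And>e. e \<in> E \<Longrightarrow> \<exists>i j. e = {i, j} \<and> i + 2 \<le> j \<and> j < m"
    and "{0, m - 1} \<notin> E"
  shows "card E + 3 \<le> m"
proof -
  \<comment> \<open>The outer edge crosses nothing, so it may be added; it takes up one of the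
    \<open>m - 2\<close> values available. In a full triangulation the value assigned to a chord is
    the third corner of the triangle below it.\<close>
  define L where "L = insert {0, m - 1} E"
  have L: "\<exists>i j. e = {i, j} \<and> i + 2 \<le> j \<and> j < m" if "e \<in> L" for e
  proof (cases "e = {0, m - 1}")
    case True
    then show ?thesis using assms(1) by (intro exI[of _ 0] exI[of _ "m - 1"]) auto
  next
    case False
    then show ?thesis using that assms(3) by (auto simp: L_def)
  qed
  have ncL: "noncrossing L"
    unfolding noncrossing_def
  proof (intro ballI notI)
    fix s t a c b d
    assume st: "s \<in> L" "t \<in> L" and el: "a \<in> s" "c \<in> t" "b \<in> s" "d \<in> t" and o: "a < c \<and> c < b \<and> b < d"
    obtain i j where "s = {i, j}" "i + 2 \<le> j" "j < m" using L st by blast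
    then have "b < m" using el by auto
    obtain i' j' where "t = {i', j'}" "i' + 2 \<le> j'" "j' < m" using L st by blast
    then have "d < m" using el by auto
    then have "s \<noteq> {0, m - 1}" "t \<noteq> {0, m - 1}" using el o by auto
    then show False
      using noncrossingD[OF assms(2), of s t a c b d] st el o by (auto simp: L_def)
  qed
  define good where "good = (\<lambda>i j l. i < l \<and> l < j \<and> (l = i + 1 \<or> {i, l} \<in> L) \<and> (\<forall>l'. l < l' \<and> l' < j \<longrightarrow> {i, l'} \<notin> L))"
  have "\<exists>l. \<exists>i j. e = {i, j} \<and> j < m \<and> good i j l" if eL: "e \<in> L" for e
  proof -
    obtain i j where e: "e = {i, j}" "i + 2 \<le> j" "j < m" using L[OF eL] by blast
    define A where "A = {l. i < l \<and> l < j \<and> (l = i + 1 \<or> {i, l} \<in> L)}"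
    have fA: "finite A" unfolding A_def by (rule finite_subset[of _ "{..<j}"]) auto
    have "i + 1 \<in> A" using e by (simp add: A_def)
    define M where "M = Max A"
    have "M \<in> A" using Max_in[OF fA] \<open>i + 1 \<in> A\<close> unfolding M_def by blast
    then have M: "i < M" "M < j" "M = i + 1 \<or> {i, M} \<in> L" by (auto simp: A_def)
    have "{i, l'} \<notin> L" if l': "M < l'" "l' < j" for l'
    proof
      assume "{i, l'} \<in> L"
      then have "l' \<in> A" using l' M by (simp add: A_def)
      then have "l' \<le> M" using Max_ge[OF fA] unfolding M_def by blast
      then show False using l' by simp
    qed
    then have "good i j M" using M unfolding good_def by blast
    then show ?thesis using e by blast
  qed
  then obtain f where f: "\<And>e. e \<in> L \<Longrightarrow> \<exists>i j. e = {i, j} \<and> j < m \<and> good i j (f e)"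
    by metis
  have "inj_on f L"
  proof (rule inj_onI)
    fix s t assume st: "s \<in> L" "t \<in> L" "f s = f t"
    obtain i j where s: "s = {i, j}" "good i j (f s)" using f[OF st(1)] by blast
    obtain i' j' where t: "t = {i', j'}" "good i' j' (f s)" using f[OF st(2)] st(3) by auto
    have lt: "i < f s" "f s < j" "i' < f s" "f s < j'" using s t by (auto simp: good_def)
    \<comment> \<open>With \<open>i'\<close> strictly between \<open>i\<close> and
      \<open>f s\<close>, the value \<open>f s\<close> exceeds \<open>i + 1\<close> and so comes
      from a chord \<open>{i, f s}\<close>, which crosses \<open>t\<close>.\<close>
    have "\<not> i < i'"
    proof
      assume "i < i'"
      then have "{i, f s} \<in> L" using s lt by (auto simp: good_def)
      then show False using noncrossingD[OF ncL _ st(2), of "{i, f s}" i i' "f s" j'] \<open>i < i'\<close> lt t by auto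
    qed
    moreover have "\<not> i' < i"
    proof
      assume "i' < i"
      then have "{i', f s} \<in> L" using t lt by (auto simp: good_def)
      then show False using noncrossingD[OF ncL _ st(1), of "{i', f s}" i' i "f s" j] \<open>i' < i\<close> lt s by auto
    qed
    ultimately have ii: "i = i'" by simp
    have "\<not> j < j'" using t st(1) s lt ii by (auto simp: good_def)
    moreover have "\<not> j' < j" using s st(2) t lt ii by (auto simp: good_def)
    ultimately show "s = t" using s t ii by simp
  qed
  moreover have "f ` L \<subseteq> {1..<m - 1}"
  proof
    fix l assume "l \<in> f ` L"
    then obtain i j where "j < m" "good i j l" using f by blast
    then show "l \<in> {1..<m - 1}" by (auto simp: good_def)
  qed
  ultimately have "card L \<le> card {1..<m - 1}"
    by (metis card_image card_mono finite_atLeastLessThan)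
  moreover have "finite E"
    by (rule finite_subset[of _ "Pow {..<m}"]) (use assms(3) in force)+
  ultimately show ?thesis
    using assms(1,4) by (simp add: L_def)
qed

subsection \<open>Orthonormal coordinates and points on a circle\<close>

lemma orthonormal_expand:
  fixes a b d x :: space
  assumes "norm a = 1" "norm b = 1" "norm d = 1" "a \<bullet> b = 0" "a \<bullet> d = 0" "b \<bullet> d = 0"
  shows "x = (x \<bullet> a) *\<^sub>R a + (x \<bullet> b) *\<^sub>R b + (x \<bullet> d) *\<^sub>R d"
proof -
  have ne: "a \<noteq> b" "a \<noteq> d" "b \<noteq> d"
    using assms by (auto simp: norm_eq_1)
  have po: "pairwise orthogonal {a, b, d}"
    using assms by (auto simp: pairwise_def orthogonal_def inner_commute)
  have "0 \<notin> {a, b, d}" using assms by auto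
  then have "independent {a, b, d}"
    using pairwise_orthogonal_independent[OF po] by blast
  moreover have "card {a, b, d} = dim (UNIV :: space set)"
    using ne by simp
  ultimately have "UNIV \<subseteq> span {a, b, d}"
    using card_eq_dim[of "{a, b, d}" UNIV] by blast
  then have "(\<Sum>i\<in>{a, b, d}. (x \<bullet> i) *\<^sub>R i) = x"
    using orthonormal_basis_expand[OF po, of x] assms by auto
  then show ?thesis using ne by (simp add: add.assoc)
qed

definition circle_pt :: "space \<Rightarrow> space \<Rightarrow> space \<Rightarrow> real \<Rightarrow> real \<Rightarrow> space" where
  "circle_pt c e f r a = c + (r * cos a) *\<^sub>R e + (r * sin a) *\<^sub>R f"

lemma circle_pt_minus: "circle_pt c e (- f) r a = circle_pt c e f r (- a)"
  by (simp add: circle_pt_def)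

lemma circle_pt_swap: "circle_pt c f e r a = circle_pt c e f r (pi / 2 - a)"
  by (simp add: circle_pt_def cos_diff sin_diff add.commute add.left_commute)

lemma circle_pt_2pi: "circle_pt c e f r (a + 2 * pi * of_int n) = circle_pt c e f r a"
proof -
  have "sin (a + 2 * pi * of_int n) = sin a \<and> cos (a + 2 * pi * of_int n) = cos a"
    using sin_cos_eq_iff by blast
  then show ?thesis by (simp add: circle_pt_def)
qed

text \<open>Indexing by all integers makes the vertex set visibly invariant under shift and negation
  of the index, which the changes of coordinates below exploit.\<close>

lemma circle_pt_image:
  assumes "0 < m"
  shows "(\<lambda>k::nat. circle_pt c e f r (\<theta> + 2 * pi * real k / m)) ` {..<m} =
    range (\<lambda>k::int. circle_pt c e f r (\<theta> + 2 * pi * of_int k / m))" (is "?L = ?R")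
proof
  show "?L \<subseteq> ?R"
  proof
    fix x assume "x \<in> ?L"
    then obtain k :: nat where "x = circle_pt c e f r (\<theta> + 2 * pi * real k / m)" by blast
    then show "x \<in> ?R" by (intro range_eqI[of _ _ "int k"]) simp
  qed
  show "?R \<subseteq> ?L"
  proof
    fix x assume "x \<in> ?R"
    then obtain k :: int where k: "x = circle_pt c e f r (\<theta> + 2 * pi * of_int k / m)" by blast
    define n where "n = nat (k mod int m)"
    have n: "int n = k mod int m" "n < m" using assms by (auto simp: n_def nat_less_iff)
    have kk: "k = int n + int m * (k div int m)" using n(1) by simp
    have "\<theta> + 2 * pi * of_int k / m = (\<theta> + 2 * pi * real n / m) + 2 * pi * of_int (k div int m)"
      by (subst kk) (use assms in \<open>simp add: field_simps\<close>)
    then have "x = circle_pt c e f r (\<theta> + 2 * pi * real n / m)" unfolding k using circle_pt_2pi by metis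
    then show "x \<in> ?L" using n(2) by blast
  qed
qed

lemma affine_fun_linear_comb:
  "affine_fun f \<Longrightarrow> affine_fun g \<Longrightarrow> affine_fun (\<lambda>x. k * f x + l * g x)"
  by (intro affine_fun_add affine_fun_scale)

text \<open>For one half of the polytope \<open>S\<close> is measured along its edge
  \<open>w1 w2\<close>, \<open>C\<close> across it within the plane of the polygon, and
  \<open>Z\<close> is the height. The letters recall cosine and sine of the angle of a
  vertex.\<close>

locale frame =
  fixes ec es ez c :: space
  assumes orthonormal: "norm ec = 1" "norm es = 1" "norm ez = 1" "ec \<bullet> es = 0" "ec \<bullet> ez = 0" "es \<bullet> ez = 0"
begin

abbreviation "C \<equiv> coord c ec"
abbreviation "S \<equiv> coord c es"
abbreviation "Z \<equiv> coord c ez"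

lemma coords_eqI: "C x = C y \<Longrightarrow> S x = S y \<Longrightarrow> Z x = Z y \<Longrightarrow> x = y"
  using orthonormal_expand[OF orthonormal, of "x - c"] orthonormal_expand[OF orthonormal, of "y - c"]
  unfolding coord_def by (metis diff_add_cancel)

lemma norm_coords: "(norm (x - c))\<^sup>2 = (C x)\<^sup>2 + (S x)\<^sup>2 + (Z x)\<^sup>2"
proof -
  have "(norm (x - c))\<^sup>2 = (x - c) \<bullet> (x - c)" by (simp add: power2_norm_eq_inner)
  also have "\<dots> = (x - c) \<bullet> (((x - c) \<bullet> ec) *\<^sub>R ec + ((x - c) \<bullet> es) *\<^sub>R es + ((x - c) \<bullet> ez) *\<^sub>R ez)"
    using orthonormal_expand[OF orthonormal, of "x - c"] by simp
  finally show ?thesis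
    by (simp add: inner_add_right coord_def power2_eq_square)
qed

lemma circle_coords [simp]:
  "C (circle_pt c ec es r a) = r * cos a"
  "S (circle_pt c ec es r a) = r * sin a"
  "Z (circle_pt c ec es r a) = 0"
  using orthonormal by (simp_all add: circle_pt_def coord_def inner_add_left norm_eq_1 inner_commute[of es ec])

lemma between_segment:
  assumes "C a = C x" "C b = C x" "Z a = Z x" "Z b = Z x" "(S a \<le> S x \<and> S x \<le> S b) \<or> (S b \<le> S x \<and> S x \<le> S a)"
  shows "x \<in> closed_segment a b"
proof (cases "S a = S b")
  case True
  then have "x = a" using assms by (intro coords_eqI) auto
  then show ?thesis by simp
next
  case False
  define t where "t = (S x - S a) / (S b - S a)"
  have t: "0 \<le> t" "t \<le> 1"
    using assms(5) False by (auto simp: t_def divide_simps)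
  have "x = (1 - t) *\<^sub>R a + t *\<^sub>R b"
  proof (rule coords_eqI)
    have "t * (S b - S a) = S x - S a" using False by (simp add: t_def)
    then show "S x = S ((1 - t) *\<^sub>R a + t *\<^sub>R b)"
      unfolding affine_fun_segment[OF affine_fun_coord] by (simp add: algebra_simps)
  qed (simp_all only: affine_fun_segment[OF affine_fun_coord] assms, simp_all add: algebra_simps)
  then show ?thesis using t by (auto simp: in_segment)
qed

end

text \<open>An odd multiple of \<open>pi / m\<close> is at least \<open>pi / m\<close> away from
  every multiple of \<open>2 * pi\<close>, which is an even multiple of it.\<close>

lemma cos_odd_le:
  assumes "odd (n::int)" "0 < (m::nat)"
  shows "cos (of_int n * pi / m) \<le> cos (pi / m)"
proof -
  define k where "k = n mod (2 * int m)"
  have k: "0 \<le> k" "k < 2 * int m" using assms(2) by (auto simp: k_def)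
  have "odd k" using assms(1) by (simp add: k_def odd_iff_mod_2_eq_one mod_mod_cancel)
  then have k1: "1 \<le> k" using k(1) by (cases "k = 0") auto
  have k2: "k \<le> 2 * int m - 1" using k by simp
  have n: "n = k + 2 * int m * (n div (2 * int m))" by (simp add: k_def)
  have "of_int n * pi / m = of_int k * pi / m + 2 * pi * of_int (n div (2 * int m))"
    by (subst n) (use assms(2) in \<open>simp add: field_simps\<close>)
  then have c: "cos (of_int n * pi / m) = cos (of_int k * pi / m)"
    using sin_cos_eq_iff by metis
  have p: "pi / m \<le> of_int k * pi / m"
    using k1 assms(2) by (simp add: divide_right_mono)
  show ?thesis
  proof (cases "k \<le> int m")
    case True
    then have "real_of_int k * pi \<le> m * pi"
      by (intro mult_right_mono) (auto simp: of_int_le_iff[symmetric, where 'a = real])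
    then have "of_int k * pi / m \<le> pi" using assms(2) by (simp add: field_simps)
    then show ?thesis unfolding c using p by (intro cos_monotone_0_pi_le) auto
  next
    case False
    have "cos (of_int k * pi / m) = cos (2 * pi - of_int k * pi / m)"
      by (simp add: cos_diff)
    also have "\<dots> \<le> cos (pi / m)"
    proof (rule cos_monotone_0_pi_le)
      show "0 \<le> pi / m" by simp
      have "real_of_int k \<le> 2 * m - 1" using k2 by linarith
      then have "real_of_int k * pi \<le> (2 * m - 1) * pi" by (intro mult_right_mono) auto
      then show "pi / m \<le> 2 * pi - of_int k * pi / m" using assms(2) by (simp add: field_simps)
      have "real m \<le> real_of_int k" using False by linarith
      then have "real m * pi \<le> real_of_int k * pi" by (intro mult_right_mono) auto
      then show "2 * pi - of_int k * pi / m \<le> pi" using assms(2) by (simp add: field_simps)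
    qed
    finally show ?thesis unfolding c .
  qed
qed


subsection \<open>The zigzag order of a regular polygon\<close>

text \<open>The vertices of the polygon are at the angles \<open>t + 2 * pi * k / m\<close> with \<open>t\<close> less than half
  a step. Sorted by the decreasing coordinate \<open>C\<close> they are \<open>q 0\<close>, \<open>q 1\<close>, ..., alternating between
  both sides of the \<open>C\<close>-axis; \<open>b i\<close> is the absolute value of the angle of \<open>q i\<close>. The sides of
  the polygon join \<open>q i\<close> and \<open>q (i + 2)\<close>, together with the first two and the last two vertices.\<close>

locale half = frame +
  fixes r t :: real and m :: nat and Q0 :: "space set" and w1 w2 :: space
  assumes r: "0 < r" and m: "4 \<le> m" "even m" and t: "0 < t" "t < pi / m"
    and Q0: "Q0 = range (\<lambda>k::int. circle_pt c ec es r (t + 2 * pi * of_int k / m))"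
    and w: "C w1 = C w2" "S w1 < S w2" "Z w1 = Z w2" "0 < Z w1"
begin

text \<open>Half the central angle of a side, so \<open>r * cos d\<close> is the distance of the
  sides from the centre.\<close>

definition d :: real where "d = pi / m"

lemma d: "0 < d" "m * d = pi" "t < d"
  using m t by (simp_all add: d_def)

lemma m_d_le: "x \<le> real m \<Longrightarrow> x * d \<le> pi"
  using mult_right_mono[of x m d] d by simp

lemma m_d_less: "x < real m \<Longrightarrow> x * d < pi"
  using mult_strict_right_mono[of x m d] d by simp

lemma Q0_d: "Q0 = range (\<lambda>k::int. circle_pt c ec es r (t + 2 * of_int k * d))"
  unfolding Q0 d_def by (simp add: mult.commute mult.left_commute)

definition b :: "nat \<Rightarrow> real" where
  "b i = (if even i then t + i * d else (i + 1) * d - t)"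

definition sg :: "nat \<Rightarrow> real" where "sg i = (if even i then 1 else - 1)"

definition q :: "nat \<Rightarrow> space" where "q i = circle_pt c ec es r (sg i * b i)"

lemma sg_Suc [simp]: "sg (Suc i) = - sg i" by (simp add: sg_def)

lemma sg_cases: "sg i = 1 \<or> sg i = - 1" by (simp add: sg_def)

lemma sg_sq [simp]: "sg i * sg i = 1" using sg_cases[of i] by auto

lemma b_Suc: "b i < b (Suc i)"
  using t d by (auto simp: b_def algebra_simps)

lemma b_diff: "b (Suc i) - b i < 2 * d"
  using t d by (auto simp: b_def algebra_simps)

lemma b_sum: "b i + b (Suc i) = (i + 1) * (2 * d)"
  by (auto simp: b_def algebra_simps)

lemma b_mono: "i < j \<Longrightarrow> b i < b j"
  by (rule lift_Suc_mono_less[of b]) (auto intro: b_Suc)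

lemma b_pos: "0 < b i"
  using b_mono[of 0 i] t by (cases i) (auto simp: b_def)

lemma b_less_pi: "i < m \<Longrightarrow> b i < pi"
proof -
  assume "i < m"
  have "b (m - 1) = pi - t"
    using m d by (simp add: b_def of_nat_diff)
  moreover have "b i \<le> b (m - 1)"
  proof (cases "i = m - 1")
    case False
    then have "i < m - 1" using \<open>i < m\<close> by simp
    then show ?thesis using b_mono by (simp add: less_imp_le)
  qed simp
  ultimately show ?thesis using t by simp
qed

lemma C_q: "C (q i) = r * cos (b i)"
  using sg_cases[of i] by (auto simp: q_def)

lemma S_q: "S (q i) = sg i * (r * sin (b i))"
  using sg_cases[of i] by (auto simp: q_def)

lemma Z_q [simp]: "Z (q i) = 0"
  by (simp add: q_def)

lemma C_q_less: "i < j \<Longrightarrow> j < m \<Longrightarrow> C (q j) < C (q i)"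
  unfolding C_q using r b_mono[of i j] b_pos[of i] b_less_pi[of j]
  by (intro mult_strict_left_mono cos_monotone_0_pi) auto

lemma C_q_le: "i \<le> j \<Longrightarrow> j < m \<Longrightarrow> C (q j) \<le> C (q i)"
  using C_q_less[of i j] by (cases "i = j") auto

lemma q_inj: "i < m \<Longrightarrow> j < m \<Longrightarrow> q i = q j \<longleftrightarrow> i = j"
  using C_q_less by (metis less_irrefl linorder_neqE_nat)

lemma sg_S_pos: "i < m \<Longrightarrow> 0 < sg i * S (q i)"
  unfolding S_q using r b_pos[of i] b_less_pi[of i] sin_gt_zero[of "b i"]
  by (simp add: mult.assoc[symmetric])

lemma q_angle_even: "q (2 * n) = circle_pt c ec es r (t + 2 * of_int (int n) * d)"
  by (simp add: q_def sg_def b_def)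

lemma q_angle_odd: "q (2 * n + 1) = circle_pt c ec es r (t + 2 * of_int (- int (n + 1)) * d)"
  by (simp add: q_def sg_def b_def algebra_simps)

text \<open>Shifting \<open>k\<close> by a multiple of \<open>m\<close> into the range from
  \<open>- m / 2\<close> to \<open>m / 2 - 1\<close> brings the angle between \<open>- pi\<close>
  and \<open>pi\<close>. Then nonnegative \<open>k\<close> are the even positions of the path and
  negative \<open>k\<close> the odd ones.\<close>

lemma q_image: "q ` {..<m} = Q0"
proof
  show "q ` {..<m} \<subseteq> Q0"
  proof
    fix x assume "x \<in> q ` {..<m}"
    then obtain i where "x = q i" by blast
    moreover have "q i \<in> Q0"
    proof (cases "even i")
      case True
      then obtain n where "i = 2 * n" by blast
      then show ?thesis unfolding Q0_d using q_angle_even[of n] by blast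
    next
      case False
      then obtain n where "i = 2 * n + 1" by (metis oddE)
      then show ?thesis unfolding Q0_d using q_angle_odd[of n] by blast
    qed
    ultimately show "x \<in> Q0" by simp
  qed
  show "Q0 \<subseteq> q ` {..<m}"
  proof
    fix x assume "x \<in> Q0"
    then obtain k :: int where k: "x = circle_pt c ec es r (t + 2 * of_int k * d)"
      unfolding Q0_d by blast
    define h where "h = int m div 2"
    have mh: "int m = 2 * h" using m(2) by (simp add: h_def)
    define k' where "k' = (k + h) mod int m - h"
    define n where "n = (k + h) div int m"
    have kb: "- h \<le> k'" "k' < h"
      using m(1) pos_mod_bound[of "int m" "k + h"] pos_mod_sign[of "int m" "k + h"] mh unfolding k'_def by linarith+
    have kk: "k = k' + int m * n"
      unfolding k'_def n_def using div_mult_mod_eq[of "k + h" "int m"] by (simp add: algebra_simps)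
    have "2 * of_int k * d = 2 * of_int k' * d + 2 * (m * d) * of_int n"
      unfolding kk by (simp add: algebra_simps)
    then have "t + 2 * of_int k * d = (t + 2 * of_int k' * d) + 2 * pi * of_int n"
      using d(2) by simp
    then have x: "x = circle_pt c ec es r (t + 2 * of_int k' * d)"
      unfolding k using circle_pt_2pi by metis
    show "x \<in> q ` {..<m}"
    proof (cases "0 \<le> k'")
      case True
      have "q (2 * nat k') = x"
        unfolding x q_angle_even using True by simp
      moreover have "2 * nat k' < m" using kb mh True by linarith
      ultimately show ?thesis by blast
    next
      case False
      have "q (2 * nat (- k' - 1) + 1) = x"
        unfolding x q_angle_odd using False by simp
      moreover have "2 * nat (- k' - 1) + 1 < m" using kb mh False by linarith
      ultimately show ?thesis by blast
    qed
  qed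
qed

lemma finite_Q0 [simp]: "finite Q0" and card_Q0: "card Q0 = m"
proof -
  show "finite Q0" unfolding q_image[symmetric] by simp
  have "inj_on q {..<m}" using q_inj by (auto simp: inj_on_def)
  then show "card Q0 = m" unfolding q_image[symmetric] by (simp add: card_image)
qed

lemma q_in [simp]: "i < m \<Longrightarrow> q i \<in> Q0"
  using q_image by blast

lemma Z_hull: "x \<in> convex hull Q0 \<Longrightarrow> Z x = 0"
  by (rule affine_fun_hull_eq[where f = Z]) (auto simp: Q0)

text \<open>The hypothesis says that the step has the central angle of a side. As the two vertices
  lie on opposite sides of the axis, their angles add up to \<open>2 * (i + 1) * d\<close>, which
  fits only for \<open>i + 1 = 1\<close> and \<open>i + 1 = m - 1\<close>.\<close>

lemma consecutive_side:
  assumes "i + 1 < m" "C (q i) * C (q (i + 1)) + S (q i) * S (q (i + 1)) = r\<^sup>2 * cos (2 * d)"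
  shows "i = 0 \<or> i + 2 = m"
proof (rule ccontr)
  assume n: "\<not> ?thesis"
  have "C (q i) * C (q (i + 1)) + S (q i) * S (q (i + 1)) = r\<^sup>2 * cos (b i + b (Suc i))"
    unfolding C_q S_q cos_add using sg_cases[of i] by (auto simp: algebra_simps power2_eq_square)
  then have e: "cos ((i + 1) * (2 * d)) = cos (2 * d)"
    using assms(2) r by (simp add: b_sum add.commute)
  have i: "1 \<le> i" "i + 2 < m" using n assms(1) by auto
  show False
  proof (cases "2 * (i + 1) \<le> m")
    case True
    then have "real (2 * (i + 1)) \<le> m" by (simp only: of_nat_le_iff)
    then have "2 * (real i + 1) * d \<le> pi" by (intro m_d_le) simp
    moreover have "1 * d < (real i + 1) * d" using i d by (intro mult_strict_right_mono) auto
    ultimately show False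
      using cos_monotone_0_pi[of "2 * d" "(i + 1) * (2 * d)"] e d by (simp add: algebra_simps)
  next
    case False
    have c: "cos ((i + 1) * (2 * d)) = cos (2 * pi - (i + 1) * (2 * d))"
      by (simp add: cos_diff)
    have "real m \<le> real (2 * (i + 1))" using False by (simp only: of_nat_le_iff)
    then have "real m \<le> 2 * (real i + 1)" by simp
    then have "m * d \<le> 2 * (real i + 1) * d" using d by (intro mult_right_mono) auto
    then have 1: "2 * pi - (i + 1) * (2 * d) \<le> pi"
      using d by (simp add: algebra_simps)
    have "(real i + 2) * d < pi" using i by (intro m_d_less) linarith
    then have "2 * d < 2 * pi - (i + 1) * (2 * d)" by (simp add: algebra_simps)
    then show False
      using cos_monotone_0_pi[of "2 * d" "2 * pi - (i + 1) * (2 * d)"] e c 1 d by simp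
  qed
qed

text \<open>The expression is the squared radius times the cosine of \<open>b (i + 1) - b i\<close>,
  which is less than \<open>2 * d\<close>, at most a right angle. Exchanging the two coordinates
  negates the expression, so no chord is a step of both zigzag paths.\<close>

lemma consecutive_pos:
  assumes "i + 1 < m"
  shows "0 < C (q i) * C (q (i + 1)) - S (q i) * S (q (i + 1))"
proof -
  have "C (q i) * C (q (i + 1)) - S (q i) * S (q (i + 1)) = r\<^sup>2 * cos (b (Suc i) - b i)"
    unfolding C_q S_q cos_diff using sg_cases[of i] by (auto simp: algebra_simps power2_eq_square)
  moreover have "4 * d \<le> pi"
    using m by (intro m_d_le) simp
  then have "0 < cos (b (Suc i) - b i)"
    using b_diff[of i] b_Suc[of i] by (intro cos_gt_zero_pi) auto
  ultimately show ?thesis using r by simp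
qed

section \<open>Supporting lines of the sides of the polygon\<close>

definition \<beta> :: "nat \<Rightarrow> real" where
  "\<beta> i = (if even i then (i + 1) * d - t else t + i * d)"

text \<open>The component along the outward normal, at angle \<open>- sg i * \<beta> i\<close>, of
  the side that joins \<open>q (i - 1)\<close> and \<open>q (i + 1)\<close> opposite to
  \<open>q i\<close>. For \<open>i = 0\<close> and \<open>i = m - 1\<close> it is the first or the
  last step of the path, which truncated subtraction and \<open>min\<close> account for
  below.\<close>

definition support :: "nat \<Rightarrow> space \<Rightarrow> real" where
  "support i x = cos (\<beta> i) * C x - sg i * sin (\<beta> i) * S x"

lemma affine_support [simp]: "affine_fun (support i)"
  unfolding support_def[abs_def] by (intro affine_fun_diff affine_fun_scale) simp_all

lemma support_circle: "support i (circle_pt c ec es r a) = r * cos (a + sg i * \<beta> i)"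
  using sg_cases[of i] by (auto simp: support_def cos_add algebra_simps)

lemma \<beta>_bounds: "i < m \<Longrightarrow> 0 < \<beta> i \<and> \<beta> i < pi"
proof -
  assume i: "i < m"
  have 1: "0 \<le> i * d" using d by simp
  have "(real i + 1) * d \<le> pi" using i by (intro m_d_le) linarith
  then have 2: "i * d + d \<le> pi" by (simp add: algebra_simps)
  have "\<beta> i = i * d + d - t \<or> \<beta> i = t + i * d" by (simp add: \<beta>_def algebra_simps)
  then show ?thesis using 1 2 t(1) d(3) by linarith
qed

text \<open>Relative to the normal of \<open>support i\<close> every vertex sits at an odd multiple
  of \<open>d\<close>, so \<open>cos_odd_le\<close> applies.\<close>

lemma support_le: "x \<in> convex hull Q0 \<Longrightarrow> support i x \<le> r * cos d"
proof (rule affine_fun_hull_le[OF affine_support])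
  fix x assume "x \<in> Q0"
  then obtain k :: int where k: "x = circle_pt c ec es r (t + 2 * of_int k * d)"
    unfolding Q0_d by blast
  define n :: int where "n = 2 * k + (if even i then int i + 1 else - int i)"
  have "odd n" by (simp add: n_def)
  have "t + 2 * of_int k * d + sg i * \<beta> i = of_int n * d"
    by (simp add: n_def \<beta>_def sg_def algebra_simps)
  then show "support i x \<le> r * cos d"
    unfolding k support_circle using cos_odd_le[OF \<open>odd n\<close>, of m] m r by (simp add: d_def)
qed

lemma support_upper:
  assumes "i < m"
  shows "support i (q (min (i + 1) (m - 1))) = r * cos d"
proof (cases "i + 1 = m")
  case True
  then have i: "min (i + 1) (m - 1) = i" by simp
  have "odd i" using True m(2) by presburger
  have "real i + 1 = m" using True by linarith
  then have "(real i + 1) * d = pi" using d by simp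
  then have e: "sg i * b i + sg i * \<beta> i = d - 2 * pi"
    using \<open>odd i\<close> by (simp add: sg_def b_def \<beta>_def algebra_simps)
  show ?thesis
    unfolding i q_def support_circle e by (simp add: cos_diff)
next
  case False
  then have i: "min (i + 1) (m - 1) = Suc i" using assms by simp
  have e: "sg (Suc i) * b (Suc i) + sg i * \<beta> i = sg (Suc i) * d"
    by (simp add: sg_def b_def \<beta>_def algebra_simps)
  show ?thesis
    unfolding i q_def support_circle e using sg_cases[of "Suc i"] by auto
qed

lemma support_lower:
  shows "support i (q (i - 1)) = r * cos d"
proof (cases i)
  case 0
  then show ?thesis
    unfolding q_def support_circle by (simp add: sg_def b_def \<beta>_def)
next
  case (Suc j)
  have e: "sg j * b j + sg i * \<beta> i = sg j * - d"
    by (simp add: Suc sg_def b_def \<beta>_def algebra_simps)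
  show ?thesis
    unfolding q_def support_circle using e sg_cases[of j] Suc by auto
qed

end

subsection \<open>Dissecting one half of the polytope\<close>

context half
begin

text \<open>Signed distance from the line through \<open>q i\<close> and \<open>q (i + 1)\<close>,
  measured parallel to \<open>w1 w2\<close>. The slope makes sense because consecutive vertices
  differ in \<open>C\<close>.\<close>

definition line_dist :: "nat \<Rightarrow> space \<Rightarrow> real" where
  "line_dist i x = S x - (S (q i) + (C (q i) - C x) * ((S (q (i + 1)) - S (q i)) / (C (q i) - C (q (i + 1)))))"

lemma affine_line_dist [simp]: "affine_fun (line_dist i)"
  unfolding line_dist_def[abs_def] by (intro affine_fun_diff affine_fun_add affine_fun_scale_right) simp_all

lemma line_dist_q [simp]: "line_dist i (q i) = 0"
  by (simp add: line_dist_def)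

lemma line_dist_q_Suc [simp]: "i + 1 < m \<Longrightarrow> line_dist i (q (Suc i)) = 0"
  using C_q_less[of i "Suc i"] by (simp add: line_dist_def)

lemma line_dist_shift: "C x = C y \<Longrightarrow> line_dist i x - line_dist i y = S x - S y"
  by (simp add: line_dist_def)

lemma exists_slab:
  assumes "x \<in> convex hull Q0"
  obtains i where "i + 1 < m" "C (q (i + 1)) \<le> C x" "C x \<le> C (q i)"
proof -
  have up: "C x \<le> C (q 0)"
    using assms by (rule affine_fun_hull_le[OF affine_fun_coord, rotated])
      (use C_q_le[of 0] in \<open>auto simp flip: q_image\<close>)
  have lo: "C (q (m - 1)) \<le> C x"
    using assms by (rule affine_fun_hull_ge[OF affine_fun_coord, rotated])
      (use C_q_le[of _ "m - 1"] m in \<open>auto simp flip: q_image\<close>)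
  define A where "A = {i. i + 1 < m \<and> C x \<le> C (q i)}"
  have fA: "finite A" unfolding A_def by (rule finite_subset[of _ "{..<m}"]) auto
  have "0 \<in> A" using up m by (simp add: A_def)
  define i where "i = Max A"
  have "i \<in> A" using fA \<open>0 \<in> A\<close> unfolding i_def by (intro Max_in) auto
  then have i: "i + 1 < m" "C x \<le> C (q i)" by (auto simp: A_def)
  have "C (q (i + 1)) \<le> C x"
  proof (cases "i + 2 = m")
    case True
    then have "i + 1 = m - 1" by simp
    then show ?thesis using lo by simp
  next
    case False
    have "i + 1 \<notin> A" using Max_ge[OF fA, of "i + 1"] unfolding i_def[symmetric] by auto
    then show ?thesis using False i by (auto simp: A_def)
  qed
  then show ?thesis using that i by blast
qed

lemma level_point:
  assumes "C h \<le> y" "y \<le> C g" "C h < C g"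
  obtains p where "p \<in> closed_segment g h" "C p = y"
proof -
  define \<tau> where "\<tau> = (C g - y) / (C g - C h)"
  have \<tau>: "0 \<le> \<tau>" "\<tau> \<le> 1" using assms by (auto simp: \<tau>_def divide_simps)
  have "C ((1 - \<tau>) *\<^sub>R g + \<tau> *\<^sub>R h) = C g - \<tau> * (C g - C h)"
    unfolding affine_fun_segment[OF affine_fun_coord] by (simp add: algebra_simps)
  also have "\<dots> = y" using assms by (simp add: \<tau>_def)
  finally show ?thesis
    using that[of "(1 - \<tau>) *\<^sub>R g + \<tau> *\<^sub>R h"] \<tau> by (auto simp: in_segment)
qed

lemma affine_fun_segment_eq:
  assumes "affine_fun f" "f g = k" "f h = k" "p \<in> closed_segment g h"
  shows "f p = k"
proof -
  obtain u where u: "p = (1 - u) *\<^sub>R g + u *\<^sub>R h" using assms(4) by (auto simp: in_segment)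
  have "f p = (1 - u) * f g + u * f h" unfolding u by (rule affine_fun_segment[OF assms(1)])
  then show ?thesis using assms(2,3) by (simp add: algebra_simps)
qed

lemma segment_hull:
  assumes "p \<in> closed_segment g h" "g \<in> A" "h \<in> A"
  shows "p \<in> convex hull A"
  using closed_segment_subset[of g "convex hull A" h] assms hull_inc[of _ A convex] by auto

definition tri :: "nat \<Rightarrow> space set" where "tri j = {q j, q (j + 1), q (j + 2)}"

lemma line_dist_segment:
  assumes "i + 1 < m" "p \<in> closed_segment (q i) (q (i + 1))"
  shows "line_dist i p = 0"
  using affine_fun_segment_eq[of "line_dist i" "q i" 0 "q (i + 1)" p] assms by simp

lemma Z_segment: "Z g = 0 \<Longrightarrow> Z h = 0 \<Longrightarrow> p \<in> closed_segment g h \<Longrightarrow> Z p = 0"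
  using affine_fun_segment_eq[of Z g 0 h p] by simp

text \<open>At the level of \<open>x\<close> the path has a point \<open>p\<close>, and the side
  from \<open>q (i - 1)\<close> to \<open>q (i + 1)\<close>, which bounds the polygon there, a point
  \<open>p'\<close>. \<open>x\<close> lies between them. For \<open>i = 0\<close> that side is the
  step itself and leaves no room.\<close>

lemma tri_cover_lower:
  assumes x: "x \<in> convex hull Q0" and i: "i + 1 < m" "C (q (i + 1)) \<le> C x" "C x \<le> C (q i)"
    and neg: "sg i * line_dist i x < 0"
  shows "1 \<le> i \<and> x \<in> convex hull (tri (i - 1))"
proof -
  obtain p where p: "p \<in> closed_segment (q i) (q (i + 1))" "C p = C x"
    by (rule level_point[OF i(2,3) C_q_less]) (use i(1) in auto)
  have Sp: "sg i * (S x - S p) < 0"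
    using line_dist_segment[OF i(1) p(1)] line_dist_shift[of x p i] p(2) neg by simp
  have sin: "0 < sin (\<beta> i)" using \<beta>_bounds[of i] i(1) by (auto intro: sin_gt_zero)
  obtain p' where p': "p' \<in> closed_segment (q (i - 1)) (q (i + 1))" "C p' = C x"
    by (rule level_point[of "q (i + 1)" "C x" "q (i - 1)"])
      (use i C_q_le[of "i - 1" i] C_q_less[of "i - 1" "i + 1"] in auto)
  have "min (i + 1) (m - 1) = i + 1" using i(1) by simp
  then have "support i p' = r * cos d"
    using support_lower[of i] support_upper[of i] i(1)
    by (intro affine_fun_segment_eq[OF affine_support _ _ p'(1)]) auto
  then have "support i x \<le> support i p'" using support_le[OF x] by simp
  then have "sg i * sin (\<beta> i) * S p' \<le> sg i * sin (\<beta> i) * S x"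
    unfolding support_def p'(2) by simp
  moreover have "sin (\<beta> i) * (sg i * (S p' - S x)) = sg i * sin (\<beta> i) * S p' - sg i * sin (\<beta> i) * S x"
    by (simp add: algebra_simps)
  ultimately have "sin (\<beta> i) * (sg i * (S p' - S x)) \<le> 0" by linarith
  then have Sp': "sg i * (S p' - S x) \<le> 0"
    using sin by (simp add: mult_le_0_iff)
  have i1: "1 \<le> i"
  proof (rule ccontr)
    assume "\<not> 1 \<le> i"
    then have "i = 0" by simp
    then have "line_dist i p' = 0" using line_dist_segment[OF i(1), of p'] p' by simp
    then have "S p' = S p"
      using line_dist_segment[OF i(1) p(1)] line_dist_shift[of p' p i] p p' by simp
    then show False using Sp Sp' by (simp add: algebra_simps)
  qed
  have "x \<in> closed_segment p p'"
    using Sp Sp' sg_cases[of i] p(2) p'(2) Z_segment[OF _ _ p(1)] Z_segment[OF _ _ p'(1)] Z_hull[OF x]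
    by (intro between_segment) auto
  moreover have "p \<in> convex hull (tri (i - 1))" "p' \<in> convex hull (tri (i - 1))"
    using i1 by (auto intro!: segment_hull[OF p(1)] segment_hull[OF p'(1)] simp: tri_def)
  ultimately show ?thesis
    using i1 by (meson convex_contains_segment convex_convex_hull subsetD)
qed

text \<open>Mirror image of \<open>tri_cover_lower\<close>, bounded by the side from
  \<open>q i\<close> to \<open>q (i + 2)\<close>, which degenerates to the step itself in the last
  slab.\<close>

lemma tri_cover_upper:
  assumes x: "x \<in> convex hull Q0" and i: "i + 1 < m" "C (q (i + 1)) \<le> C x" "C x \<le> C (q i)"
    and pos: "0 < sg i * line_dist i x"
  shows "i + 2 < m \<and> x \<in> convex hull (tri i)"
proof -
  obtain p where p: "p \<in> closed_segment (q i) (q (i + 1))" "C p = C x"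
    by (rule level_point[OF i(2,3) C_q_less]) (use i(1) in auto)
  have Sp: "0 < sg i * (S x - S p)"
    using line_dist_segment[OF i(1) p(1)] line_dist_shift[of x p i] p(2) pos by simp
  have sin: "0 < sin (\<beta> (i + 1))" using \<beta>_bounds[of "i + 1"] i(1) by (auto intro: sin_gt_zero)
  define k where "k = min (i + 2) (m - 1)"
  have k: "i + 1 \<le> k" "k < m" using i(1) by (auto simp: k_def)
  obtain p' where p': "p' \<in> closed_segment (q i) (q k)" "C p' = C x"
    by (rule level_point[of "q k" "C x" "q i"])
      (use i C_q_le[of "i + 1" k] C_q_less[of i k] k in auto)
  have "min (i + 1 + 1) (m - 1) = k" by (simp add: k_def)
  then have "support (i + 1) p' = r * cos d"
    using support_lower[of "i + 1"] support_upper[of "i + 1"] i(1)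
    by (intro affine_fun_segment_eq[OF affine_support _ _ p'(1)]) auto
  then have "support (i + 1) x \<le> support (i + 1) p'" using support_le[OF x] by simp
  then have "sg i * sin (\<beta> (i + 1)) * S x \<le> sg i * sin (\<beta> (i + 1)) * S p'"
    unfolding support_def p'(2) by simp
  moreover have "sin (\<beta> (i + 1)) * (sg i * (S x - S p')) = sg i * sin (\<beta> (i + 1)) * S x - sg i * sin (\<beta> (i + 1)) * S p'"
    by (simp add: algebra_simps)
  ultimately have "sin (\<beta> (i + 1)) * (sg i * (S x - S p')) \<le> 0" by linarith
  then have Sp': "sg i * (S x - S p') \<le> 0"
    using sin by (simp add: mult_le_0_iff)
  have i2: "i + 2 < m"
  proof (rule ccontr)
    assume "\<not> i + 2 < m"
    then have "k = i + 1" using i(1) by (auto simp: k_def)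
    then have "line_dist i p' = 0" using line_dist_segment[OF i(1), of p'] p' by simp
    then have "S p' = S p"
      using line_dist_segment[OF i(1) p(1)] line_dist_shift[of p' p i] p p' by simp
    then show False using Sp Sp' by (simp add: algebra_simps)
  qed
  then have ki: "k = i + 2" by (auto simp: k_def)
  have "x \<in> closed_segment p p'"
    using Sp Sp' sg_cases[of i] p(2) p'(2) Z_segment[OF _ _ p(1)] Z_segment[OF _ _ p'(1)] Z_hull[OF x]
    by (intro between_segment) auto
  moreover have "p \<in> convex hull (tri i)" "p' \<in> convex hull (tri i)"
    using ki by (auto intro!: segment_hull[OF p(1)] segment_hull[OF p'(1)] simp: tri_def)
  ultimately show ?thesis
    using i2 by (meson convex_contains_segment convex_convex_hull subsetD)
qed


text \<open>\<open>q j\<close> and \<open>q (j + 2)\<close> lie on one side of the axis and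
  \<open>q (j + 1)\<close> on the other. Hence their chord passes the level of
  \<open>q (j + 1)\<close> at a point \<open>M\<close> on the \<open>sg j\<close> side of it, and
  \<open>M\<close> is tested against both steps.\<close>

lemma line_dist_above:
  assumes "j + 2 < m"
  shows "0 < sg j * line_dist j (q (j + 2))" "0 < sg j * line_dist (j + 1) (q j)"
proof -
  have lt: "C (q (j + 1)) < C (q j)" "C (q (j + 2)) < C (q (j + 1))"
    using C_q_less[of j "j + 1"] C_q_less[of "j + 1" "j + 2"] assms by simp_all
  obtain M where M: "M \<in> closed_segment (q j) (q (j + 2))" "C M = C (q (j + 1))"
    by (rule level_point[of "q (j + 2)" "C (q (j + 1))" "q j"]) (use lt in linarith)+
  obtain \<tau> where \<tau>: "0 \<le> \<tau>" "\<tau> \<le> 1" "M = (1 - \<tau>) *\<^sub>R q j + \<tau> *\<^sub>R q (j + 2)"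
    using M(1) by (auto simp: in_segment)
  have "sg j * S M = (1 - \<tau>) * (sg j * S (q j)) + \<tau> * (sg j * S (q (j + 2)))"
    unfolding \<tau>(3) affine_fun_segment[OF affine_fun_coord] by (simp add: algebra_simps)
  moreover have "0 < sg j * S (q j)" "0 < sg j * S (q (j + 2))"
    using sg_S_pos[of j] sg_S_pos[of "j + 2"] assms by auto
  ultimately have 1: "0 \<le> sg j * S M" using \<tau> by simp
  have "sg j * S (q (j + 1)) < 0"
    using sg_S_pos[of "j + 1"] assms by auto
  then have 2: "0 < sg j * (S M - S (q (j + 1)))"
    using 1 by (simp add: algebra_simps)
  have "line_dist j M = S M - S (q (j + 1))"
    using line_dist_shift[of M "q (j + 1)" j] M(2) assms by simp
  moreover have "line_dist j M = \<tau> * line_dist j (q (j + 2))"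
    unfolding \<tau>(3) affine_fun_segment[OF affine_line_dist] by simp
  ultimately have "S M - S (q (j + 1)) = \<tau> * line_dist j (q (j + 2))" by linarith
  then have "0 < \<tau> * (sg j * line_dist j (q (j + 2)))" using 2 by (simp only: mult.left_commute)
  then show "0 < sg j * line_dist j (q (j + 2))" using \<tau>(1) by (simp add: zero_less_mult_iff)
  have "line_dist (j + 1) M = S M - S (q (j + 1))"
    using line_dist_shift[of M "q (j + 1)" "j + 1"] M(2) by simp
  moreover have "line_dist (j + 1) M = (1 - \<tau>) * line_dist (j + 1) (q j)"
    unfolding \<tau>(3) affine_fun_segment[OF affine_line_dist] using line_dist_q_Suc[of "Suc j"] assms by simp
  ultimately have "S M - S (q (j + 1)) = (1 - \<tau>) * line_dist (j + 1) (q j)" by linarith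
  then have "0 < (1 - \<tau>) * (sg j * line_dist (j + 1) (q j))" using 2 by (simp only: mult.left_commute)
  then show "0 < sg j * line_dist (j + 1) (q j)" using \<tau>(2) by (simp add: zero_less_mult_iff)
qed

definition prism :: "nat \<Rightarrow> space set" where "prism i = {w1, w2} \<union> {q i, q (i + 1)}"

text \<open>For even \<open>j\<close> the triangle lies on the side of the path with larger
  \<open>S\<close> and takes \<open>w2\<close>, the end with larger \<open>S\<close>; for odd
  \<open>j\<close> everything is reversed.\<close>

definition pyramid :: "nat \<Rightarrow> space set" where "pyramid j = {if odd j then w1 else w2} \<union> tri j"

lemma convex_comb_hull:
  assumes "x \<in> convex hull A" "y \<in> convex hull B" "0 \<le> u" "u \<le> 1"
  shows "(1 - u) *\<^sub>R x + u *\<^sub>R y \<in> convex hull (A \<union> B)"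
proof -
  have "x \<in> convex hull (A \<union> B)" "y \<in> convex hull (A \<union> B)"
    using assms(1,2) hull_mono[of A "A \<union> B" convex] hull_mono[of B "A \<union> B" convex] by auto
  then show ?thesis using convexD_alt[OF convex_convex_hull _ _ assms(3,4)] by blast
qed

text \<open>At the level of a point of the half the zigzag path has a unique point \<open>p\<close>. Moving the point
  parallel to the edge \<open>w1 w2\<close> it enters the prism over the path from the pyramids with apex
  \<open>w1\<close> and leaves it into those with apex \<open>w2\<close>.\<close>

lemma half_cover:
  assumes "z \<in> convex hull (Q0 \<union> {w1, w2})"
  shows "(\<exists>i. i + 1 < m \<and> z \<in> convex hull (prism i)) \<or> (\<exists>j. j + 2 < m \<and> z \<in> convex hull (pyramid j))"
proof -
  have "convex hull (Q0 \<union> {w1, w2}) = convex hull (convex hull Q0 \<union> closed_segment w1 w2)"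
    unfolding segment_convex_hull using hull_Un_left hull_Un_right by metis
  moreover have "Q0 \<noteq> {}" using card_Q0 m by auto
  ultimately obtain u v x W where uv: "0 \<le> u" "0 \<le> v" "u + v = 1" and x: "x \<in> convex hull Q0"
      and W: "W \<in> closed_segment w1 w2" and z: "z = u *\<^sub>R x + v *\<^sub>R W"
    using assms convex_hull_union_two[of "convex hull Q0" "closed_segment w1 w2"] by auto
  have u: "u = 1 - v" using uv by simp
  obtain \<rho> where \<rho>: "0 \<le> \<rho>" "\<rho> \<le> 1" "W = (1 - \<rho>) *\<^sub>R w1 + \<rho> *\<^sub>R w2"
    using W by (auto simp: in_segment)
  define L where "L = S w2 - S w1"
  have L: "0 < L" using w by (simp add: L_def)
  obtain i where i: "i + 1 < m" "C (q (i + 1)) \<le> C x" "C x \<le> C (q i)"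
    using exists_slab[OF x] by blast
  obtain p where p: "p \<in> closed_segment (q i) (q (i + 1))" "C p = C x"
    by (rule level_point[OF i(2,3) C_q_less]) (use i(1) in auto)
  have pQ: "p \<in> convex hull Q0"
    using segment_hull[OF p(1), of Q0] i(1) by simp
  have Zp: "Z p = 0" "Z x = 0" using Z_hull x pQ by auto
  define \<Delta> where "\<Delta> = S x - S p"
  \<comment> \<open>The displacement of \<open>z\<close>, parallel to the edge, from
    \<open>(1 - v) p + v w1\<close>. The prism accounts for the values from \<open>0\<close> to
    \<open>v * L\<close>.\<close>
  define D where "D = (1 - v) * \<Delta> + v * \<rho> * L"
  have ld: "line_dist i y = S y - S p" if "C y = C x" for y
    using line_dist_segment[OF i(1) p(1)] line_dist_shift[of y p i] p(2) that by simp
  have coordz: "C z = (1 - v) * C p + v * C w1" "Z z = v * Z w1" "S z = (1 - v) * S p + v * S w1 + D"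
    unfolding z \<rho>(3) u affine_fun_segment[OF affine_fun_coord] D_def \<Delta>_def L_def
    using p(2) w Zp by (simp_all add: algebra_simps)
  have pyr: ?thesis if y: "y \<in> convex hull Q0" "C y = C x" "y \<noteq> p" "(0 < line_dist i y \<and> w0 = w2) \<or> (line_dist i y < 0 \<and> w0 = w1)"
      and zy: "z = (1 - v) *\<^sub>R y + v *\<^sub>R w0" for y w0
  proof -
    have j: "\<exists>j. j + 2 < m \<and> y \<in> convex hull (tri j) \<and> w0 = (if odd j then w1 else w2)"
    proof (cases "0 < sg i * line_dist i y")
      case True
      then show ?thesis
        using tri_cover_upper[of y i] y i sg_cases[of i] by (intro exI[of _ i]) (auto simp: sg_def split: if_splits)
    next
      case False
      then have "sg i * line_dist i y < 0" using y(4) sg_cases[of i] by auto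
      then have c: "1 \<le> i" "y \<in> convex hull (tri (i - 1))"
        using tri_cover_lower[of y i] y i by auto
      then show ?thesis
        using y(4) i(1) False by (intro exI[of _ "i - 1"]) (auto simp: sg_def split: if_splits)
    qed
    then obtain j where j: "j + 2 < m" "y \<in> convex hull (tri j)" "w0 = (if odd j then w1 else w2)" by blast
    have "z \<in> convex hull (tri j \<union> {w0})"
      unfolding zy using j uv by (intro convex_comb_hull) auto
    then show ?thesis using j by (intro disjI2 exI[of _ j]) (simp add: pyramid_def Un_commute)
  qed
  have seg: "(1 - \<mu>) *\<^sub>R p + \<mu> *\<^sub>R x \<in> convex hull Q0" if "0 \<le> \<mu>" "\<mu> \<le> 1" for \<mu>
    using convexD_alt[OF convex_convex_hull pQ x that] .
  have Cseg: "C ((1 - \<mu>) *\<^sub>R p + \<mu> *\<^sub>R x) = C x" "Z ((1 - \<mu>) *\<^sub>R p + \<mu> *\<^sub>R x) = 0"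
      "S ((1 - \<mu>) *\<^sub>R p + \<mu> *\<^sub>R x) = S p + \<mu> * \<Delta>" for \<mu>
    unfolding affine_fun_segment[OF affine_fun_coord] using p(2) Zp by (simp_all add: \<Delta>_def algebra_simps)
  consider "D < 0" | "v * L < D" | "0 \<le> D" "D \<le> v * L" by linarith
  then show ?thesis
  proof cases
    case 1
    have "0 \<le> v * \<rho> * L" using uv \<rho> L by simp
    then have v1: "(1 - v) * \<Delta> \<le> D" "(1 - v) * \<Delta> < 0" using 1 by (auto simp: D_def)
    then have "\<Delta> < 0" "0 < 1 - v" using uv by (auto simp: mult_less_0_iff)
    \<comment> \<open>The base point slides from \<open>p\<close> towards \<open>x\<close> just far
      enough to produce the whole displacement \<open>D\<close>, so that the apex can be
      \<open>w1\<close>.\<close>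
    define \<mu> where "\<mu> = D / ((1 - v) * \<Delta>)"
    have \<mu>: "0 < \<mu>" "\<mu> \<le> 1"
      using 1 v1 by (auto simp: \<mu>_def divide_neg_neg divide_le_eq_1)
    have \<mu>D: "(1 - v) * (\<mu> * \<Delta>) = D"
      using \<open>\<Delta> < 0\<close> \<open>0 < 1 - v\<close> by (simp add: \<mu>_def)
    define y where "y = (1 - \<mu>) *\<^sub>R p + \<mu> *\<^sub>R x"
    have Cy: "C y = C x" "Z y = 0" "S y = S p + \<mu> * \<Delta>" unfolding y_def by (rule Cseg)+
    have neg: "\<mu> * \<Delta> < 0" using \<mu> \<open>\<Delta> < 0\<close> by (simp add: mult_less_0_iff)
    have yQ: "y \<in> convex hull Q0" unfolding y_def using \<mu> by (intro seg) auto
    have yp: "y \<noteq> p" using Cy(3) neg by auto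
    have ly: "line_dist i y < 0" using ld[OF Cy(1)] Cy(3) neg by simp
    have zy: "z = (1 - v) *\<^sub>R y + v *\<^sub>R w1"
    proof (rule coords_eqI)
      show "S z = S ((1 - v) *\<^sub>R y + v *\<^sub>R w1)"
        unfolding affine_fun_segment[OF affine_fun_coord] coordz Cy distrib_left \<mu>D by simp
    qed (simp_all add: affine_fun_segment[OF affine_fun_coord] coordz Cy p(2))
    show ?thesis by (rule pyr[OF yQ Cy(1) yp disjI2[OF conjI[OF ly refl]] zy])
  next
    case 2
    have "v * \<rho> * L \<le> v * L" using uv \<rho> L mult_left_le[of \<rho> "v * L"] by (simp add: mult.commute mult.left_commute)
    then have v1: "D - v * L \<le> (1 - v) * \<Delta>" "0 < (1 - v) * \<Delta>" using 2 by (auto simp: D_def)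
    then have "0 < \<Delta>" "0 < 1 - v" using uv by (auto simp: zero_less_mult_iff)
    define \<mu> where "\<mu> = (D - v * L) / ((1 - v) * \<Delta>)"
    have \<mu>: "0 < \<mu>" "\<mu> \<le> 1"
      using 2 v1 by (auto simp: \<mu>_def divide_le_eq_1)
    have \<mu>D: "(1 - v) * (\<mu> * \<Delta>) = D - v * L"
      using \<open>0 < \<Delta>\<close> \<open>0 < 1 - v\<close> by (simp add: \<mu>_def)
    define y where "y = (1 - \<mu>) *\<^sub>R p + \<mu> *\<^sub>R x"
    have Cy: "C y = C x" "Z y = 0" "S y = S p + \<mu> * \<Delta>" unfolding y_def by (rule Cseg)+
    have pos: "0 < \<mu> * \<Delta>" using \<mu> \<open>0 < \<Delta>\<close> by simp
    have yQ: "y \<in> convex hull Q0" unfolding y_def using \<mu> by (intro seg) auto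
    have yp: "y \<noteq> p" using Cy(3) pos by auto
    have ly: "0 < line_dist i y" using ld[OF Cy(1)] Cy(3) pos by simp
    have zy: "z = (1 - v) *\<^sub>R y + v *\<^sub>R w2"
    proof (rule coords_eqI)
      show "S z = S ((1 - v) *\<^sub>R y + v *\<^sub>R w2)"
        unfolding affine_fun_segment[OF affine_fun_coord] coordz Cy distrib_left \<mu>D
        by (simp add: L_def right_diff_distrib)
    qed (simp_all add: affine_fun_segment[OF affine_fun_coord] coordz Cy p(2) w)
    show ?thesis by (rule pyr[OF yQ Cy(1) yp disjI1[OF conjI[OF ly refl]] zy])
  next
    case 3
    \<comment> \<open>For \<open>v = 0\<close> the edge has no weight and any
      \<open>\<sigma>\<close> would do.\<close>
    define \<sigma> where "\<sigma> = (if v = 0 then 0 else D / (v * L))"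
    have \<sigma>: "0 \<le> \<sigma>" "\<sigma> \<le> 1" "v * (\<sigma> * L) = D"
      using 3 uv L by (auto simp: \<sigma>_def divide_simps)
    have "z = (1 - v) *\<^sub>R p + v *\<^sub>R ((1 - \<sigma>) *\<^sub>R w1 + \<sigma> *\<^sub>R w2)"
    proof (rule coords_eqI)
      show "S z = S ((1 - v) *\<^sub>R p + v *\<^sub>R ((1 - \<sigma>) *\<^sub>R w1 + \<sigma> *\<^sub>R w2))"
        unfolding affine_fun_segment[OF affine_fun_coord] coordz using \<sigma>(3) by (simp add: algebra_simps L_def)
    qed (simp_all only: affine_fun_segment[OF affine_fun_coord] coordz Zp w, simp_all add: algebra_simps)
    moreover have "(1 - \<sigma>) *\<^sub>R w1 + \<sigma> *\<^sub>R w2 \<in> convex hull {w1, w2}"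
      unfolding segment_convex_hull[symmetric] using \<sigma> by (auto simp: in_segment)
    moreover have "p \<in> convex hull {q i, q (i + 1)}" using p(1) by (simp add: segment_convex_hull)
    ultimately have "z \<in> convex hull ({q i, q (i + 1)} \<union> {w1, w2})"
      using uv convex_comb_hull[of p "{q i, q (i + 1)}" "(1 - \<sigma>) *\<^sub>R w1 + \<sigma> *\<^sub>R w2" "{w1, w2}" v] by simp
    then show ?thesis using i(1) by (intro disjI1 exI[of _ i]) (simp only: prism_def Un_commute)
  qed
qed

section \<open>Disjointness and number of the tetrahedra in one half\<close>

lemma C_mono_less: "i < m \<Longrightarrow> j < m \<Longrightarrow> C (q j) < C (q i) \<longleftrightarrow> i < j"
  using C_q_less C_q_le by (metis linorder_not_less)

text \<open>A point \<open>(1 - u) x + u W\<close> with \<open>x\<close> in the plane of the polygon and \<open>W\<close> on \<open>w1 w2\<close> determines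
  \<open>u\<close>, the level of \<open>x\<close>, and its offset, which is negative to the one side of the prism and larger
  than \<open>u (S w2 - S w1)\<close> to the other.\<close>

definition ht :: "space \<Rightarrow> real" where "ht z = Z z / Z w1"

definition level :: "space \<Rightarrow> real" where "level z = (C z - ht z * C w1) / (1 - ht z)"

definition offset :: "nat \<Rightarrow> space \<Rightarrow> real" where "offset i z = line_dist i z - ht z * line_dist i w1"

lemma comb_coords:
  assumes "Z x = 0" "C W = C w1" "Z W = Z w1" "0 < u" "u < 1"
  shows "ht ((1 - u) *\<^sub>R x + u *\<^sub>R W) = u"
    "level ((1 - u) *\<^sub>R x + u *\<^sub>R W) = C x"
    "offset i ((1 - u) *\<^sub>R x + u *\<^sub>R W) = (1 - u) * line_dist i x + u * (S W - S w1)"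
proof -
  show h: "ht ((1 - u) *\<^sub>R x + u *\<^sub>R W) = u"
    unfolding ht_def affine_fun_segment[OF affine_fun_coord] using assms w by simp
  show "level ((1 - u) *\<^sub>R x + u *\<^sub>R W) = C x"
    unfolding level_def h affine_fun_segment[OF affine_fun_coord] using assms by simp
  have e: "line_dist i W = line_dist i w1 + (S W - S w1)"
    using line_dist_shift[OF assms(2), of i] by simp
  show "offset i ((1 - u) *\<^sub>R x + u *\<^sub>R W) = (1 - u) * line_dist i x + u * (S W - S w1)"
    unfolding offset_def h affine_fun_segment[OF affine_line_dist] e by (simp add: algebra_simps)
qed

lemma q_ne_w [simp]: "q k \<noteq> w1" "q k \<noteq> w2" "w1 \<noteq> q k" "w2 \<noteq> q k"
  using w Z_q[of k] by auto

lemma prism_interior: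
  assumes i: "i + 1 < m" and z: "z \<in> strict_hull (prism i)"
  shows "C (q (i + 1)) < level z" "level z < C (q i)" "0 < offset i z" "offset i z < ht z * (S w2 - S w1)"
proof -
  have ne: "w1 \<noteq> w2" "q i \<noteq> q (i + 1)" using w q_inj[of i "i + 1"] i by auto
  have dj: "{q i, q (i + 1)} \<inter> {w1, w2} = {}" by simp
  have zs: "z \<in> strict_hull ({q i, q (i + 1)} \<union> {w1, w2})" using z by (simp only: prism_def Un_commute)
  obtain u x W where u: "0 < u" "u < 1" "x \<in> strict_hull {q i, q (i + 1)}" "W \<in> strict_hull {w1, w2}"
      and ze: "z = (1 - u) *\<^sub>R x + u *\<^sub>R W"
    by (rule strict_hull_split[OF _ _ _ _ dj zs]) auto
  obtain \<tau> where \<tau>: "0 < \<tau>" "\<tau> < 1" "x = (1 - \<tau>) *\<^sub>R q i + \<tau> *\<^sub>R q (i + 1)"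
    by (rule strict_hull_pair[OF ne(2) u(3)])
  obtain \<rho> where \<rho>: "0 < \<rho>" "\<rho> < 1" "W = (1 - \<rho>) *\<^sub>R w1 + \<rho> *\<^sub>R w2"
    by (rule strict_hull_pair[OF ne(1) u(4)])
  have W: "C W = C w1" "Z W = Z w1" "S W - S w1 = \<rho> * (S w2 - S w1)"
    unfolding \<rho>(3) affine_fun_segment[OF affine_fun_coord] using w by (simp_all add: algebra_simps)
  have x: "Z x = 0" "C x = C (q i) - \<tau> * (C (q i) - C (q (i + 1)))" "line_dist i x = 0"
    unfolding \<tau>(3) affine_fun_segment[OF affine_fun_coord] affine_fun_segment[OF affine_line_dist]
    using line_dist_q_Suc[OF i] by (simp_all add: algebra_simps)
  note c = comb_coords[OF x(1) W(1,2) u(1,2)]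
  have lt: "C (q (i + 1)) < C (q i)" using C_q_less i by simp
  show "level z < C (q i)" unfolding ze c x(2) using lt \<tau> by simp
  have "\<tau> * (C (q i) - C (q (i + 1))) < 1 * (C (q i) - C (q (i + 1)))"
    using lt \<tau> by (intro mult_strict_right_mono) auto
  then show "C (q (i + 1)) < level z" unfolding ze c x(2) by simp
  have L: "0 < S w2 - S w1" using w by simp
  show "0 < offset i z" unfolding ze c x(3) W(3) using L u \<rho> by simp
  have "\<rho> * (S w2 - S w1) < 1 * (S w2 - S w1)" using L \<rho> by (intro mult_strict_right_mono) auto
  then show "offset i z < ht z * (S w2 - S w1)" unfolding ze c x(3) W(3) using u by simp
qed

text \<open>The offset is stated with respect to both steps \<open>j\<close> and
  \<open>j + 1\<close> bounding the triangle, since a prism over either of them may share levels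
  with the pyramid.\<close>

lemma pyramid_interior:
  assumes j: "j + 2 < m" and z: "z \<in> strict_hull (pyramid j)"
  shows "C (q (j + 2)) < level z" "level z < C (q j)"
    "i \<in> {j, j + 1} \<Longrightarrow> odd j \<Longrightarrow> offset i z < 0"
    "i \<in> {j, j + 1} \<Longrightarrow> even j \<Longrightarrow> ht z * (S w2 - S w1) < offset i z"
    "0 < ht z"
proof -
  define W where "W = (if odd j then w1 else w2)"
  have W: "C W = C w1" "Z W = Z w1" using w by (auto simp: W_def)
  have fin: "finite (tri j)" "tri j \<noteq> {}" by (auto simp: tri_def)
  have dj: "tri j \<inter> {W} = {}" by (auto simp: tri_def W_def)
  have zs: "z \<in> strict_hull (tri j \<union> {W})" using z by (simp only: pyramid_def W_def Un_commute)
  obtain u x where u: "0 < u" "u < 1" "x \<in> strict_hull (tri j)" and ze: "z = (1 - u) *\<^sub>R x + u *\<^sub>R W"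
    by (rule strict_hull_split[OF _ _ _ _ dj zs]) (use fin in auto)
  have Zx: "Z x = 0"
    by (rule affine_fun_hull_eq[OF affine_fun_coord, of "tri j"])
      (use strict_hull_subset[OF fin(1)] u(3) in \<open>auto simp: tri_def\<close>)
  note c = comb_coords[OF Zx W u(1,2)]
  show "0 < ht z" unfolding ze c using u by simp
  have lt: "C (q (j + 1)) < C (q j)" "C (q (j + 2)) < C (q (j + 1))"
    using C_q_less[of j "j + 1"] C_q_less[of "j + 1" "j + 2"] j by simp_all
  have "0 < C x - C (q (j + 2))"
    by (rule affine_fun_strict_hull_pos[OF fin(1) _ _ _ u(3), of "\<lambda>y. C y - C (q (j + 2))"])
      (use lt in \<open>auto simp: tri_def intro!: affine_fun_diff\<close>)
  then show "C (q (j + 2)) < level z" unfolding ze c by simp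
  have "0 < C (q j) - C x"
    by (rule affine_fun_strict_hull_pos[OF fin(1) _ _ _ u(3), of "\<lambda>y. C (q j) - C y"])
      (use lt in \<open>auto simp: tri_def intro!: affine_fun_diff\<close>)
  then show "level z < C (q j)" unfolding ze c by simp
  have pos: "0 < sg j * line_dist i x" if "i \<in> {j, j + 1}"
  proof (rule affine_fun_strict_hull_pos[OF fin(1) _ _ _ u(3)])
    show "affine_fun (\<lambda>x. sg j * line_dist i x)" by (intro affine_fun_scale) simp
    have l: "line_dist j (q (j + 1)) = 0" "line_dist (j + 1) (q (j + 1)) = 0" "line_dist (j + 1) (q (j + 2)) = 0" "line_dist j (q j) = 0"
      using line_dist_q_Suc[of j] line_dist_q_Suc[of "j + 1"] j by simp_all
    note a = line_dist_above[OF j]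
    show "0 \<le> sg j * line_dist i y" if "y \<in> tri j" for y
      using that \<open>i \<in> {j, j + 1}\<close> l a unfolding tri_def by (elim insertE emptyE) simp_all
    show "\<exists>y\<in>tri j. 0 < sg j * line_dist i y"
      using \<open>i \<in> {j, j + 1}\<close> a unfolding tri_def by blast
  qed
  show "offset i z < 0" if "i \<in> {j, j + 1}" "odd j"
  proof -
    have "line_dist i x < 0" using pos[OF that(1)] that(2) by (simp add: sg_def)
    moreover have "S W = S w1" using that by (simp add: W_def)
    ultimately show ?thesis unfolding ze c using u by (simp add: mult_less_0_iff)
  qed
  show "ht z * (S w2 - S w1) < offset i z" if "i \<in> {j, j + 1}" "even j"
  proof -
    have "0 < line_dist i x" using pos[OF that(1)] that(2) by (simp add: sg_def)
    moreover have "S W = S w2" using that by (simp add: W_def)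
    ultimately show ?thesis unfolding ze c using u by simp
  qed
qed

lemma prism_prism_disjoint:
  assumes "i < j" "j + 1 < m"
  shows "strict_hull (prism i) \<inter> strict_hull (prism j) = {}"
proof (rule equals0I)
  fix z assume z: "z \<in> strict_hull (prism i) \<inter> strict_hull (prism j)"
  then have "C (q (i + 1)) < level z" "level z < C (q j)"
    using prism_interior[of i z] prism_interior[of j z] assms by auto
  moreover have "C (q j) \<le> C (q (i + 1))" using C_q_le[of "i + 1" j] assms by simp
  ultimately show False by simp
qed

text \<open>Common levels force the step of the prism to bound the triangle of the pyramid. The
  offset from that step then lies inside the range of the prism and outside it at once.\<close>

lemma prism_pyramid_disjoint:
  assumes "i + 1 < m" "j + 2 < m"
  shows "strict_hull (prism i) \<inter> strict_hull (pyramid j) = {}"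
proof (rule equals0I)
  fix z assume z: "z \<in> strict_hull (prism i) \<inter> strict_hull (pyramid j)"
  note 1 = prism_interior[of i z] and 2 = pyramid_interior[of j z]
  have "C (q (i + 1)) < C (q j)" "C (q (j + 2)) < C (q i)"
    using 1 2 assms z by force+
  then have "i \<in> {j, j + 1}"
    using C_mono_less[of j "i + 1"] C_mono_less[of i "j + 2"] assms by auto
  then show False using 1(3,4) 2(3,4)[of i] z assms by (cases "odd j") force+
qed

text \<open>Common levels force \<open>j = i + 1\<close>. The parities differ, so the offsets from
  the shared step \<open>j\<close> lie beyond opposite ends of the range of the prism.\<close>

lemma pyramid_pyramid_disjoint:
  assumes "i < j" "j + 2 < m"
  shows "strict_hull (pyramid i) \<inter> strict_hull (pyramid j) = {}"
proof (rule equals0I)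
  fix z assume z: "z \<in> strict_hull (pyramid i) \<inter> strict_hull (pyramid j)"
  note 1 = pyramid_interior[of i z] and 2 = pyramid_interior[of j z]
  have "C (q (i + 2)) < C (q j)"
    using 1(1) 2(2) assms z by force
  then have j: "j = i + 1"
    using C_mono_less[of j "i + 2"] assms by auto
  have "0 < ht z * (S w2 - S w1)"
    using 1(5) z assms w(2) by auto
  then show False using 1(3,4)[of j] 2(3,4)[of j] z assms j by (cases "odd j") force+
qed

lemma affine_ht [simp]: "affine_fun ht"
  unfolding ht_def[abs_def] divide_inverse by (intro affine_fun_scale_right) simp

lemma affine_offset [simp]: "affine_fun (offset i)"
  unfolding offset_def[abs_def] by (intro affine_fun_diff affine_fun_scale_right) simp_all

lemma w_ne: "w1 \<noteq> w2"
  using w by auto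

lemma prism_simplex:
  assumes i: "i + 1 < m"
  shows "\<not> affine_dependent (prism i)" "card (prism i) = 4"
proof -
  have ne: "q i \<noteq> q (i + 1)" using q_inj[of i "i + 1"] i by auto
  have h: "ht w1 = 1" "ht w2 = 1" "\<And>k. ht (q k) = 0" using w by (auto simp: ht_def)
  have 1: "\<not> affine_dependent {q i, q (i + 1)}" by (rule affine_independent_2)
  have 2: "\<not> affine_dependent (insert w1 {q i, q (i + 1)})"
    by (rule affine_independent_insert_fun[OF 1 affine_ht]) (auto simp: h)
  have "line_dist i w2 - line_dist i w1 = S w2 - S w1" using w by (intro line_dist_shift) simp
  then have "offset i w2 \<noteq> 0" using w(2) by (simp add: offset_def h)
  moreover have "offset i x = 0" if "x \<in> insert w1 {q i, q (i + 1)}" for x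
    using that line_dist_q_Suc[OF i] by (auto simp: offset_def h)
  ultimately have "\<not> affine_dependent (insert w2 (insert w1 {q i, q (i + 1)}))"
    by (intro affine_independent_insert_fun[OF 2 affine_offset]) auto
  moreover have "prism i = insert w2 (insert w1 {q i, q (i + 1)})" by (auto simp: prism_def)
  ultimately show "\<not> affine_dependent (prism i)" by simp
  show "card (prism i) = 4" using ne w_ne by (simp add: prism_def)
qed

lemma pyramid_simplex:
  assumes j: "j + 2 < m"
  shows "\<not> affine_dependent (pyramid j)" "card (pyramid j) = 4"
proof -
  define W where "W = (if odd j then w1 else w2)"
  have ne: "q j \<noteq> q (j + 1)" "q j \<noteq> q (j + 2)" "q (j + 1) \<noteq> q (j + 2)"
    using q_inj[of j "j + 1"] q_inj[of j "j + 2"] q_inj[of "j + 1" "j + 2"] j by auto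
  have 1: "\<not> affine_dependent {q j, q (j + 1)}" by (rule affine_independent_2)
  have "line_dist j (q (j + 2)) \<noteq> 0" using line_dist_above(1)[OF j] by auto
  then have 2: "\<not> affine_dependent (insert (q (j + 2)) {q j, q (j + 1)})"
    using line_dist_q_Suc[of j] j by (intro affine_independent_insert_fun[OF 1 affine_line_dist[of j]]) auto
  have "Z W \<noteq> 0" using w by (auto simp: W_def)
  then have "\<not> affine_dependent (insert W (insert (q (j + 2)) {q j, q (j + 1)}))"
    by (intro affine_independent_insert_fun[OF 2 affine_fun_coord[of c ez]]) auto
  moreover have "pyramid j = insert W (insert (q (j + 2)) {q j, q (j + 1)})"
    by (auto simp: pyramid_def W_def tri_def)
  ultimately show "\<not> affine_dependent (pyramid j)" by simp
  show "card (pyramid j) = 4" using ne by (simp add: pyramid_def tri_def)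
qed

definition half_tets :: "space set set" where
  "half_tets = prism ` {i. i + 1 < m} \<union> pyramid ` {j. j + 2 < m}"

lemma half_tets_simplex:
  assumes "T \<in> half_tets"
  shows "\<not> affine_dependent T" "card T = 4" "T \<subseteq> Q0 \<union> {w1, w2}" "T \<inter> {w1, w2} \<noteq> {}"
proof -
  have "(\<exists>i. i + 1 < m \<and> T = prism i) \<or> (\<exists>j. j + 2 < m \<and> T = pyramid j)"
    using assms by (auto simp: half_tets_def)
  then show "\<not> affine_dependent T" "card T = 4" "T \<subseteq> Q0 \<union> {w1, w2}" "T \<inter> {w1, w2} \<noteq> {}"
    using prism_simplex pyramid_simplex by (auto simp: prism_def pyramid_def tri_def)
qed

lemma half_tets_cover: "convex hull (Q0 \<union> {w1, w2}) \<subseteq> (\<Union>T\<in>half_tets. convex hull T)"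
proof
  fix z assume "z \<in> convex hull (Q0 \<union> {w1, w2})"
  from half_cover[OF this] show "z \<in> (\<Union>T\<in>half_tets. convex hull T)"
    unfolding half_tets_def by (elim disjE exE conjE) (auto simp: less_diff_conv)
qed

lemma half_tets_disjoint:
  assumes "T \<in> half_tets" "T' \<in> half_tets" "T \<noteq> T'"
  shows "strict_hull T \<inter> strict_hull T' = {}"
proof -
  have pp: "strict_hull (prism i) \<inter> strict_hull (prism j) = {}" if "i \<noteq> j" "i + 1 < m" "j + 1 < m" for i j
    using prism_prism_disjoint[of i j] prism_prism_disjoint[of j i] that by (cases "i < j") (auto simp: Int_commute)
  have yy: "strict_hull (pyramid i) \<inter> strict_hull (pyramid j) = {}" if "i \<noteq> j" "i + 2 < m" "j + 2 < m" for i j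
    using pyramid_pyramid_disjoint[of i j] pyramid_pyramid_disjoint[of j i] that by (cases "i < j") (auto simp: Int_commute)
  have cases: "(\<exists>i. i + 1 < m \<and> T = prism i) \<or> (\<exists>j. j + 2 < m \<and> T = pyramid j)" if "T \<in> half_tets" for T
    using that by (auto simp: half_tets_def)
  consider i j where "i + 1 < m" "j + 1 < m" "T = prism i" "T' = prism j"
    | i j where "i + 1 < m" "j + 2 < m" "T = prism i" "T' = pyramid j"
    | i j where "i + 1 < m" "j + 2 < m" "T' = prism i" "T = pyramid j"
    | i j where "i + 2 < m" "j + 2 < m" "T = pyramid i" "T' = pyramid j"
    using cases[OF assms(1)] cases[OF assms(2)] by blast
  then show ?thesis
  proof cases
    case (1 i j)
    then show ?thesis using pp[of i j] assms(3) by auto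
  next
    case (2 i j)
    then show ?thesis using prism_pyramid_disjoint[of i j] by simp
  next
    case (3 i j)
    then show ?thesis using prism_pyramid_disjoint[of i j] by (simp add: Int_commute)
  next
    case (4 i j)
    then show ?thesis using yy[of i j] assms(3) by auto
  qed
qed

text \<open>Strict hulls are nonempty by the barycentre, so their disjointness makes the
  \<open>m - 1\<close> prisms and \<open>m - 2\<close> pyramids distinct.\<close>

lemma half_tets_card: "finite half_tets" "card half_tets = 2 * m - 3"
proof -
  have ne: "strict_hull A \<noteq> {}" if "card A = 4" for A
  proof -
    have "(\<Sum>x\<in>A. (1 / 4) *\<^sub>R x) \<in> strict_hull A"
      unfolding strict_hull_def using that by (intro CollectI exI[of _ "\<lambda>_. 1 / 4"]) auto
    then show ?thesis by blast
  qed
  have i1: "inj_on prism {i. i + 1 < m}"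
  proof (rule linorder_inj_onI')
    fix i j assume "i \<in> {i. i + 1 < m}" "j \<in> {i. i + 1 < m}" "i < j"
    then show "prism i \<noteq> prism j"
      using prism_prism_disjoint[of i j] ne[OF prism_simplex(2), of i] by auto
  qed
  have i2: "inj_on pyramid {j. j + 2 < m}"
  proof (rule linorder_inj_onI')
    fix i j assume "i \<in> {j. j + 2 < m}" "j \<in> {j. j + 2 < m}" "i < j"
    then show "pyramid i \<noteq> pyramid j"
      using pyramid_pyramid_disjoint[of i j] ne[OF pyramid_simplex(2), of i] by auto
  qed
  have i3: "prism ` {i. i + 1 < m} \<inter> pyramid ` {j. j + 2 < m} = {}"
  proof (rule equals0I)
    fix T assume "T \<in> prism ` {i. i + 1 < m} \<inter> pyramid ` {j. j + 2 < m}"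
    then obtain i j where "i + 1 < m" "j + 2 < m" "T = prism i" "T = pyramid j" by auto
    then show False using prism_pyramid_disjoint[of i j] ne[OF prism_simplex(2), of i] by auto
  qed
  have e: "{i. i + 1 < m} = {..<m - 1}" "{j. j + 2 < m} = {..<m - 2}" by auto
  then show "finite half_tets" by (simp add: half_tets_def)
  have "card half_tets = (m - 1) + (m - 2)"
    unfolding half_tets_def using card_Un_disjoint[OF _ _ i3] card_image[OF i1] card_image[OF i2] e by simp
  then show "card half_tets = 2 * m - 3" using m by simp
qed

end

subsection \<open>Tetrahedra around the edge \<open>w1 w2\<close>\<close>

context half
begin

lemma C_le_iff: "i < m \<Longrightarrow> j < m \<Longrightarrow> C (q j) \<le> C (q i) \<longleftrightarrow> i \<le> j"
  using C_mono_less[of j i] by (simp add: not_less[symmetric])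

lemma pair_obtain:
  assumes "e \<subseteq> Q0" "card e = 2"
  obtains a k where "a < k" "k < m" "e = {q a, q k}"
proof -
  obtain x y where xy: "e = {x, y}" "x \<noteq> y" using assms(2) by (auto simp: card_2_iff)
  then obtain a k where ad: "x = q a" "y = q k" "a < m" "k < m"
    using assms(1) q_image by (metis imageE insert_subset lessThan_iff)
  then have "a \<noteq> k" using xy by auto
  then show ?thesis
    using that[of a k] that[of k a] ad xy by (cases "a < k") (auto simp: insert_commute)
qed

text \<open>The gaps between consecutive levels of vertices that a chord spans. Two tetrahedra around the
  edge \<open>w1 w2\<close> with base chords spanning a common gap overlap close to the edge.\<close>

definition gaps :: "space set \<Rightarrow> nat set" where
  "gaps e = {i. i + 1 < m \<and> (\<exists>p\<in>e. C (q i) \<le> C p) \<and> (\<exists>p\<in>e. C p \<le> C (q (i + 1)))}"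

lemma gaps_pair:
  assumes "a < k" "k < m"
  shows "gaps {q a, q k} = {a..<k}"
  using assms C_le_iff by (auto simp: gaps_def)

lemma card_gaps_pos: "e \<subseteq> Q0 \<Longrightarrow> card e = 2 \<Longrightarrow> 1 \<le> card (gaps e)"
  by (erule pair_obtain) (auto simp: gaps_pair)

lemma card_gaps_1:
  assumes "e \<subseteq> Q0" "card e = 2" "card (gaps e) = 1"
  obtains i where "i + 1 < m" "e = {q i, q (i + 1)}"
proof -
  obtain a k where ad: "a < k" "k < m" "e = {q a, q k}" using pair_obtain[OF assms(1,2)] by blast
  then have "k = a + 1" using assms(3) by (simp add: gaps_pair)
  then show ?thesis using that[of a] ad by simp
qed

definition around :: "space set set \<Rightarrow> space set set" where
  "around K = {e. e \<subseteq> Q0 \<and> card e = 2 \<and> e \<union> {w1, w2} \<in> K}"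

lemma gap_point:
  assumes e: "e \<subseteq> Q0" "card e = 2" "i \<in> gaps e" and y: "C (q (i + 1)) < y" "y < C (q i)"
  obtains x where "x \<in> strict_hull e" "C x = y" "Z x = 0"
proof -
  obtain a k where ad: "a < k" "k < m" "e = {q a, q k}" using pair_obtain[OF e(1,2)] by blast
  then have "a \<le> i" "i + 1 \<le> k" using e(3) by (auto simp: gaps_pair)
  then have "C (q k) \<le> C (q (i + 1))" "C (q i) \<le> C (q a)" using C_q_le[of "i + 1" k] C_q_le[of a i] ad by auto
  then have lt: "C (q k) < y" "y < C (q a)" using y by auto
  define \<tau> where "\<tau> = (C (q a) - y) / (C (q a) - C (q k))"
  have \<tau>: "0 < \<tau>" "\<tau> < 1" using lt by (auto simp: \<tau>_def)
  have \<tau>2: "\<tau> * (C (q a) - C (q k)) = C (q a) - y" using lt by (simp add: \<tau>_def)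
  define x where "x = (1 - \<tau>) *\<^sub>R q a + \<tau> *\<^sub>R q k"
  have "x \<in> strict_hull e" unfolding x_def ad(3) using \<tau> by (rule strict_hull_pairI)
  moreover have "C x = C (q a) - \<tau> * (C (q a) - C (q k))"
    unfolding x_def affine_fun_segment[OF affine_fun_coord] by (simp add: algebra_simps)
  moreover have "Z x = 0" unfolding x_def affine_fun_segment[OF affine_fun_coord] by simp
  ultimately show ?thesis using that[of x] \<tau>2 by simp
qed

lemma Q0_no_w: "e \<subseteq> Q0 \<Longrightarrow> w1 \<notin> e \<and> w2 \<notin> e"
  using w q_image by (metis Z_hull hull_inc less_irrefl subsetD)

text \<open>On both chords a point at a common level is chosen. They differ only parallel to the
  edge, and close to the edge this difference is absorbed by moving along
  \<open>w1 w2\<close>.\<close>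

lemma gaps_disjoint:
  assumes K: "face_to_face K" and e: "e \<in> around K" "e' \<in> around K" "e \<noteq> e'"
  shows "gaps e \<inter> gaps e' = {}"
proof (rule equals0I)
  fix i assume "i \<in> gaps e \<inter> gaps e'"
  then have i: "i \<in> gaps e" "i \<in> gaps e'" by auto
  have eQ: "e \<subseteq> Q0" "card e = 2" "e \<union> {w1, w2} \<in> K" "e' \<subseteq> Q0" "card e' = 2" "e' \<union> {w1, w2} \<in> K"
    using e by (auto simp: around_def)
  have "i + 1 < m" using i by (auto simp: gaps_def)
  then have lt: "C (q (i + 1)) < C (q i)" using C_q_less by simp
  define y where "y = (C (q (i + 1)) + C (q i)) / 2"
  have y: "C (q (i + 1)) < y" "y < C (q i)" using lt by (auto simp: y_def)
  obtain x where x: "x \<in> strict_hull e" "C x = y" "Z x = 0" using gap_point[OF eQ(1,2) i(1) y] by blast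
  obtain x' where x': "x' \<in> strict_hull e'" "C x' = y" "Z x' = 0" using gap_point[OF eQ(4,5) i(2) y] by blast
  have fin: "finite e" "finite e'" using eQ finite_subset[OF _ finite_Q0] by auto
  define L where "L = S w2 - S w1"
  define \<Delta> where "\<Delta> = S x - S x'"
  have L: "0 < L" using w by (simp add: L_def)
  \<comment> \<open>\<open>\<kappa>\<close> and \<open>u\<close> solve
    \<open>(1 - u) * \<Delta> = u * \<kappa> * L\<close> with \<open>\<kappa>\<close> strictly
    between -1 and 1, so that the points \<open>W\<close> and \<open>W'\<close>, apart by
    \<open>\<kappa> * L\<close>, stay inside the edge.\<close>
  define \<kappa> where "\<kappa> = \<Delta> / (2 * \<bar>\<Delta>\<bar> + L)"
  have den: "0 < 2 * \<bar>\<Delta>\<bar> + L" using L by simp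
  have \<kappa>: "- 1 < \<kappa>" "\<kappa> < 1"
    using L den by (auto simp: \<kappa>_def divide_simps)
  define u where "u = (2 * \<bar>\<Delta>\<bar> + L) / (2 * \<bar>\<Delta>\<bar> + 2 * L)"
  have u: "0 < u" "u < 1" using L den by (auto simp: u_def divide_simps)
  have uk: "(1 - u) * \<Delta> = u * \<kappa> * L"
    using L den by (simp add: u_def \<kappa>_def divide_simps)
  define W where "W = (1 - (1 - \<kappa>) / 2) *\<^sub>R w1 + ((1 - \<kappa>) / 2) *\<^sub>R w2"
  define W' where "W' = (1 - (1 + \<kappa>) / 2) *\<^sub>R w1 + ((1 + \<kappa>) / 2) *\<^sub>R w2"
  have W: "W \<in> strict_hull {w1, w2}" "W' \<in> strict_hull {w1, w2}"
    unfolding W_def W'_def using \<kappa> by (auto intro!: strict_hull_pairI)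
  have cW: "C W = C w1" "Z W = Z w1" "S W = S w1 + (1 - \<kappa>) / 2 * L"
     "C W' = C w1" "Z W' = Z w1" "S W' = S w1 + (1 + \<kappa>) / 2 * L"
    unfolding W_def W'_def affine_fun_segment[OF affine_fun_coord] using w by (simp_all add: L_def algebra_simps)
  define z where "z = (1 - u) *\<^sub>R x + u *\<^sub>R W"
  have "z = (1 - u) *\<^sub>R x' + u *\<^sub>R W'"
  proof (rule coords_eqI)
    show "C z = C ((1 - u) *\<^sub>R x' + u *\<^sub>R W')" "Z z = Z ((1 - u) *\<^sub>R x' + u *\<^sub>R W')"
      unfolding z_def affine_fun_segment[OF affine_fun_coord] cW x x' by simp_all
    have "(1 - u) * S x = (1 - u) * S x' + u * \<kappa> * L"
      using uk by (simp add: \<Delta>_def algebra_simps)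
    then show "S z = S ((1 - u) *\<^sub>R x' + u *\<^sub>R W')"
      unfolding z_def affine_fun_segment[OF affine_fun_coord] cW by (simp add: field_simps)
  qed
  then have "z \<in> strict_hull (e' \<union> {w1, w2})"
    using strict_hull_combine[OF fin(2) _ x'(1) W(2) u] by simp
  then have z': "z \<in> convex hull (e' \<union> {w1, w2})"
    using strict_hull_subset[of "e' \<union> {w1, w2}"] fin by auto
  have "z \<in> strict_hull (e \<union> {w1, w2})"
    unfolding z_def using strict_hull_combine[OF fin(1) _ x(1) W(1) u] by simp
  then have "e \<union> {w1, w2} \<subseteq> e' \<union> {w1, w2}"
    by (rule face_to_face_strict[OF K eQ(3) subset_refl eQ(6) subset_refl _ z'])
  then have "e \<subseteq> e'" using Q0_no_w[OF eQ(1)] by blast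
  then have "e = e'" using card_subset_eq[OF fin(2)] eQ by simp
  then show False using e(3) by simp
qed

lemma finite_around: "finite (around K)"
  by (rule finite_subset[of _ "Pow Q0"]) (auto simp: around_def)

text \<open>The sets of gaps are disjoint subsets of the \<open>m - 1\<close> gaps. The dichotomy
  behind the last unit of the bound: either a gap stays free, or \<open>apex_separation\<close> is
  applicable.\<close>

lemma sum_card_gaps:
  assumes K: "face_to_face K"
  shows "(\<Sum>e\<in>around K. card (gaps e)) \<le> m - 1"
    "\<exists>i. i + 1 < m \<and> (\<forall>e\<in>around K. i \<notin> gaps e) \<Longrightarrow> (\<Sum>e\<in>around K. card (gaps e)) \<le> m - 2"
proof -
  have sub: "(\<Union>e\<in>around K. gaps e) \<subseteq> {..<m - 1}" by (auto simp: gaps_def)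
  have "\<forall>e\<in>around K. finite (gaps e)"
    by (auto simp: gaps_def intro: finite_subset[of _ "{..<m}"])
  then have eq: "card (\<Union>e\<in>around K. gaps e) = (\<Sum>e\<in>around K. card (gaps e))"
    using gaps_disjoint[OF K] finite_around by (intro card_UN_disjoint) auto
  show "(\<Sum>e\<in>around K. card (gaps e)) \<le> m - 1"
    using card_mono[OF _ sub] eq by simp
  assume "\<exists>i. i + 1 < m \<and> (\<forall>e\<in>around K. i \<notin> gaps e)"
  then obtain i where "i + 1 < m" "\<forall>e\<in>around K. i \<notin> gaps e" by blast
  then have "(\<Union>e\<in>around K. gaps e) \<subseteq> {..<m - 1} - {i}" using sub by auto
  then have "card (\<Union>e\<in>around K. gaps e) \<le> card ({..<m - 1} - {i})" by (intro card_mono) auto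
  also have "\<dots> = m - 2" using \<open>i + 1 < m\<close> by simp
  finally show "(\<Sum>e\<in>around K. card (gaps e)) \<le> m - 2" using eq by simp
qed

text \<open>If \<open>y\<close> were on the wrong side of \<open>x\<close>, the edge from \<open>wa\<close> to \<open>U\<close> would start inside the
  tetrahedron over \<open>e\<close>.\<close>

lemma apex_side:
  assumes K: "face_to_face K" and e: "e \<in> around K" and wab: "{wa, wb} = {w1, w2}"
    and U: "{wa, U} \<subseteq> T" "T \<in> K" "Z U < 0"
    and x: "x \<in> strict_hull {wa, U}" "Z x = 0" and y: "y \<in> convex hull e" "C y = C x"
  shows "(S x - S y) * (S wb - S wa) < 0"
proof (rule ccontr)
  assume neg: "\<not> ?thesis"
  have wab2: "C wa = C wb" "Z wa = Z wb" "S wa \<noteq> S wb" "Z wa = Z w1"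
    using wab w by (auto simp: doubleton_eq_iff)
  define L where "L = S wb - S wa"
  have L: "L \<noteq> 0" using wab2 by (simp add: L_def)
  define \<kappa> where "\<kappa> = (S x - S y) / L"
  have \<kappa>L: "\<kappa> * L = S x - S y" using L by (simp add: \<kappa>_def)
  have \<kappa>: "0 \<le> \<kappa>"
    using neg L unfolding \<kappa>_def L_def[symmetric] by (simp add: zero_le_divide_iff zero_le_mult_iff not_less)
  have eQ: "e \<subseteq> Q0" "e \<union> {w1, w2} \<in> K" using e by (auto simp: around_def)
  have Zy: "Z y = 0"
    using y(1) Z_hull hull_mono[OF eQ(1), of convex] by blast
  \<comment> \<open>\<open>\<kappa>\<close> is the displacement of \<open>x\<close> from
    \<open>y\<close> in units of the edge. The equation
    \<open>(1 - \<epsilon>) * \<rho> = \<epsilon> * \<kappa>\<close> lets a point near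
    \<open>wa\<close> be written both on the segment to \<open>x\<close> and over
    \<open>y\<close>.\<close>
  define \<epsilon> where "\<epsilon> = 1 / (2 + \<kappa>)"
  define \<rho> where "\<rho> = \<kappa> / (1 + \<kappa>)"
  have \<epsilon>: "0 < \<epsilon>" "\<epsilon> < 1" and \<rho>: "0 \<le> \<rho>" "\<rho> \<le> 1" and er: "(1 - \<epsilon>) * \<rho> = \<epsilon> * \<kappa>"
    using \<kappa> by (auto simp: \<epsilon>_def \<rho>_def divide_simps)
  define W where "W = (1 - \<rho>) *\<^sub>R wa + \<rho> *\<^sub>R wb"
  define z where "z = (1 - \<epsilon>) *\<^sub>R wa + \<epsilon> *\<^sub>R x"
  have cW: "C W = C wa" "Z W = Z wa" "S W = S wa + \<rho> * L"
    unfolding W_def affine_fun_segment[OF affine_fun_coord] using wab2 by (simp_all add: L_def algebra_simps)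
  have "z = (1 - \<epsilon>) *\<^sub>R W + \<epsilon> *\<^sub>R y"
  proof (rule coords_eqI)
    show "C z = C ((1 - \<epsilon>) *\<^sub>R W + \<epsilon> *\<^sub>R y)" "Z z = Z ((1 - \<epsilon>) *\<^sub>R W + \<epsilon> *\<^sub>R y)"
      unfolding z_def affine_fun_segment[OF affine_fun_coord] cW y x Zy by simp_all
    have "(1 - \<epsilon>) * (\<rho> * L) = \<epsilon> * (S x - S y)" using er \<kappa>L by (metis mult.assoc)
    then show "S z = S ((1 - \<epsilon>) *\<^sub>R W + \<epsilon> *\<^sub>R y)"
      unfolding z_def affine_fun_segment[OF affine_fun_coord] cW distrib_left by (simp add: algebra_simps)
  qed
  moreover have "W \<in> convex hull {w1, w2}"
    unfolding wab[symmetric] segment_convex_hull[symmetric] W_def using \<rho> by (auto simp: in_segment)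
  ultimately have z1: "z \<in> convex hull (e \<union> {w1, w2})"
    using convex_comb_hull[of W "{w1, w2}" y e \<epsilon>] y(1) \<epsilon> by (simp add: Un_commute)
  have "z \<in> strict_hull ({wa} \<union> {wa, U})"
    unfolding z_def using strict_hull_combine[of "{wa}" "{wa, U}" wa x \<epsilon>] x(1) \<epsilon> by simp
  then have "z \<in> strict_hull {wa, U}" by (simp add: insert_commute)
  then have "{wa, U} \<subseteq> e \<union> {w1, w2}"
    by (rule face_to_face_strict[OF K U(2,1) eQ(2) subset_refl _ z1])
  moreover have "U \<notin> e" using U(3) eQ(1) Z_hull[of U] hull_inc[of U Q0 convex] by auto
  moreover have "U \<noteq> w1" "U \<noteq> w2" using U(3) w by auto
  ultimately show False by auto
qed

text \<open>With all gaps covered, some link chord has a point \<open>y\<close> at the common level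
  of \<open>x1\<close> and \<open>x2\<close>. Applied to \<open>w1\<close> and to \<open>w2\<close>,
  \<open>apex_side\<close> puts the two points on opposite sides of it.\<close>

lemma apex_separation:
  assumes K: "face_to_face K" and cov: "\<forall>i. i + 1 < m \<longrightarrow> (\<exists>e\<in>around K. i \<in> gaps e)"
    and U: "{w1, U} \<subseteq> T1" "T1 \<in> K" "{w2, U} \<subseteq> T2" "T2 \<in> K" "Z U < 0"
    and x: "x1 \<in> strict_hull {w1, U}" "x1 \<in> convex hull Q0" "x2 \<in> strict_hull {w2, U}" "x2 \<in> convex hull Q0" "C x1 = C x2"
  obtains e y where "e \<in> around K" "y \<in> convex hull e" "C y = C x1" "S x1 < S y" "S y < S x2"
proof -
  obtain i where i: "i + 1 < m" "C (q (i + 1)) \<le> C x1" "C x1 \<le> C (q i)"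
    using exists_slab[OF x(2)] by blast
  obtain e where e: "e \<in> around K" "i \<in> gaps e" using cov i(1) by blast
  have eQ: "e \<subseteq> Q0" "card e = 2" using e by (auto simp: around_def)
  obtain a k where ad: "a < k" "k < m" "e = {q a, q k}" using pair_obtain[OF eQ] by blast
  then have "a \<le> i" "i + 1 \<le> k" using e(2) by (auto simp: gaps_pair)
  then have "C (q k) \<le> C x1" "C x1 \<le> C (q a)" using C_q_le[of "i + 1" k] C_q_le[of a i] ad i by auto
  then obtain y where y: "y \<in> closed_segment (q a) (q k)" "C y = C x1"
    using level_point[of "q k" "C x1" "q a"] C_q_less[OF ad(1,2)] by blast
  have yh: "y \<in> convex hull e" using y(1) ad(3) by (simp add: segment_convex_hull)
  have "(S x1 - S y) * (S w2 - S w1) < 0"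
    by (rule apex_side[OF K e(1) refl U(1,2,5) x(1) Z_hull[OF x(2)] yh y(2)])
  moreover have "(S x2 - S y) * (S w1 - S w2) < 0"
    using y(2) x(5) by (intro apex_side[OF K e(1) _ U(3,4,5) x(3) Z_hull[OF x(4)] yh]) auto
  ultimately have "S x1 < S y" "S y < S x2"
    using w(2) by (auto simp: mult_less_0_iff)
  then show ?thesis using that e(1) yh y(2) by blast
qed

end

subsection \<open>The polytope\<close>

lemma round_angle:
  fixes \<psi> \<delta> :: real
  assumes "0 < \<delta>"
  obtains n :: int where "\<bar>\<psi> - of_int n * \<delta>\<bar> \<le> \<delta> / 2"
proof -
  have "\<bar>of_int (round (\<psi> / \<delta>)) - \<psi> / \<delta>\<bar> \<le> 1 / 2" by (rule of_int_round_abs_le)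
  then have "\<bar>of_int (round (\<psi> / \<delta>)) - \<psi> / \<delta>\<bar> * \<delta> \<le> 1 / 2 * \<delta>"
    using assms by (intro mult_right_mono) auto
  moreover have "\<bar>of_int (round (\<psi> / \<delta>)) - \<psi> / \<delta>\<bar> * \<delta> = \<bar>\<psi> - of_int (round (\<psi> / \<delta>)) * \<delta>\<bar>"
  proof -
    have "\<bar>of_int (round (\<psi> / \<delta>)) - \<psi> / \<delta>\<bar> * \<delta> = \<bar>(of_int (round (\<psi> / \<delta>)) - \<psi> / \<delta>) * \<delta>\<bar>"
      using assms by (simp add: abs_mult)
    also have "(of_int (round (\<psi> / \<delta>)) - \<psi> / \<delta>) * \<delta> = - (\<psi> - of_int (round (\<psi> / \<delta>)) * \<delta>)"
      using assms by (simp add: algebra_simps)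
    finally show ?thesis by simp
  qed
  ultimately show ?thesis using that by simp
qed

lemma range_minus_int: "range (\<lambda>k::int. F (- k)) = range F"
proof -
  have "F k \<in> range (\<lambda>k::int. F (- k))" for k
    by (rule range_eqI[of _ _ "- k"]) simp
  then show ?thesis by auto
qed

lemma range_plus_int: "range (\<lambda>k::int. F (k + n)) = range F"
proof -
  have "F k \<in> range (\<lambda>k::int. F (k + n))" for k
    by (rule range_eqI[of _ _ "k - n"]) simp
  then show ?thesis by auto
qed

lemma convex_comb3:
  assumes "convex A" "x \<in> A" "y \<in> A" "z \<in> A" "0 \<le> a" "0 \<le> b" "0 \<le> d" "a + b + d = (1::real)"
  shows "a *\<^sub>R x + b *\<^sub>R y + d *\<^sub>R z \<in> A"
proof -
  have "convex hull {x, y, z} \<subseteq> A" using assms by (intro hull_minimal) auto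
  then show ?thesis using assms(5-8) unfolding convex_hull_3 by blast
qed

lemma not_in_hull:
  assumes "affine_fun f" "\<And>x. x \<in> A \<Longrightarrow> f x < f y"
  shows "y \<notin> convex hull A"
proof
  assume y: "y \<in> convex hull A"
  obtain a b where f: "\<And>p. f p = a \<bullet> p + b"
    using assms(1) unfolding affine_fun_def by blast
  have "convex hull A \<subseteq> {x. a \<bullet> x < a \<bullet> y}"
    by (rule hull_minimal, use assms(2) in \<open>force simp: f\<close>, rule convex_halfspace_lt)
  then show False using y by auto
qed

text \<open>\<open>ex\<close> and \<open>ey\<close> are the directions of \<open>v1 v2\<close> and
  \<open>u1 u2\<close>, and the polygon lies at height 0 around \<open>c\<close>. That no edge or
  diagonal is parallel to them becomes \<open>generic\<close>: neither \<open>X\<close> nor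
  \<open>Y\<close> takes a value twice on the vertices.\<close>

locale Pm =
  fixes ex ey ez c :: space and r \<theta> :: real and m :: nat and Q0 :: "space set" and v1 v2 u1 u2 :: space
  assumes orthonormal: "norm ex = 1" "norm ey = 1" "norm ez = 1" "ex \<bullet> ey = 0" "ex \<bullet> ez = 0" "ey \<bullet> ez = 0"
    and r: "0 < r" and m: "4 \<le> m" "even m"
    and Q0: "Q0 = range (\<lambda>k::int. circle_pt c ex ey r (\<theta> + 2 * pi * of_int k / m))"
    and generic: "\<And>p p'. p \<in> Q0 \<Longrightarrow> p' \<in> Q0 \<Longrightarrow> p \<noteq> p'
      \<Longrightarrow> coord c ex p \<noteq> coord c ex p' \<and> coord c ey p \<noteq> coord c ey p'"
    and v: "coord c ey v1 = coord c ey v2" "coord c ex v1 < coord c ex v2" "coord c ez v1 = coord c ez v2" "0 < coord c ez v1"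
    and u: "coord c ex u1 = coord c ex u2" "coord c ey u1 < coord c ey u2" "coord c ez u1 = coord c ez u2" "coord c ez u1 < 0"
    and cross: "\<And>v u. v \<in> {v1, v2} \<Longrightarrow> u \<in> {u1, u2} \<Longrightarrow> closed_segment v u \<inter> rel_interior (convex hull Q0) \<noteq> {}"
begin

abbreviation "X \<equiv> coord c ex"
abbreviation "Y \<equiv> coord c ey"
abbreviation "Z \<equiv> coord c ez"

sublocale fr: frame ex ey ez c
  by unfold_locales (rule orthonormal)+

lemma Q0_swap: "Q0 = range (\<lambda>k::int. circle_pt c ey ex r ((pi / 2 - \<theta>) + 2 * pi * of_int k / m))"
proof -
  have e: "circle_pt c ey ex r ((pi / 2 - \<theta>) + 2 * pi * of_int k / m)
      = circle_pt c ex ey r (\<theta> + 2 * pi * of_int (- k) / m)" for k :: int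
    unfolding circle_pt_swap[of c ey ex] by (simp add: algebra_simps)
  show ?thesis
    unfolding e Q0 by (rule range_minus_int[of "\<lambda>k. circle_pt c ex ey r (\<theta> + 2 * pi * of_int k / m)", symmetric])
qed

text \<open>Facts about the edge \<open>v1 v2\<close> carry over to \<open>u1 u2\<close> by this symmetry.\<close>

lemma swap: "Pm ey ex (- ez) c r (pi / 2 - \<theta>) m Q0 u1 u2 v1 v2"
proof
  show "Q0 = range (\<lambda>k::int. circle_pt c ey ex r ((pi / 2 - \<theta>) + 2 * pi * of_int k / m))"
    by (rule Q0_swap)
  show "closed_segment v u \<inter> rel_interior (convex hull Q0) \<noteq> {}" if "v \<in> {u1, u2}" "u \<in> {v1, v2}" for v u
    using cross[OF that(2,1)] by (simp add: closed_segment_commute)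
  show "coord c ey p \<noteq> coord c ey p' \<and> coord c ex p \<noteq> coord c ex p'" if "p \<in> Q0" "p' \<in> Q0" "p \<noteq> p'" for p p'
    using generic[OF that] by simp
qed (use orthonormal r m v u in \<open>auto simp: inner_commute coord_def\<close>)

text \<open>The index is shifted so that \<open>\<tau>\<close> is the angle of a vertex nearest to
  the axis \<open>ey\<close>. The values \<open>0\<close> and \<open>\<delta> / 2\<close> up to sign
  would give two vertices with equal \<open>Y\<close>. A negative angle is made positive by
  reflecting \<open>ex\<close>, which exchanges \<open>v1\<close> and \<open>v2\<close>.\<close>

lemma half_exists:
  "(\<exists>t. half ey ex ez c r t m Q0 v1 v2) \<or> (\<exists>t. half ey (- ex) ez c r t m Q0 v2 v1)"
proof -
  define \<psi> where "\<psi> = pi / 2 - \<theta>"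
  define \<delta> where "\<delta> = 2 * pi / m"
  have \<delta>: "0 < \<delta>" "\<delta> \<le> pi / 2" using m by (auto simp: \<delta>_def field_simps)
  obtain n :: int where n: "\<bar>\<psi> - of_int n * \<delta>\<bar> \<le> \<delta> / 2" using round_angle[OF \<delta>(1)] by blast
  define \<tau> where "\<tau> = \<psi> - of_int n * \<delta>"
  define pt where "pt = (\<lambda>k::int. circle_pt c ey ex r (\<tau> + of_int k * \<delta>))"
  have "Q0 = range (\<lambda>k::int. circle_pt c ey ex r (\<psi> + of_int k * \<delta>))"
    unfolding Q0_swap \<psi>_def \<delta>_def by (simp add: mult.commute)
  also have "\<dots> = range (\<lambda>k. pt (k + n))"
    using range_plus_int[of "\<lambda>k. circle_pt c ey ex r (\<psi> + of_int k * \<delta>)" "- n"]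
      range_plus_int[of pt n] by (simp add: pt_def \<tau>_def algebra_simps)
  also have "\<dots> = range pt" by (rule range_plus_int)
  finally have Q: "Q0 = range pt" .
  interpret sw: frame ey ex ez c
    by unfold_locales (use orthonormal in \<open>auto simp: inner_commute\<close>)
  have coords: "Y (pt k) = r * cos (\<tau> + of_int k * \<delta>)" "X (pt k) = r * sin (\<tau> + of_int k * \<delta>)" for k
    by (simp_all add: pt_def)
  have inj: "sin (\<tau> + of_int k * \<delta>) = sin (\<tau> + of_int l * \<delta>)"
    if "cos (\<tau> + of_int k * \<delta>) = cos (\<tau> + of_int l * \<delta>)" for k l
  proof -
    have "Y (pt k) = Y (pt l)" using that by (simp add: coords)
    then have "pt k = pt l" using generic[of "pt k" "pt l"] Q by blast
    then have "X (pt k) = X (pt l)" by simp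
    then show ?thesis using r by (simp add: coords)
  qed
  have "\<tau> \<noteq> 0"
  proof
    assume "\<tau> = 0"
    then have "sin \<delta> = sin (- \<delta>)" using inj[of 1 "-1"] by simp
    moreover have "0 < sin \<delta>" using \<delta> pi_gt_zero by (intro sin_gt_zero) linarith+
    ultimately show False by simp
  qed
  have s2: "0 < sin (\<delta> / 2)" using \<delta> pi_gt_zero by (intro sin_gt_zero) linarith+
  have "\<tau> \<noteq> \<delta> / 2"
  proof
    assume t: "\<tau> = \<delta> / 2"
    have "sin (\<tau> + of_int 0 * \<delta>) = sin (\<tau> + of_int (-1) * \<delta>)"
      by (rule inj) (simp add: t)
    then show False using s2 by (simp add: t)
  qed
  moreover have "\<tau> \<noteq> - (\<delta> / 2)"
  proof
    assume t: "\<tau> = - (\<delta> / 2)"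
    have "sin (\<tau> + of_int 0 * \<delta>) = sin (\<tau> + of_int 1 * \<delta>)"
      by (rule inj) (simp add: t)
    then show False using s2 by (simp add: t)
  qed
  ultimately have \<tau>: "\<bar>\<tau>\<bar> < \<delta> / 2" using n unfolding \<tau>_def by linarith
  show ?thesis
  proof (cases "0 < \<tau>")
    case True
    have "half ey ex ez c r \<tau> m Q0 v1 v2"
    proof
      show "Q0 = range (\<lambda>k::int. circle_pt c ey ex r (\<tau> + 2 * pi * of_int k / m))"
        unfolding Q pt_def \<delta>_def by (simp add: mult.commute)
    qed (use True \<tau> r m v in \<open>auto simp: \<delta>_def\<close>)
    then show ?thesis by blast
  next
    case False
    have "half ey (- ex) ez c r (- \<tau>) m Q0 v2 v1"
    proof
      have e: "pt k = circle_pt c ey (- ex) r (- \<tau> + 2 * pi * of_int (- k) / m)" for k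
        unfolding pt_def circle_pt_minus \<delta>_def by (simp add: algebra_simps)
      show "Q0 = range (\<lambda>k::int. circle_pt c ey (- ex) r (- \<tau> + 2 * pi * of_int k / m))"
        unfolding Q e[abs_def] by (rule range_minus_int)
    qed (use False \<open>\<tau> \<noteq> 0\<close> \<tau> r m v orthonormal in \<open>auto simp: \<delta>_def coord_def inner_commute\<close>)
    then show ?thesis by blast
  qed
qed

lemma finite_Q0 [simp]: "finite Q0" and card_Q0: "card Q0 = m"
proof -
  have "finite Q0 \<and> card Q0 = m"
    using half_exists half.finite_Q0 half.card_Q0 by blast
  then show "finite Q0" "card Q0 = m" by auto
qed

text \<open>Stated without the locale \<open>half\<close>, so that it covers both orientations from
  \<open>half_exists\<close> and, through \<open>swap\<close>, also the half below.\<close>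

lemma half_dissection:
  "\<exists>K. finite K \<and> card K = 2 * m - 3 \<and>
     (\<forall>T\<in>K. \<not> affine_dependent T \<and> card T = 4 \<and> T \<subseteq> Q0 \<union> {v1, v2} \<and> T \<inter> {v1, v2} \<noteq> {}) \<and>
     (\<forall>T\<in>K. \<forall>T'\<in>K. T \<noteq> T' \<longrightarrow> strict_hull T \<inter> strict_hull T' = {}) \<and>
     convex hull (Q0 \<union> {v1, v2}) \<subseteq> (\<Union>T\<in>K. convex hull T)"
  using half_exists
proof (elim disjE exE)
  fix t assume h: "half ey ex ez c r t m Q0 v1 v2"
  show ?thesis
    using half.half_tets_card[OF h] half.half_tets_simplex[OF h] half.half_tets_disjoint[OF h]
      half.half_tets_cover[OF h] by (intro exI[of _ "half.half_tets ey ex c r t m v1 v2"] conjI ballI impI) auto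
next
  fix t assume h: "half ey (- ex) ez c r t m Q0 v2 v1"
  show ?thesis
    using half.half_tets_card[OF h] half.half_tets_simplex[OF h] half.half_tets_disjoint[OF h]
      half.half_tets_cover[OF h] 
    by (intro exI[of _ "half.half_tets ey (- ex) c r t m v2 v1"] conjI ballI impI) (auto simp: insert_commute)
qed

lemma Q0_coords: "p \<in> Q0 \<Longrightarrow> Z p = 0 \<and> (X p)\<^sup>2 + (Y p)\<^sup>2 = r\<^sup>2"
  unfolding Q0 by (auto simp: power_mult_distrib simp flip: distrib_left)

lemma Z_hull: "x \<in> convex hull Q0 \<Longrightarrow> Z x = 0"
  by (rule affine_fun_hull_eq[OF affine_fun_coord]) (use Q0_coords in auto)

lemma hull_norm: "x \<in> convex hull Q0 \<Longrightarrow> (X x)\<^sup>2 + (Y x)\<^sup>2 \<le> r\<^sup>2"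
proof -
  assume x: "x \<in> convex hull Q0"
  have "Q0 \<subseteq> cball c r"
  proof
    fix p assume "p \<in> Q0"
    then have "(norm (p - c))\<^sup>2 = r\<^sup>2" using Q0_coords fr.norm_coords by simp
    then show "p \<in> cball c r" using r by (simp add: dist_norm norm_minus_commute power2_eq_iff_nonneg)
  qed
  then have "x \<in> cball c r" using x hull_minimal[of Q0 "cball c r" convex] by auto
  then have "(norm (x - c))\<^sup>2 \<le> r\<^sup>2" by (simp add: dist_norm norm_minus_commute power_mono)
  then show ?thesis using fr.norm_coords Z_hull[OF x] by simp
qed

lemma segment_norm:
  "(X ((1 - s) *\<^sub>R x + s *\<^sub>R y))\<^sup>2 + (Y ((1 - s) *\<^sub>R x + s *\<^sub>R y))\<^sup>2 =
    (1 - s) * ((X x)\<^sup>2 + (Y x)\<^sup>2) + s * ((X y)\<^sup>2 + (Y y)\<^sup>2) - s * (1 - s) * ((X x - X y)\<^sup>2 + (Y x - Y y)\<^sup>2)"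
  unfolding affine_fun_segment[OF affine_fun_coord] by (simp add: power2_eq_square algebra_simps)

lemma open_segment_norm:
  assumes "x \<in> convex hull Q0" "y \<in> convex hull Q0" "x \<noteq> y" "0 < s" "s < 1"
  shows "(X ((1 - s) *\<^sub>R x + s *\<^sub>R y))\<^sup>2 + (Y ((1 - s) *\<^sub>R x + s *\<^sub>R y))\<^sup>2 < r\<^sup>2"
proof -
  have "X x \<noteq> X y \<or> Y x \<noteq> Y y" using fr.coords_eqI[of x y] Z_hull assms by auto
  then have "0 < (X x - X y)\<^sup>2 + (Y x - Y y)\<^sup>2" by (simp add: sum_power2_gt_zero_iff)
  then have "0 < s * (1 - s) * ((X x - X y)\<^sup>2 + (Y x - Y y)\<^sup>2)" using assms by simp
  moreover have "(1 - s) * ((X x)\<^sup>2 + (Y x)\<^sup>2) \<le> (1 - s) * r\<^sup>2" "s * ((X y)\<^sup>2 + (Y y)\<^sup>2) \<le> s * r\<^sup>2"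
    using hull_norm assms by (auto intro!: mult_left_mono)
  moreover have "(1 - s) * r\<^sup>2 + s * r\<^sup>2 = r\<^sup>2" by (simp add: algebra_simps)
  ultimately show ?thesis unfolding segment_norm by linarith
qed

text \<open>A relative interior point lies strictly between a vertex and a further point of the
  polygon, where strict convexity of the disc applies.\<close>

lemma hull_norm_less:
  assumes "x \<in> rel_interior (convex hull Q0)"
  shows "(X x)\<^sup>2 + (Y x)\<^sup>2 < r\<^sup>2"
proof -
  have "1 < card Q0" using card_Q0 m by simp
  then obtain p p' where "p \<in> Q0" "p' \<in> Q0" "p \<noteq> p'" by (metis card_le_Suc0_iff_eq finite_Q0 not_less One_nat_def)
  then obtain p where p: "p \<in> Q0" "p \<noteq> x" by metis
  have ne: "convex hull Q0 \<noteq> {}" using p by auto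
  have ph: "p \<in> convex hull Q0" using p(1) by (rule hull_inc)
  obtain e where e: "e > 1" "(1 - e) *\<^sub>R p + e *\<^sub>R x \<in> convex hull Q0"
    using convex_rel_interior_iff[OF convex_convex_hull ne] assms ph by blast
  define y where "y = (1 - e) *\<^sub>R p + e *\<^sub>R x"
  have x: "x = (1 - 1 / e) *\<^sub>R p + (1 / e) *\<^sub>R y"
    using e by (simp add: y_def algebra_simps)
  have "p \<noteq> y"
  proof
    assume "p = y"
    moreover have "y - p = e *\<^sub>R (x - p)" by (simp add: y_def algebra_simps)
    ultimately show False using e p by auto
  qed
  then have "(X ((1 - 1 / e) *\<^sub>R p + (1 / e) *\<^sub>R y))\<^sup>2 + (Y ((1 - 1 / e) *\<^sub>R p + (1 / e) *\<^sub>R y))\<^sup>2 < r\<^sup>2"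
    using e ph by (intro open_segment_norm) (auto simp: y_def)
  then show ?thesis using x by simp
qed

text \<open>As both edges are parallel to the plane, all four segments from a \<open>v\<close> to a
  \<open>u\<close> cross it at this same parameter.\<close>

definition t0 :: real where "t0 = Z v1 / (Z v1 - Z u1)"

lemma t0: "0 < t0" "t0 < 1"
  using v u by (auto simp: t0_def)

definition xp :: "space \<Rightarrow> space \<Rightarrow> space" where "xp v u = (1 - t0) *\<^sub>R v + t0 *\<^sub>R u"

lemma Z_xp: "v \<in> {v1, v2} \<Longrightarrow> u \<in> {u1, u2} \<Longrightarrow> Z (xp v u) = 0"
proof -
  assume a: "v \<in> {v1, v2}" "u \<in> {u1, u2}"
  have "t0 * (Z v1 - Z u1) = Z v1" using v u by (simp add: t0_def)
  moreover have "Z v = Z v1" "Z u = Z u1" using a u(3) v(3) by auto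
  ultimately show ?thesis unfolding xp_def affine_fun_segment[OF affine_fun_coord] by (simp add: algebra_simps)
qed

lemma xp_rel_interior:
  assumes a: "v \<in> {v1, v2}" "u \<in> {u1, u2}"
  shows "xp v u \<in> rel_interior (convex hull Q0)"
proof -
  obtain x where x: "x \<in> closed_segment v u" "x \<in> rel_interior (convex hull Q0)"
    using cross[OF a] by blast
  obtain s where s: "x = (1 - s) *\<^sub>R v + s *\<^sub>R u" using x(1) by (auto simp: in_segment)
  have Z: "Z v = Z v1" "Z u = Z u1" using a u(3) v(3) by auto
  have "Z x = 0" using x(2) rel_interior_subset Z_hull by blast
  then have "(1 - s) * Z v1 + s * Z u1 = 0" unfolding s affine_fun_segment[OF affine_fun_coord] Z .
  then have "s * (Z v1 - Z u1) = Z v1" by (simp add: algebra_simps)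
  then have "s = t0" using v u by (simp add: t0_def field_simps)
  then show ?thesis using x(2) s by (simp add: xp_def)
qed

lemma xp_hull: "v \<in> {v1, v2} \<Longrightarrow> u \<in> {u1, u2} \<Longrightarrow> xp v u \<in> convex hull Q0"
  using xp_rel_interior rel_interior_subset by blast

section \<open>Vertices of the polytope\<close>

definition V :: "space set" where "V = Q0 \<union> {v1, v2, u1, u2}"

definition P :: "space set" where "P = convex hull V"

lemma finite_V [simp]: "finite V" by (simp add: V_def)

lemma distinct_apices: "v1 \<noteq> v2" "u1 \<noteq> u2" "v1 \<noteq> u1" "v1 \<noteq> u2" "v2 \<noteq> u1" "v2 \<noteq> u2"
    "v1 \<notin> Q0" "v2 \<notin> Q0" "u1 \<notin> Q0" "u2 \<notin> Q0"
  using v u Q0_coords by fastforce+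

lemma card_V: "card V = m + 4"
proof -
  have "card V = card Q0 + card {v1, v2, u1, u2}"
    unfolding V_def using distinct_apices by (intro card_Un_disjoint) auto
  then show ?thesis using card_Q0 distinct_apices by simp
qed

lemma Q0_range: "p \<in> Q0 \<Longrightarrow> \<bar>X p\<bar> \<le> r"
proof -
  assume "p \<in> Q0"
  then have "(X p)\<^sup>2 \<le> r\<^sup>2" using Q0_coords[of p] zero_le_power2[of "Y p"] by linarith
  then show ?thesis using r by (simp add: abs_le_square_iff[symmetric])
qed

lemma apex_not_in_hull:
  assumes "(w = v1 \<and> w' = v2 \<and> s = - 1) \<or> (w = v2 \<and> w' = v1 \<and> s = (1::real))"
  shows "w \<notin> convex hull (V - {w})"
proof -
  \<comment> \<open>So steep a tilt that \<open>w\<close> beats the polygon and the apices below,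
    whatever \<open>X\<close> contributes there; against \<open>w'\<close> at equal height
    \<open>s * X\<close> decides.\<close>
  define \<kappa> where "\<kappa> = (\<bar>X w\<bar> + r + \<bar>X u1\<bar> + 1) / Z v1"
  have \<kappa>: "0 < \<kappa>" "\<kappa> * Z v1 = \<bar>X w\<bar> + r + \<bar>X u1\<bar> + 1" using v r by (auto simp: \<kappa>_def)
  have s: "s * X w' < s * X w" "\<bar>s\<bar> = 1" "Z w = Z v1" "Z w' = Z v1" using assms v by auto
  have b: "\<bar>s * x\<bar> = \<bar>x\<bar>" for x using s(2) by (simp add: abs_mult)
  show ?thesis
  proof (rule not_in_hull[of "\<lambda>x. \<kappa> * Z x + s * X x"])
    show "affine_fun (\<lambda>x. \<kappa> * Z x + s * X x)" by (intro affine_fun_linear_comb) simp_all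
    fix x assume "x \<in> V - {w}"
    then have "x \<in> Q0 \<or> x = w' \<or> x = u1 \<or> x = u2" using assms unfolding V_def by blast
    then consider "x \<in> Q0" | "x = w'" | "x = u1 \<or> x = u2" by blast
    then show "\<kappa> * Z x + s * X x < \<kappa> * Z w + s * X w"
    proof cases
      case 1
      have "\<kappa> * Z x = 0" "\<kappa> * Z w = \<bar>X w\<bar> + r + \<bar>X u1\<bar> + 1" using Q0_coords[OF 1] \<kappa>(2) s(3) by simp_all
      then show ?thesis using Q0_range[OF 1] b[of "X x"] b[of "X w"] by linarith
    next
      case 2
      then show ?thesis using s by simp
    next
      case 3
      then have "Z x < 0" "X x = X u1" using u by auto
      then have "\<kappa> * Z x < 0" using \<kappa>(1) by (simp add: mult_pos_neg)
      moreover have "\<kappa> * Z w = \<bar>X w\<bar> + r + \<bar>X u1\<bar> + 1" using \<kappa>(2) s(3) by simp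
      ultimately show ?thesis using b[of "X u1"] b[of "X w"] r unfolding \<open>X x = X u1\<close> by linarith
    qed
  qed
qed

lemma inner_le: "(X p)\<^sup>2 + (Y p)\<^sup>2 = r\<^sup>2 \<Longrightarrow> 2 * (X p * X x + Y p * Y x) = r\<^sup>2 + ((X x)\<^sup>2 + (Y x)\<^sup>2) - ((X p - X x)\<^sup>2 + (Y p - Y x)\<^sup>2)"
  by (simp add: power2_eq_square algebra_simps)

text \<open>The functional \<open>g\<close> exposes \<open>p\<close> in the polygon. As \<open>g\<close> is below \<open>g p\<close> on the points \<open>xp v u\<close>,
  it can be tilted so as to be below \<open>g p\<close> on all four apices.\<close>

lemma base_not_in_hull:
  assumes p: "p \<in> Q0"
  shows "p \<notin> convex hull (V - {p})"
proof -
  define g where "g = (\<lambda>x. X p * X x + Y p * Y x)"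
  have ag: "affine_fun g" unfolding g_def by (intro affine_fun_linear_comb) simp_all
  have gp: "g p = r\<^sup>2" using Q0_coords[OF p] by (simp add: g_def power2_eq_square)
  have gQ: "g x < r\<^sup>2" if "x \<in> Q0" "x \<noteq> p" for x
  proof -
    have "X p \<noteq> X x" using generic[OF p that(1)] that(2) by auto
    then have "0 < (X p - X x)\<^sup>2 + (Y p - Y x)\<^sup>2" by (simp add: sum_power2_gt_zero_iff)
    then show ?thesis using inner_le[of p x] Q0_coords[OF p] Q0_coords[OF that(1)] by (simp add: g_def)
  qed
  have gx: "g (xp v u) < r\<^sup>2" if "v \<in> {v1, v2}" "u \<in> {u1, u2}" for v u
  proof -
    have "0 \<le> (X p - X (xp v u))\<^sup>2 + (Y p - Y (xp v u))\<^sup>2" by simp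
    moreover have "2 * g (xp v u) = r\<^sup>2 + ((X (xp v u))\<^sup>2 + (Y (xp v u))\<^sup>2) - ((X p - X (xp v u))\<^sup>2 + (Y p - Y (xp v u))\<^sup>2)"
      unfolding g_def using inner_le[of p "xp v u"] Q0_coords[OF p] by blast
    ultimately show ?thesis
      using hull_norm_less[OF xp_rel_interior[OF that]] by linarith
  qed
  define h k where "h = Z v1" and "k = - Z u1"
  have hk: "0 < h" "0 < k" using v u by (auto simp: h_def k_def)
  \<comment> \<open>The tilt \<open>\<kappa>\<close> must stay below \<open>A v\<close> for the
    apices above and exceed \<open>B u\<close> for those below. That every \<open>B u\<close> is
    less than every \<open>A v\<close> is the inequality for \<open>g\<close> at
    \<open>xp v u\<close>.\<close>
  define A where "A = (\<lambda>v. (r\<^sup>2 - g v) / h)"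
  define B where "B = (\<lambda>u. - (r\<^sup>2 - g u) / k)"
  have BA: "B u < A v" if "v \<in> {v1, v2}" "u \<in> {u1, u2}" for v u
  proof -
    have t: "t0 * (h + k) = h" "(1 - t0) * (h + k) = k"
      using hk by (auto simp: t0_def h_def k_def field_simps)
    have "(1 - t0) * g v + t0 * g u < r\<^sup>2"
      using gx[OF that] affine_fun_segment[OF ag, of t0 v u] by (simp add: xp_def)
    then have "((1 - t0) * g v + t0 * g u) * (h + k) < r\<^sup>2 * (h + k)"
      using hk by (intro mult_strict_right_mono) auto
    then have "((1 - t0) * (h + k)) * g v + (t0 * (h + k)) * g u < r\<^sup>2 * (h + k)"
      by (simp add: algebra_simps)
    then have "k * g v + h * g u < r\<^sup>2 * (h + k)" unfolding t .
    then show ?thesis using hk by (simp add: A_def B_def divide_simps) (simp add: algebra_simps)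
  qed
  define \<kappa> where "\<kappa> = (max (B u1) (B u2) + min (A v1) (A v2)) / 2"
  have lt: "max (B u1) (B u2) < min (A v1) (A v2)"
    using BA[of v1 u1] BA[of v1 u2] BA[of v2 u1] BA[of v2 u2] by simp
  have \<kappa>A: "\<kappa> < A v" if "v \<in> {v1, v2}" for v
    using lt that unfolding \<kappa>_def by (auto simp: min_def max_def split: if_splits)
  have \<kappa>B: "B u < \<kappa>" if "u \<in> {u1, u2}" for u
    using lt that unfolding \<kappa>_def by (auto simp: min_def max_def split: if_splits)
  show ?thesis
  proof (rule not_in_hull[of "\<lambda>x. 1 * g x + \<kappa> * Z x"])
    show "affine_fun (\<lambda>x. 1 * g x + \<kappa> * Z x)" using ag by (intro affine_fun_linear_comb) simp_all
    have fp: "1 * g p + \<kappa> * Z p = r\<^sup>2" using gp Q0_coords[OF p] by simp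
    fix x assume "x \<in> V - {p}"
    then have "(x \<in> Q0 \<and> x \<noteq> p) \<or> x \<in> {v1, v2} \<or> x \<in> {u1, u2}" unfolding V_def by blast
    then consider "x \<in> Q0" "x \<noteq> p" | "x \<in> {v1, v2}" | "x \<in> {u1, u2}" by blast
    then show "1 * g x + \<kappa> * Z x < 1 * g p + \<kappa> * Z p"
      unfolding fp
    proof cases
      case 1
      then show "1 * g x + \<kappa> * Z x < r\<^sup>2" using gQ Q0_coords by simp
    next
      case 2
      then have "Z x = h" using v by (auto simp: h_def)
      then show "1 * g x + \<kappa> * Z x < r\<^sup>2"
        using \<kappa>A[OF 2] hk by (simp add: A_def field_simps)
    next
      case 3
      then have "Z x = - k" using u by (auto simp: k_def)
      then show "1 * g x + \<kappa> * Z x < r\<^sup>2"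
        using \<kappa>B[OF 3] hk by (simp add: B_def field_simps)
    qed
  qed
qed

lemma V_swap: "Pm.V Q0 u1 u2 v1 v2 = V"
  unfolding Pm.V_def[OF swap] V_def by auto

lemma vertices_P: "vertices P = V"
proof -
  have "a \<notin> convex hull (V - {a})" if aV: "a \<in> V" for a
  proof -
    consider "a \<in> Q0" | "a = v1 \<or> a = v2" | "a = u1 \<or> a = u2" using aV unfolding V_def by blast
    then show ?thesis
    proof cases
      case 3
      then show ?thesis using Pm.apex_not_in_hull[OF swap, of a] V_swap by auto
    qed (use base_not_in_hull apex_not_in_hull[of a] in auto)
  qed
  then have "x extreme_point_of (convex hull V) \<longleftrightarrow> x \<in> V" for x
    by (intro extreme_point_of_convex_hull_convex_independent) (auto simp: finite_imp_compact)
  then show ?thesis by (auto simp: vertices_def P_def)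
qed


text \<open>Twice the signed area of the triangle \<open>p p' x\<close> projected to the plane of
  the polygon.\<close>

definition orient :: "space \<Rightarrow> space \<Rightarrow> space \<Rightarrow> real" where
  "orient p p' x = (X p' - X p) * (Y x - Y p) - (Y p' - Y p) * (X x - X p)"

lemma affine_orient [simp]: "affine_fun (orient p p')"
  unfolding orient_def[abs_def] by (intro affine_fun_diff affine_fun_scale) simp_all

lemma orient_simps [simp]: "orient p p' p = 0" "orient p p' p' = 0"
  by (simp_all add: orient_def)

text \<open>The formula for the norm locates \<open>x\<close> on the line: it is on the circle only
  for \<open>\<tau>\<close> equal to 0 or 1, and in the disc only for \<open>\<tau>\<close> between
  them.\<close>

lemma on_line:
  assumes p: "p \<in> Q0" "p' \<in> Q0" "p \<noteq> p'" and x: "Z x = 0" "orient p p' x = 0"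
  obtains \<tau> k where "x = (1 - \<tau>) *\<^sub>R p + \<tau> *\<^sub>R p'" "0 < k" "(X x)\<^sup>2 + (Y x)\<^sup>2 = r\<^sup>2 - \<tau> * (1 - \<tau>) * k"
proof -
  have ne: "X p' - X p \<noteq> 0" using generic[OF p] by auto
  define \<tau> where "\<tau> = (X x - X p) / (X p' - X p)"
  have "X x = X p + \<tau> * (X p' - X p)" using ne by (simp add: \<tau>_def)
  then have Xx: "X x = (1 - \<tau>) * X p + \<tau> * X p'" by (simp add: algebra_simps)
  have "Y x = Y p + \<tau> * (Y p' - Y p)" using ne x(2) by (simp add: \<tau>_def orient_def field_simps)
  then have Yx: "Y x = (1 - \<tau>) * Y p + \<tau> * Y p'" by (simp add: algebra_simps)
  have xe: "x = (1 - \<tau>) *\<^sub>R p + \<tau> *\<^sub>R p'"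
    by (rule fr.coords_eqI; unfold affine_fun_segment[OF affine_fun_coord])
      (simp_all add: Xx Yx Q0_coords p x(1))
  have n: "(X p)\<^sup>2 + (Y p)\<^sup>2 = r\<^sup>2" "(X p')\<^sup>2 + (Y p')\<^sup>2 = r\<^sup>2" using Q0_coords p by auto
  define k where "k = (X p - X p')\<^sup>2 + (Y p - Y p')\<^sup>2"
  have "(X x)\<^sup>2 + (Y x)\<^sup>2 = (1 - \<tau>) * r\<^sup>2 + \<tau> * r\<^sup>2 - \<tau> * (1 - \<tau>) * k"
    using segment_norm[of \<tau> p p'] unfolding xe[symmetric] n k_def .
  also have "\<dots> = r\<^sup>2 - \<tau> * (1 - \<tau>) * k" by (simp add: algebra_simps)
  finally have "(X x)\<^sup>2 + (Y x)\<^sup>2 = r\<^sup>2 - \<tau> * (1 - \<tau>) * k" .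
  moreover have "0 < k" unfolding k_def using ne by (simp add: sum_power2_gt_zero_iff)
  ultimately show ?thesis using that xe by blast
qed

lemma orient_nonzero:
  assumes "p \<in> Q0" "q \<in> Q0" "s \<in> Q0" "p \<noteq> q" "q \<noteq> s" "p \<noteq> s"
  shows "orient p q s \<noteq> 0"
proof
  have Zs: "Z s = 0" "(X s)\<^sup>2 + (Y s)\<^sup>2 = r\<^sup>2" using Q0_coords[OF assms(3)] by auto
  assume "orient p q s = 0"
  then obtain \<tau> k where t: "s = (1 - \<tau>) *\<^sub>R p + \<tau> *\<^sub>R q" "0 < k" "(X s)\<^sup>2 + (Y s)\<^sup>2 = r\<^sup>2 - \<tau> * (1 - \<tau>) * k"
    using on_line[OF assms(1,2,4) Zs(1)] by blast
  then have "\<tau> = 0 \<or> \<tau> = 1" using Zs(2) by simp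
  then show False using t(1) assms by auto
qed

section \<open>Proper faces and simpliciality\<close>

lemma affine_fun_expand:
  assumes "affine_fun f"
  obtains f0 \<alpha> \<beta> \<gamma> where "\<And>x. f x = f0 + \<alpha> * X x + \<beta> * Y x + \<gamma> * Z x"
proof -
  obtain a b where f: "\<And>p. f p = a \<bullet> p + b"
    using assms unfolding affine_fun_def by blast
  have "f x = (a \<bullet> c + b) + (a \<bullet> ex) * X x + (a \<bullet> ey) * Y x + (a \<bullet> ez) * Z x" for x
  proof -
    have "f x = (a \<bullet> c + b) + a \<bullet> (x - c)" by (simp add: f inner_diff_right)
    also have "a \<bullet> (x - c) = a \<bullet> (((x - c) \<bullet> ex) *\<^sub>R ex + ((x - c) \<bullet> ey) *\<^sub>R ey + ((x - c) \<bullet> ez) *\<^sub>R ez)"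
      using orthonormal_expand[OF orthonormal, of "x - c"] by simp
    finally show ?thesis by (simp add: inner_add_right coord_def mult.commute)
  qed
  then show ?thesis using that by blast
qed

text \<open>Vanishing at a vertex of the polygon makes \<open>f\<close> a multiple of
  \<open>Z\<close>. Being nonpositive both above and below the plane, it is zero.\<close>

lemma proper_support:
  assumes f: "affine_fun f" and le: "\<And>x. x \<in> V \<Longrightarrow> f x \<le> 0" and ne: "\<exists>x\<in>V. f x \<noteq> 0"
    and \<alpha>\<beta>: "\<And>x. f x = f0 + \<gamma> * Z x" and p: "p \<in> Q0" "f p = 0"
  shows False
proof -
  have f0: "f0 = 0" using \<alpha>\<beta>[of p] p Q0_coords by simp
  have "\<gamma> * Z v1 \<le> 0" "\<gamma> * Z u1 \<le> 0" using le[of v1] le[of u1] f0 \<alpha>\<beta> by (simp_all add: V_def)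
  then have "\<gamma> = 0" using v(4) u(4) by (auto simp: mult_le_0_iff)
  then show False using ne f0 \<alpha>\<beta> by simp
qed

text \<open>Three polygon vertices kill both horizontal coefficients of \<open>f\<close>. Apices
  from both sides put some \<open>xp v u\<close>, hence the whole polygon, into the face. Both
  \<open>v1\<close> and \<open>v2\<close> kill the coefficient of \<open>X\<close>, and two polygon
  vertices then that of \<open>Y\<close>, by \<open>generic\<close>.\<close>

lemma face_subset_no_opposite:
  assumes F: "F face_of P" "F \<noteq> P" and f: "affine_fun f" "\<And>x. x \<in> V \<Longrightarrow> f x \<le> 0" "F = P \<inter> {x. f x = 0}"
  shows "card (F \<inter> Q0) \<le> 2" "\<not> (v \<in> {v1, v2} \<and> v \<in> F \<and> u \<in> {u1, u2} \<and> u \<in> F)"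
    "card (F \<inter> Q0) = 2 \<Longrightarrow> \<not> (v1 \<in> F \<and> v2 \<in> F)"
proof -
  obtain f0 \<alpha> \<beta> \<gamma> where ff: "\<And>x. f x = f0 + \<alpha> * X x + \<beta> * Y x + \<gamma> * Z x"
    using affine_fun_expand[OF f(1)] by blast
  have ne: "\<exists>x\<in>V. f x \<noteq> 0"
  proof (rule ccontr)
    assume "\<not> ?thesis"
    then have "f x = 0" if "x \<in> P" for x
      using affine_fun_hull_eq[OF f(1), of V 0 x] that by (auto simp: P_def)
    then show False using f(3) F(2) by auto
  qed
  have F0: "f x = 0" if "x \<in> F" for x using that f(3) by blast
  have three: False if "p \<in> Q0 \<inter> F" "q \<in> Q0 \<inter> F" "s \<in> Q0 \<inter> F" "p \<noteq> q" "q \<noteq> s" "p \<noteq> s" for p q s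
  proof -
    have z: "f p = 0" "f q = 0" "f s = 0" using F0 that by auto
    have Z: "Z p = 0" "Z q = 0" "Z s = 0" using Q0_coords that by auto
    define a1 a2 b1 b2 where "a1 = X q - X p" and "a2 = Y q - Y p" and "b1 = X s - X p" and "b2 = Y s - Y p"
    have e: "\<alpha> * a1 + \<beta> * a2 = 0" "\<alpha> * b1 + \<beta> * b2 = 0"
      using z Z unfolding ff a1_def a2_def b1_def b2_def by (auto simp: algebra_simps)
    have d: "a1 * b2 - a2 * b1 \<noteq> 0"
      using orient_nonzero[of p q s] that unfolding orient_def a1_def a2_def b1_def b2_def by auto
    have "\<alpha> * (a1 * b2 - a2 * b1) = (\<alpha> * a1 + \<beta> * a2) * b2 - (\<alpha> * b1 + \<beta> * b2) * a2"
      "\<beta> * (a1 * b2 - a2 * b1) = (\<alpha> * b1 + \<beta> * b2) * a1 - (\<alpha> * a1 + \<beta> * a2) * b1"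
      by (simp_all add: algebra_simps)
    then have "\<alpha> = 0" "\<beta> = 0" using e d by auto
    then show False using proper_support[OF f(1,2) ne, of f0 \<gamma> p] ff z that by auto
  qed
  show c2: "card (F \<inter> Q0) \<le> 2"
  proof (rule ccontr)
    assume "\<not> ?thesis"
    then have "3 \<le> card (F \<inter> Q0)" by simp
    then obtain T where "T \<subseteq> F \<inter> Q0" "card T = 3" by (meson obtain_subset_with_card_n)
    then obtain p q s where "p \<in> Q0 \<inter> F" "q \<in> Q0 \<inter> F" "s \<in> Q0 \<inter> F" "p \<noteq> q" "q \<noteq> s" "p \<noteq> s"
      by (auto simp: card_3_iff)
    then show False using three by blast
  qed
  show "\<not> (v \<in> {v1, v2} \<and> v \<in> F \<and> u \<in> {u1, u2} \<and> u \<in> F)"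
  proof
    assume a: "v \<in> {v1, v2} \<and> v \<in> F \<and> u \<in> {u1, u2} \<and> u \<in> F"
    have "convex F" using F(1) face_of_imp_convex by blast
    then have "xp v u \<in> F" unfolding xp_def using a t0 convexD_alt[of F v u t0] by auto
    moreover have "xp v u \<in> rel_interior (convex hull Q0)" using xp_rel_interior a by blast
    moreover have "convex hull Q0 \<subseteq> P" unfolding P_def V_def by (rule hull_mono) auto
    ultimately have "convex hull Q0 \<subseteq> F" using subset_of_face_of[OF F(1)] by blast
    then have "Q0 \<subseteq> F \<inter> Q0" using hull_subset by fastforce
    then have "card Q0 \<le> card (F \<inter> Q0)" by (intro card_mono) auto
    then show False using c2 card_Q0 m by simp
  qed
  show "\<not> (v1 \<in> F \<and> v2 \<in> F)" if two: "card (F \<inter> Q0) = 2"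
  proof
    assume a: "v1 \<in> F \<and> v2 \<in> F"
    obtain p q where pq: "F \<inter> Q0 = {p, q}" "p \<noteq> q" using two unfolding card_2_iff by blast
    have pq2: "p \<in> Q0" "q \<in> Q0" "f p = 0" "f q = 0" using pq F0 by auto
    have "\<alpha> * (X v2 - X v1) = f v2 - f v1" unfolding ff using v by (simp add: algebra_simps)
    then have \<alpha>: "\<alpha> = 0" using F0 a v by auto
    have "\<beta> * (Y q - Y p) = f q - f p" unfolding ff using \<alpha> Q0_coords pq2 by (simp add: algebra_simps)
    then have "\<beta> = 0" using pq2 generic[of p q] pq(2) by auto
    then show False using proper_support[OF f(1,2) ne, of f0 \<gamma> p] ff pq2 \<alpha> by auto
  qed
qed

lemma P_swap: "Pm.P Q0 u1 u2 v1 v2 = P"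
  unfolding Pm.P_def[OF swap] P_def V_swap by simp

lemma aff_dim_P: "aff_dim P = 3"
proof -
  obtain K where K: "card K = 2 * m - 3"
     "\<forall>T\<in>K. \<not> affine_dependent T \<and> card T = 4 \<and> T \<subseteq> Q0 \<union> {v1, v2} \<and> T \<inter> {v1, v2} \<noteq> {}"
    using half_dissection by blast
  then have "K \<noteq> {}" using m by auto
  then obtain T where T: "\<not> affine_dependent T" "card T = 4" "T \<subseteq> V" using K(2) by (auto simp: V_def)
  have "aff_dim T = 3" using T aff_dim_affine_independent[OF T(1)] by simp
  moreover have "aff_dim T \<le> aff_dim P"
    using T(3) hull_subset[of V convex] by (intro aff_dim_subset) (auto simp: P_def)
  moreover have "aff_dim P \<le> 3" using aff_dim_le_DIM[of P] by simp
  ultimately show ?thesis by simp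
qed

lemma polytope_P: "polytope P"
  unfolding polytope_def P_def using finite_V by blast

text \<open>A facet has apices on one side only, so \<open>face_subset_no_opposite\<close> and its
  swapped version leave it at most three vertices; dimension 2 makes them exactly three and
  independent.\<close>

lemma facet_simplex:
  assumes "F facet_of P"
  shows "2 simplex F"
proof -
  have F: "F face_of P" "F \<noteq> P" "aff_dim F = 2"
    using assms aff_dim_P by (auto simp: facet_of_def)
  have "F exposed_face_of P"
    using exposed_face_of_polyhedron[OF polytope_imp_polyhedron[OF polytope_P]] F(1) by blast
  then obtain a b where ab: "P \<subseteq> {x. a \<bullet> x \<le> b}" "F = P \<inter> {x. a \<bullet> x = b}"
    unfolding exposed_face_of_def by blast
  define f where "f = (\<lambda>x. a \<bullet> x - b)"
  have f: "affine_fun f" unfolding affine_fun_def f_def by (intro exI[of _ a] exI[of _ "- b"]) simp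
  have VP: "V \<subseteq> P" unfolding P_def by (rule hull_subset)
  have le: "f x \<le> 0" if "x \<in> V" for x using that VP ab(1) by (auto simp: f_def)
  have Feq: "F = P \<inter> {x. f x = 0}" using ab(2) by (auto simp: f_def)
  obtain W where W: "W \<subseteq> V" "F = convex hull W"
    using face_of_convex_hull_subset[of V F] F(1) finite_imp_compact[OF finite_V] unfolding P_def by blast
  have WF: "W \<subseteq> F" unfolding W(2) by (rule hull_subset)
  note 1 = face_subset_no_opposite[OF F(1,2) f le Feq]
  note 2 = Pm.face_subset_no_opposite[OF swap, unfolded P_swap V_swap, OF F(1,2) f le Feq]
  have fin: "finite W" using W(1) finite_V finite_subset by blast
  have "card W \<le> 3"
  proof -
    have gen: "card W \<le> 3" if ww: "W \<subseteq> Q0 \<union> {w, w'}" "card (F \<inter> Q0) \<le> 2" "card (F \<inter> Q0) = 2 \<Longrightarrow> \<not> (w \<in> F \<and> w' \<in> F)" for w w'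
    proof -
      have "card W \<le> card (W \<inter> Q0) + card (W \<inter> {w, w'})"
      proof -
        have "(W \<inter> Q0) \<union> (W \<inter> {w, w'}) = W" using ww(1) by blast
        then show ?thesis using card_Un_le[of "W \<inter> Q0" "W \<inter> {w, w'}"] by simp
      qed
      moreover have "card (W \<inter> Q0) \<le> card (F \<inter> Q0)" using WF by (intro card_mono) auto
      moreover have "card (W \<inter> {w, w'}) \<le> 2"
      proof -
        have "card (W \<inter> {w, w'}) \<le> card {w, w'}" by (intro card_mono) auto
        also have "\<dots> \<le> 2" by (simp add: card_insert_if)
        finally show ?thesis .
      qed
      moreover have "card (W \<inter> {w, w'}) \<le> 1" if "\<not> (w \<in> F \<and> w' \<in> F)"
      proof -
        have "W \<inter> {w, w'} \<subseteq> {w} \<or> W \<inter> {w, w'} \<subseteq> {w'}" using that WF by blast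
        then show ?thesis using card_mono[of "{w}" "W \<inter> {w, w'}"] card_mono[of "{w'}" "W \<inter> {w, w'}"] by auto
      qed
      ultimately show ?thesis using ww(2,3) by linarith
    qed
    show ?thesis
    proof (cases "W \<inter> {u1, u2} = {}")
      case True
      then show ?thesis using gen[of v1 v2] 1(1,3) W(1) unfolding V_def by blast
    next
      case False
      then have "W \<inter> {v1, v2} = {}" using 1(2) WF by blast
      then show ?thesis using gen[of u1 u2] 2(1,3) W(1) unfolding V_def by blast
    qed
  qed
  moreover have ad: "aff_dim W = 2" using F(3) by (simp add: W(2) aff_dim_convex_hull)
  moreover have "aff_dim W \<le> int (card W) - 1" using aff_dim_le_card[OF fin] .
  ultimately have c: "card W = 3" by linarith
  then have "\<not> affine_dependent W" using affine_independent_iff_card[of W] fin ad by simp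
  then show ?thesis unfolding simplex_def using c W(2) by (intro exI[of _ W]) simp
qed

lemma simplicial_P: "simplicial_3polytope P"
  unfolding simplicial_3polytope_def using polytope_P aff_dim_P facet_simplex by blast

section \<open>Gluing the two halves to a dissection\<close>

lemma xp_segment_hull:
  assumes "a \<in> closed_segment v1 v2" "b \<in> closed_segment u1 u2"
  shows "xp a b \<in> convex hull Q0"
proof -
  obtain \<rho> where \<rho>: "0 \<le> \<rho>" "\<rho> \<le> 1" "a = (1 - \<rho>) *\<^sub>R v1 + \<rho> *\<^sub>R v2" using assms(1) by (auto simp: in_segment)
  obtain \<sigma> where \<sigma>: "0 \<le> \<sigma>" "\<sigma> \<le> 1" "b = (1 - \<sigma>) *\<^sub>R u1 + \<sigma> *\<^sub>R u2" using assms(2) by (auto simp: in_segment)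
  have 1: "xp w b = (1 - \<sigma>) *\<^sub>R xp w u1 + \<sigma> *\<^sub>R xp w u2" for w
    unfolding xp_def \<sigma>(3) by (simp add: algebra_simps)
  have 2: "xp a b = (1 - \<rho>) *\<^sub>R xp v1 b + \<rho> *\<^sub>R xp v2 b"
    unfolding xp_def \<rho>(3) by (simp add: algebra_simps)
  have "xp w b \<in> convex hull Q0" if "w \<in> {v1, v2}" for w
    unfolding 1 using xp_hull that \<sigma> by (intro convexD_alt[OF convex_convex_hull]) auto
  then show ?thesis unfolding 2 using \<rho> by (intro convexD_alt[OF convex_convex_hull]) auto
qed

text \<open>\<open>z\<close> combines a point of the polygon, a point \<open>a\<close> of
  \<open>v1 v2\<close> and a point \<open>b\<close> of \<open>u1 u2\<close>. Portions of
  \<open>a\<close> and \<open>b\<close> in the ratio \<open>1 - t0\<close> to \<open>t0\<close>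
  merge into the point \<open>xp a b\<close> of the polygon; merging until one of them is used up
  leaves a point of one half.\<close>

lemma P_split: "P \<subseteq> convex hull (Q0 \<union> {v1, v2}) \<union> convex hull (Q0 \<union> {u1, u2})"
proof
  fix z assume z: "z \<in> P"
  let ?A = "convex hull (Q0 \<union> {v1, v2})" and ?B = "convex hull (Q0 \<union> {u1, u2})"
  have Qne: "Q0 \<noteq> {}" using card_Q0 m by auto
  have decomp: "\<exists>x\<in>convex hull A. \<exists>w\<in>closed_segment a b. \<exists>s. 0 \<le> s \<and> s \<le> 1 \<and> y = (1 - s) *\<^sub>R x + s *\<^sub>R w"
    if y: "y \<in> convex hull (A \<union> {a, b})" and A: "A \<noteq> {}" for y a b :: space and A
  proof -
    have "convex hull (A \<union> {a, b}) = convex hull (convex hull A \<union> closed_segment a b)"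
      unfolding segment_convex_hull using hull_Un_left hull_Un_right by metis
    then obtain k l x w where "0 \<le> k" "0 \<le> l" "k + l = 1" "x \<in> convex hull A" "w \<in> closed_segment a b" "y = k *\<^sub>R x + l *\<^sub>R w"
      using y A convex_hull_union_two[of "convex hull A" "closed_segment a b"] by auto
    moreover have "k = 1 - l" using \<open>k + l = 1\<close> by simp
    ultimately show ?thesis by (intro bexI[of _ x] bexI[of _ w] exI[of _ l]) auto
  qed
  have "V = (Q0 \<union> {v1, v2}) \<union> {u1, u2}" by (auto simp: V_def)
  then have "z \<in> convex hull ((Q0 \<union> {v1, v2}) \<union> {u1, u2})" using z by (simp add: P_def)
  then obtain x b s where s: "x \<in> ?A" "b \<in> closed_segment u1 u2" "0 \<le> s" "s \<le> 1" "z = (1 - s) *\<^sub>R x + s *\<^sub>R b"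
    using decomp[of z "Q0 \<union> {v1, v2}" u1 u2] by blast
  obtain y a s' where s': "y \<in> convex hull Q0" "a \<in> closed_segment v1 v2" "0 \<le> s'" "s' \<le> 1" "x = (1 - s') *\<^sub>R y + s' *\<^sub>R a"
    using decomp[OF s(1) Qne] by blast
  define k l where "k = (1 - s) * s'" and "l = (1 - s) * (1 - s')"
  have kl: "0 \<le> k" "0 \<le> l" "k + l + s = 1" using s(3,4) s'(3,4)
    by (simp_all add: k_def l_def) (simp add: algebra_simps)
  have ze: "z = l *\<^sub>R y + k *\<^sub>R a + s *\<^sub>R b"
    unfolding s(5) s'(5) k_def l_def by (simp add: algebra_simps)
  have x: "xp a b \<in> convex hull Q0" by (rule xp_segment_hull[OF s'(2) s(2)])
  have xe: "xp a b = (1 - t0) *\<^sub>R a + t0 *\<^sub>R b" by (simp add: xp_def)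
  have QA: "convex hull Q0 \<subseteq> ?A" "convex hull Q0 \<subseteq> ?B" by (intro hull_mono; blast)+
  have aA: "a \<in> ?A" using s'(2) unfolding segment_convex_hull by (meson hull_mono subsetD sup_ge2)
  have bB: "b \<in> ?B" using s(2) unfolding segment_convex_hull by (meson hull_mono subsetD sup_ge2)
  show "z \<in> ?A \<union> ?B"
  proof (cases "s * (1 - t0) \<le> k * t0")
    case True
    have "z = l *\<^sub>R y + (k - s * (1 - t0) / t0) *\<^sub>R a + (s / t0) *\<^sub>R xp a b"
      unfolding ze xe using t0 by (simp add: algebra_simps divide_simps flip: scaleR_left_distrib)
    moreover have "0 \<le> k - s * (1 - t0) / t0" using True t0 by (simp add: field_simps)
    moreover have "l + (k - s * (1 - t0) / t0) + s / t0 = 1"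
    proof -
      have "s / t0 - s * (1 - t0) / t0 = s" using t0 by (simp add: field_simps)
      then show ?thesis using kl(3) by simp
    qed
    ultimately have "z \<in> ?A"
      using convex_comb3[OF convex_convex_hull, of y "Q0 \<union> {v1, v2}" a "xp a b" l "k - s * (1 - t0) / t0" "s / t0"]
        s'(1) x QA(1) aA kl s(3) t0 by auto
    then show ?thesis by blast
  next
    case False
    have "z = l *\<^sub>R y + (s - k * t0 / (1 - t0)) *\<^sub>R b + (k / (1 - t0)) *\<^sub>R xp a b"
    proof -
      have "(k / (1 - t0)) *\<^sub>R xp a b = k *\<^sub>R a + (k * t0 / (1 - t0)) *\<^sub>R b"
        unfolding xe scaleR_right_distrib scaleR_scaleR using t0 by simp
      then show ?thesis unfolding ze by (simp add: algebra_simps)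
    qed
    moreover have "0 \<le> s - k * t0 / (1 - t0)" using False t0 by (simp add: field_simps)
    moreover have "l + (s - k * t0 / (1 - t0)) + k / (1 - t0) = 1"
    proof -
      have "k - k * t0 = k * (1 - t0)" by (simp add: algebra_simps)
      then have "k / (1 - t0) - k * t0 / (1 - t0) = k"
        unfolding diff_divide_distrib[symmetric] using t0 by simp
      then show ?thesis using kl(3) by simp
    qed
    ultimately have "z \<in> ?B"
      using convex_comb3[OF convex_convex_hull, of y "Q0 \<union> {u1, u2}" b "xp a b" l "s - k * t0 / (1 - t0)" "k / (1 - t0)"]
        s'(1) x QA(2) bB kl t0 by auto
    then show ?thesis by blast
  qed
qed

lemma dissection_exists: "\<exists>D. dissection P D \<and> card D = 4 * m - 6"
proof -
  obtain K where K: "finite K" "card K = 2 * m - 3"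
     "\<And>T. T \<in> K \<Longrightarrow> \<not> affine_dependent T \<and> card T = 4 \<and> T \<subseteq> Q0 \<union> {v1, v2} \<and> T \<inter> {v1, v2} \<noteq> {}"
     "\<And>T T'. T \<in> K \<Longrightarrow> T' \<in> K \<Longrightarrow> T \<noteq> T' \<Longrightarrow> strict_hull T \<inter> strict_hull T' = {}"
     "convex hull (Q0 \<union> {v1, v2}) \<subseteq> (\<Union>T\<in>K. convex hull T)"
    using half_dissection by metis
  obtain L where L: "finite L" "card L = 2 * m - 3"
     "\<And>T. T \<in> L \<Longrightarrow> \<not> affine_dependent T \<and> card T = 4 \<and> T \<subseteq> Q0 \<union> {u1, u2} \<and> T \<inter> {u1, u2} \<noteq> {}"
     "\<And>T T'. T \<in> L \<Longrightarrow> T' \<in> L \<Longrightarrow> T \<noteq> T' \<Longrightarrow> strict_hull T \<inter> strict_hull T' = {}"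
     "convex hull (Q0 \<union> {u1, u2}) \<subseteq> (\<Union>T\<in>L. convex hull T)"
    using Pm.half_dissection[OF swap] by metis
  have pos: "0 < Z z" if TK: "T \<in> K" "z \<in> strict_hull T" for T z
  proof (rule affine_fun_strict_hull_pos[OF _ affine_fun_coord _ _ that(2)])
    show "finite T" using K(3)[OF that(1)] by (simp add: card_ge_0_finite)
    show "0 \<le> Z x" if "x \<in> T" for x using K(3)[OF \<open>T \<in> K\<close>] that Q0_coords v by fastforce
    obtain w where "w \<in> T" "w = v1 \<or> w = v2" using K(3)[OF TK(1)] by blast
    then show "\<exists>x\<in>T. 0 < Z x" using v(3,4) by (intro bexI[of _ w]) auto
  qed
  have neg: "0 < - Z z" if TK: "T \<in> L" "z \<in> strict_hull T" for T z
  proof (rule affine_fun_strict_hull_pos[OF _ affine_fun_minus[OF affine_fun_coord] _ _ that(2)])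
    show "finite T" using L(3)[OF that(1)] by (simp add: card_ge_0_finite)
    show "0 \<le> - Z x" if "x \<in> T" for x using L(3)[OF \<open>T \<in> L\<close>] that Q0_coords u by fastforce
    obtain w where "w \<in> T" "w = u1 \<or> w = u2" using L(3)[OF TK(1)] by blast
    then show "\<exists>x\<in>T. 0 < - Z x" using u(3,4) by (intro bexI[of _ w]) auto
  qed
  define M where "M = K \<union> L"
  have M: "\<not> affine_dependent T \<and> card T = 4 \<and> T \<subseteq> V" if "T \<in> M" for T
    using K(3)[of T] L(3)[of T] that unfolding M_def V_def by blast
  have dj: "strict_hull T \<inter> strict_hull T' = {}" if T: "T \<in> M" "T' \<in> M" "T \<noteq> T'" for T T'
  proof (cases "(T \<in> K \<and> T' \<in> K) \<or> (T \<in> L \<and> T' \<in> L)")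
    case True
    then show ?thesis using K(4) L(4) T(3) by blast
  next
    case False
    then have "(T \<in> K \<and> T' \<in> L) \<or> (T \<in> L \<and> T' \<in> K)" using T unfolding M_def by blast
    then show ?thesis using pos neg by (metis disjoint_iff less_asym' neg_0_less_iff_less)
  qed
  have "K \<inter> L = {}"
  proof (rule equals0I)
    fix T assume "T \<in> K \<inter> L"
    then have "T \<inter> {v1, v2} \<noteq> {}" "T \<subseteq> Q0 \<union> {u1, u2}" using K(3)[of T] L(3)[of T] by blast+
    then show False using distinct_apices by auto
  qed
  then have "card M = 4 * m - 6" unfolding M_def using card_Un_disjoint[OF K(1) L(1)] K(2) L(2) m by simp
  define D where "D = (hull) convex ` M"
  have vert: "vertices (convex hull T) = T" if "T \<in> M" for T
    unfolding vertices_def using extreme_point_of_convex_hull_affine_independent M[OF that] by blast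
  have inj: "inj_on ((hull) convex) M" by (rule inj_on_inverseI[of _ vertices]) (rule vert)
  have "dissection P D"
    unfolding dissection_def
  proof (intro conjI ballI impI)
    show "finite D" using K(1) L(1) by (simp add: D_def M_def)
    fix T assume "T \<in> D"
    then obtain A where A: "A \<in> M" "T = convex hull A" by (auto simp: D_def)
    show "3 simplex T" unfolding simplex_def A(2) using M[OF A(1)] by (intro exI[of _ A]) simp
    show "vertices T \<subseteq> vertices P" using M[OF A(1)] vert[OF A(1)] A(2) vertices_P by simp
  next
    fix S T assume ST: "S \<in> D" "T \<in> D" "S \<noteq> T"
    obtain A where A: "A \<in> M" "S = convex hull A" using ST(1) by (auto simp: D_def)
    obtain B where B: "B \<in> M" "T = convex hull B" using ST(2) by (auto simp: D_def)
    have "strict_hull A \<inter> strict_hull B = {}" using dj A B ST(3) by blast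
    then show "interior S \<inter> interior T = {}"
      using strict_hull_simplex_interior[of A] strict_hull_simplex_interior[of B] M[OF A(1)] M[OF B(1)]
      unfolding A(2) B(2) by blast
  next
    show "\<Union>D = P"
    proof
      show "\<Union>D \<subseteq> P" using M hull_mono[of _ V convex] unfolding D_def P_def by blast
      show "P \<subseteq> \<Union>D" using P_split K(5) L(5) unfolding D_def M_def by blast
    qed
  qed
  moreover have "card D = 4 * m - 6" unfolding D_def card_image[OF inj] by fact
  ultimately show ?thesis by blast
qed

lemma max_dissection_ge: "4 * m - 6 \<le> max_dissection_size P"
proof -
  obtain D where D: "dissection P D" "card D = 4 * m - 6" using dissection_exists by blast
  have "finite {card D |D. dissection P D}"
    by (rule finite_dissection_cards) (simp add: vertices_P)
  then have "card D \<le> Max {card D |D. dissection P D}" using D(1) by (intro Max_ge) auto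
  then show ?thesis using D(2) by (simp add: max_dissection_size_def)
qed

lemma max_triangulation_attained:
  obtains D where "triangulation_of P D" "card D = max_triangulation_size P"
proof -
  have "{card D |D. triangulation_of P D} \<subseteq> {card D |D. dissection P D}"
    by (auto simp: triangulation_of_def)
  then have fin: "finite {card D |D. triangulation_of P D}"
    using finite_dissection_cards[of P] finite_subset by (simp add: vertices_P)
  have "{card D |D. triangulation_of P D} \<noteq> {}"
    using simplicial_polytope_triangulation[OF simplicial_P] by blast
  then have "Max {card D |D. triangulation_of P D} \<in> {card D |D. triangulation_of P D}"
    using fin by (intro Max_in)
  then show ?thesis using that by (auto simp: max_triangulation_size_def)
qed

end

subsection \<open>Counting tetrahedra of a triangulation\<close>

context half
begin

lemma card_gaps_1_pos:
  assumes "e \<subseteq> Q0" "card e = 2" "card (gaps e) = 1"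
  shows "\<exists>p p'. e = {p, p'} \<and> 0 < C p * C p' - S p * S p'"
  using card_gaps_1[OF assms] consecutive_pos by metis

text \<open>By \<open>consecutive_side\<close> only the first and the last step of the path are
  sides.\<close>

lemma card_gaps_1_sides:
  "card {e \<in> around K. card (gaps e) = 1 \<and>
     (\<exists>p p'. e = {p, p'} \<and> p \<noteq> p' \<and> C p * C p' + S p * S p' = r\<^sup>2 * cos (2 * pi / m))} \<le> 2"
proof -
  have "{e \<in> around K. card (gaps e) = 1 \<and>
     (\<exists>p p'. e = {p, p'} \<and> p \<noteq> p' \<and> C p * C p' + S p * S p' = r\<^sup>2 * cos (2 * pi / m))}
     \<subseteq> {{q 0, q (0 + 1)}, {q (m - 2), q (m - 2 + 1)}}"
  proof
    fix e assume "e \<in> {e \<in> around K. card (gaps e) = 1 \<and>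
     (\<exists>p p'. e = {p, p'} \<and> p \<noteq> p' \<and> C p * C p' + S p * S p' = r\<^sup>2 * cos (2 * pi / m))}"
    then have e: "e \<subseteq> Q0" "card e = 2" "card (gaps e) = 1"
      and "\<exists>p p'. e = {p, p'} \<and> p \<noteq> p' \<and> C p * C p' + S p * S p' = r\<^sup>2 * cos (2 * pi / m)"
      by (auto simp: around_def)
    then obtain p p' where p: "e = {p, p'}" "C p * C p' + S p * S p' = r\<^sup>2 * cos (2 * pi / m)" by blast
    obtain i where i: "i + 1 < m" "e = {q i, q (i + 1)}" using card_gaps_1[OF e] by blast
    have "(p = q i \<and> p' = q (i + 1)) \<or> (p = q (i + 1) \<and> p' = q i)"
      using p(1) i(2) by (auto simp: doubleton_eq_iff)
    then have "C (q i) * C (q (i + 1)) + S (q i) * S (q (i + 1)) = r\<^sup>2 * cos (2 * d)"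
      using p(2) by (auto simp: d_def mult.commute)
    then have "i = 0 \<or> i = m - 2" using consecutive_side[OF i(1)] by auto
    then show "e \<in> {{q 0, q (0 + 1)}, {q (m - 2), q (m - 2 + 1)}}" using i(2) by blast
  qed
  then have "card {e \<in> around K. card (gaps e) = 1 \<and>
     (\<exists>p p'. e = {p, p'} \<and> p \<noteq> p' \<and> C p * C p' + S p * S p' = r\<^sup>2 * cos (2 * pi / m))}
    \<le> card {{q 0, q (0 + 1)}, {q (m - 2), q (m - 2 + 1)}}"
    by (rule card_mono[rotated]) simp
  also have "\<dots> \<le> 2" by (simp add: card_insert_if)
  finally show ?thesis .
qed

end

lemma coord_minus [simp]: "coord c (- e) p = - coord c e p"
  by (simp add: coord_def)

context Pm
begin

section \<open>Chords around the two edges, independent of orientation\<close>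

definition link :: "space set set \<Rightarrow> space set set" where
  "link K = {e. e \<subseteq> Q0 \<and> card e = 2 \<and> e \<union> {v1, v2} \<in> K}"

text \<open>Sides are recognised by their central angle. This is symmetric in \<open>X\<close> and
  \<open>Y\<close> and independent of any numbering, so both halves share the notion.\<close>

definition side :: "space set \<Rightarrow> bool" where
  "side e \<longleftrightarrow> (\<exists>p p'. e = {p, p'} \<and> p \<noteq> p' \<and> Y p * Y p' + X p * X p' = r\<^sup>2 * cos (2 * pi / m))"

text \<open>The conclusion of \<open>apex_separation\<close> with the order of the three points
  replaced by a product of differences, which survives the reflection of \<open>ex\<close>.\<close>

definition separates :: "space set set \<Rightarrow> bool" where
  "separates K \<longleftrightarrow> (\<forall>U T1 T2 x1 x2. {v1, U} \<subseteq> T1 \<longrightarrow> T1 \<in> K \<longrightarrow> {v2, U} \<subseteq> T2 \<longrightarrow> T2 \<in> K \<longrightarrow> Z U < 0 \<longrightarrow>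
     x1 \<in> strict_hull {v1, U} \<longrightarrow> x1 \<in> convex hull Q0 \<longrightarrow> x2 \<in> strict_hull {v2, U} \<longrightarrow> x2 \<in> convex hull Q0 \<longrightarrow>
     Y x1 = Y x2 \<longrightarrow> (\<exists>e\<in>link K. \<exists>y\<in>convex hull e. Y y = Y x1 \<and> (X x1 - X y) * (X x2 - X y) < 0))"

text \<open>The weight of a chord is the number of gaps it spans. It is hidden behind an existential
  because the zigzag numbering depends on which alternative of \<open>half_exists\<close>
  holds.\<close>

lemma link_weights:
  assumes K: "face_to_face K"
  shows "\<exists>wt :: space set \<Rightarrow> nat. (\<forall>e\<in>link K. 1 \<le> wt e \<and>
      (wt e = 1 \<longrightarrow> (\<exists>p p'. e = {p, p'} \<and> 0 < Y p * Y p' - X p * X p'))) \<and>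
    sum wt (link K) \<le> m - 1 \<and> card {e \<in> link K. wt e = 1 \<and> side e} \<le> 2 \<and>
    (sum wt (link K) \<le> m - 2 \<or> separates K)"
  using half_exists
proof (elim disjE exE)
  fix t assume h: "half ey ex ez c r t m Q0 v1 v2"
  interpret h: half ey ex ez c r t m Q0 v1 v2 by (rule h)
  have l: "h.around K = link K" by (simp add: h.around_def link_def)
  have sep: "separates K" if "\<not> (\<exists>i. i + 1 < m \<and> (\<forall>e\<in>h.around K. i \<notin> h.gaps e))"
    unfolding separates_def
  proof (intro allI impI)
    have cov: "\<forall>i. i + 1 < m \<longrightarrow> (\<exists>e\<in>h.around K. i \<in> h.gaps e)" using that by blast
    fix U T1 T2 x1 x2
    assume a: "{v1, U} \<subseteq> T1" "T1 \<in> K" "{v2, U} \<subseteq> T2" "T2 \<in> K" "Z U < 0" "x1 \<in> strict_hull {v1, U}" "x1 \<in> convex hull Q0"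
      "x2 \<in> strict_hull {v2, U}" "x2 \<in> convex hull Q0" "Y x1 = Y x2"
    obtain e y where "e \<in> h.around K" "y \<in> convex hull e" "Y y = Y x1" "X x1 < X y" "X y < X x2"
      by (rule h.apex_separation[OF K cov a])
    then show "\<exists>e\<in>link K. \<exists>y\<in>convex hull e. Y y = Y x1 \<and> (X x1 - X y) * (X x2 - X y) < 0"
      using l by (intro bexI[of _ e] bexI[of _ y]) (auto simp: mult_less_0_iff)
  qed
  show ?thesis
  proof (intro exI[of _ "\<lambda>e. card (h.gaps e)"] conjI ballI impI)
    fix e assume "e \<in> link K"
    then have e: "e \<subseteq> Q0" "card e = 2" by (auto simp: link_def)
    show "1 \<le> card (h.gaps e)" by (rule h.card_gaps_pos[OF e])
    show "\<exists>p p'. e = {p, p'} \<and> 0 < Y p * Y p' - X p * X p'" if "card (h.gaps e) = 1"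
      by (rule h.card_gaps_1_pos[OF e that])
  next
    show "(\<Sum>e\<in>link K. card (h.gaps e)) \<le> m - 1" using h.sum_card_gaps(1)[OF K] l by simp
    show "(\<Sum>e\<in>link K. card (h.gaps e)) \<le> m - 2 \<or> separates K"
      using h.sum_card_gaps(2)[OF K] sep l by auto
    show "card {e \<in> link K. card (h.gaps e) = 1 \<and> side e} \<le> 2"
      using h.card_gaps_1_sides[of K] unfolding l side_def .
  qed
next
  fix t assume h: "half ey (- ex) ez c r t m Q0 v2 v1"
  interpret h: half ey "- ex" ez c r t m Q0 v2 v1 by (rule h)
  have l: "h.around K = link K" by (simp add: h.around_def link_def insert_commute)
  have sep: "separates K" if "\<not> (\<exists>i. i + 1 < m \<and> (\<forall>e\<in>h.around K. i \<notin> h.gaps e))"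
    unfolding separates_def
  proof (intro allI impI)
    have cov: "\<forall>i. i + 1 < m \<longrightarrow> (\<exists>e\<in>h.around K. i \<in> h.gaps e)" using that by blast
    fix U T1 T2 x1 x2
    assume a: "{v1, U} \<subseteq> T1" "T1 \<in> K" "{v2, U} \<subseteq> T2" "T2 \<in> K" "Z U < 0" "x1 \<in> strict_hull {v1, U}" "x1 \<in> convex hull Q0"
      "x2 \<in> strict_hull {v2, U}" "x2 \<in> convex hull Q0" "Y x1 = Y x2"
    obtain e y where "e \<in> h.around K" "y \<in> convex hull e" "Y y = Y x2" "coord c (- ex) x2 < coord c (- ex) y" "coord c (- ex) y < coord c (- ex) x1"
      by (rule h.apex_separation[OF K cov a(3,4,1,2,5) a(8,9,6,7) a(10)[symmetric]])
    then show "\<exists>e\<in>link K. \<exists>y\<in>convex hull e. Y y = Y x1 \<and> (X x1 - X y) * (X x2 - X y) < 0"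
      using l a(10) by (intro bexI[of _ e] bexI[of _ y]) (auto simp: mult_less_0_iff)
  qed
  show ?thesis
  proof (intro exI[of _ "\<lambda>e. card (h.gaps e)"] conjI ballI impI)
    fix e assume "e \<in> link K"
    then have e: "e \<subseteq> Q0" "card e = 2" by (auto simp: link_def)
    show "1 \<le> card (h.gaps e)" by (rule h.card_gaps_pos[OF e])
    show "\<exists>p p'. e = {p, p'} \<and> 0 < Y p * Y p' - X p * X p'" if "card (h.gaps e) = 1"
      using h.card_gaps_1_pos[OF e that] by simp
  next
    show "(\<Sum>e\<in>link K. card (h.gaps e)) \<le> m - 1" using h.sum_card_gaps(1)[OF K] l by simp
    show "(\<Sum>e\<in>link K. card (h.gaps e)) \<le> m - 2 \<or> separates K"
      using h.sum_card_gaps(2)[OF K] sep l by auto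
    show "card {e \<in> link K. card (h.gaps e) = 1 \<and> side e} \<le> 2"
      using h.card_gaps_1_sides[of K] unfolding l side_def by simp
  qed
qed

section \<open>Numbering the vertices around the circle, as opposed to the zigzag numbering
  \<open>q\<close>\<close>

definition pt :: "nat \<Rightarrow> space" where
  "pt k = circle_pt c ex ey r (\<theta> + 2 * pi * real k / m)"

lemma pt_image: "pt ` {..<m} = Q0"
  unfolding Q0 pt_def[abs_def] using m by (intro circle_pt_image) simp

lemma pt_inj: "inj_on pt {..<m}"
  using card_Q0 unfolding pt_image[symmetric] by (intro eq_card_imp_inj_on) auto

lemma pt_in [simp]: "k < m \<Longrightarrow> pt k \<in> Q0"
  using pt_image by blast

lemma pt_coords: "X (pt k) = r * cos (\<theta> + 2 * pi * real k / m)" "Y (pt k) = r * sin (\<theta> + 2 * pi * real k / m)"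
  by (simp_all add: pt_def)

text \<open>Area of an inscribed triangle: half the arcs between its corners are \<open>x\<close>
  and \<open>y\<close>, and \<open>orient\<close> is the squared radius times
  \<open>4 * sin x * sin y * sin (x + y)\<close>, where \<open>x + y\<close> is less than
  \<open>pi\<close>.\<close>

lemma orient_pos:
  assumes "i < j" "j < k" "k < m"
  shows "0 < orient (pt i) (pt j) (pt k)"
proof -
  define a b d where "a = \<theta> + 2 * pi * real i / m" and "b = \<theta> + 2 * pi * real j / m" and "d = \<theta> + 2 * pi * real k / m"
  define x y where "x = pi * real (j - i) / m" and "y = pi * real (k - j) / m"
  have m0: "0 < real m" using m by simp
  have xy: "b - a = 2 * x" "d - b = 2 * y" "d - a = 2 * x + 2 * y"
    using assms by (simp_all add: a_def b_def d_def x_def y_def of_nat_diff field_simps)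
  have pos: "0 < x" "0 < y" using assms m0 by (auto simp: x_def y_def)
  have "x + y = pi * real (k - i) / m" using assms by (simp add: x_def y_def of_nat_diff field_simps)
  also have "\<dots> < pi"
  proof -
    have "real (k - i) < m" using assms by simp
    then have "pi * real (k - i) < pi * m" by simp
    then show ?thesis using m0 by (simp add: divide_less_eq)
  qed
  finally have lt: "x + y < pi" .
  have "orient (pt i) (pt j) (pt k) = r\<^sup>2 * (sin (d - b) + sin (b - a) - sin (d - a))"
    unfolding orient_def pt_coords a_def[symmetric] b_def[symmetric] d_def[symmetric] sin_diff
    by (simp add: power2_eq_square algebra_simps)
  also have "sin (d - b) + sin (b - a) - sin (d - a) = 4 * sin x * sin y * sin (x + y)"
  proof -
    have "sin (2 * x + 2 * y) = sin (2 * x) * cos (2 * y) + cos (2 * x) * sin (2 * y)" by (rule sin_add)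
    then have "sin (2 * y) + sin (2 * x) - sin (2 * x + 2 * y) = sin (2 * x) * (1 - cos (2 * y)) + sin (2 * y) * (1 - cos (2 * x))"
      by (simp add: algebra_simps)
    also have "\<dots> = 2 * sin x * cos x * (2 * (sin y)\<^sup>2) + 2 * sin y * cos y * (2 * (sin x)\<^sup>2)"
      unfolding sin_double by (simp add: cos_double_sin)
    also have "\<dots> = 4 * sin x * sin y * sin (x + y)"
      unfolding sin_add by (simp add: power2_eq_square algebra_simps)
    finally show ?thesis unfolding xy .
  qed
  also have "0 < r\<^sup>2 * (4 * sin x * sin y * sin (x + y))"
    using r pos lt sin_gt_zero[of x] sin_gt_zero[of y] sin_gt_zero[of "x + y"] by simp
  finally show ?thesis .
qed

lemma orient_outside:
  assumes "i < j" "j < m" "k < m" "k < i \<or> j < k"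
  shows "0 < orient (pt i) (pt j) (pt k)"
proof (cases "j < k")
  case True
  then show ?thesis using orient_pos assms by blast
next
  case False
  then have "0 < orient (pt k) (pt i) (pt j)" using orient_pos assms by auto
  also have "orient (pt k) (pt i) (pt j) = orient (pt i) (pt j) (pt k)"
    by (simp add: orient_def algebra_simps)
  finally show ?thesis .
qed

lemma orient_inside:
  assumes "i < k" "k < j" "j < m"
  shows "orient (pt i) (pt j) (pt k) < 0"
proof -
  have "0 < orient (pt i) (pt k) (pt j)" by (rule orient_pos[OF assms])
  also have "orient (pt i) (pt k) (pt j) = - orient (pt i) (pt j) (pt k)"
    by (simp add: orient_def algebra_simps)
  finally show ?thesis by simp
qed

lemma on_chord:
  assumes p: "p \<in> Q0" "p' \<in> Q0" "p \<noteq> p'" and x: "x \<in> convex hull Q0" "orient p p' x = 0"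
  shows "x \<in> closed_segment p p'"
proof -
  obtain \<tau> k where t: "x = (1 - \<tau>) *\<^sub>R p + \<tau> *\<^sub>R p'" "0 < k" "(X x)\<^sup>2 + (Y x)\<^sup>2 = r\<^sup>2 - \<tau> * (1 - \<tau>) * k"
    using on_line[OF p Z_hull[OF x(1)] x(2)] by blast
  then have "0 \<le> \<tau> * (1 - \<tau>)" using hull_norm[OF x(1)] by (simp add: zero_le_mult_iff)
  then have "0 \<le> \<tau> \<and> \<tau> \<le> 1" by (auto simp: zero_le_mult_iff)
  then show ?thesis using t(1) by (auto simp: in_segment)
qed

end

lemma affine_fun_zero_between:
  assumes f: "affine_fun f" "f a \<le> 0" "0 \<le> f x" and x: "x \<in> closed_segment a b"
  obtains y where "y \<in> closed_segment a b" "f y = 0" "x \<in> closed_segment y b"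
proof -
  obtain u where u: "0 \<le> u" "u \<le> 1" "x = (1 - u) *\<^sub>R a + u *\<^sub>R b" using x by (auto simp: in_segment)
  show ?thesis
  proof (cases "f a = f x")
    case True
    then show ?thesis using that[of a] f x by simp
  next
    case False
    then have lt: "f a < f x" using f by simp
    define s where "s = - f a / (f x - f a)"
    have s: "0 \<le> s" "s \<le> 1" using lt f by (auto simp: s_def divide_simps)
    define y where "y = (1 - s) *\<^sub>R a + s *\<^sub>R x"
    have "f y = f a + s * (f x - f a)"
      unfolding y_def affine_fun_segment[OF f(1)] by (simp add: algebra_simps)
    also have "\<dots> = 0" using lt by (simp add: s_def)
    finally have fy: "f y = 0" .
    have ye: "y = (1 - s * u) *\<^sub>R a + (s * u) *\<^sub>R b"
      unfolding y_def u(3) by (simp add: algebra_simps)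
    have su: "0 \<le> s * u" "s * u \<le> u" "s * u \<le> 1" using s u by (auto intro: mult_left_le_one_le mult_le_one)
    have y1: "y \<in> closed_segment a b" unfolding ye using su by (auto simp: in_segment)
    have "x \<in> closed_segment y b"
    proof (cases "s * u = 1")
      case True
      then have "u = 1" using su u by simp
      then show ?thesis using u(3) by simp
    next
      case False
      define k where "k = (u - s * u) / (1 - s * u)"
      have den: "0 < 1 - s * u" using False su by simp
      have k: "0 \<le> k" "k \<le> 1" using su u den by (auto simp: k_def divide_simps)
      have ke: "(1 - k) * (1 - s * u) = 1 - u" using den by (simp add: k_def field_simps)
      have ke2: "(1 - k) * (s * u) + k = u"
      proof -
        have "k * (1 - s * u) = u - s * u" using den by (simp add: k_def)
        then show ?thesis by (simp add: algebra_simps)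
      qed
      have "(1 - k) *\<^sub>R y + k *\<^sub>R b = ((1 - k) * (1 - s * u)) *\<^sub>R a + ((1 - k) * (s * u) + k) *\<^sub>R b"
        unfolding ye by (simp add: scaleR_add_right scaleR_add_left)
      then have "x = (1 - k) *\<^sub>R y + k *\<^sub>R b" unfolding ke ke2 u(3) by simp
      then show ?thesis using k by (auto simp: in_segment)
    qed
    then show ?thesis using that y1 fy by blast
  qed
qed

definition is_face :: "space set set \<Rightarrow> space set \<Rightarrow> bool" where
  "is_face K A \<longleftrightarrow> (\<exists>S\<in>K. A \<subseteq> S)"

lemma is_face_strict:
  assumes "face_to_face K" "is_face K A" "is_face K B" "g \<in> strict_hull A" "g \<in> convex hull B"
  shows "A \<subseteq> B"
  using assms face_to_face_strict[of K] unfolding is_face_def by blast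

lemma is_face_subset: "is_face K A \<Longrightarrow> B \<subseteq> A \<Longrightarrow> is_face K B"
  unfolding is_face_def by blast

lemma hull_Un_segment:
  fixes A B :: "space set"
  assumes x: "x \<in> convex hull (A \<union> B)" and ne: "A \<noteq> {}" "B \<noteq> {}"
  obtains a b where "a \<in> convex hull A" "b \<in> convex hull B" "x \<in> closed_segment a b"
proof -
  have "convex hull (A \<union> B) = convex hull (convex hull A \<union> convex hull B)"
    unfolding hull_Un_left[of convex A B] hull_Un_right[of convex "convex hull A" B] ..
  then obtain k l a b where kl: "0 \<le> k" "0 \<le> l" "k + l = 1" "a \<in> convex hull A" "b \<in> convex hull B" "x = k *\<^sub>R a + l *\<^sub>R b"
    using x ne convex_hull_union_two[of "convex hull A" "convex hull B"] by auto
  have "k = 1 - l" "l \<le> 1" using kl by auto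
  then have "x \<in> closed_segment a b" using kl by (auto simp: in_segment)
  then show ?thesis using that kl by blast
qed

context Pm
begin

lemma pt_eq_iff: "i < m \<Longrightarrow> j < m \<Longrightarrow> pt i = pt j \<longleftrightarrow> i = j"
  using pt_inj by (auto simp: inj_on_def)

text \<open>\<open>x\<close> lies on a segment from a point of one part to a point of the other. The
  segment meets the line of the chord within the polygon, hence in the chord, which belongs to both
  parts; \<open>x\<close> is on one side of this crossing.\<close>

lemma chord_split:
  assumes J: "J \<subseteq> {..<m}" "s \<in> J" "t \<in> J" "s < t" and x: "x \<in> convex hull (pt ` J)"
  shows "x \<in> convex hull (pt ` (J \<inter> {s..t})) \<or> x \<in> convex hull (pt ` (J - {s<..<t}))"
proof -
  let ?h = "orient (pt s) (pt t)"
  define A where "A = pt ` (J \<inter> {s..t})"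
  define B where "B = pt ` (J - {s<..<t})"
  have st: "s < m" "t < m" using J by auto
  have "J = (J \<inter> {s..t}) \<union> (J - {s<..<t})" using J by auto
  then have "x \<in> convex hull (A \<union> B)" using x unfolding A_def B_def image_Un[symmetric] by simp
  moreover have "pt s \<in> A" "pt t \<in> A" "pt s \<in> B" "pt t \<in> B" using J by (auto simp: A_def B_def)
  ultimately obtain a b where ab: "a \<in> convex hull A" "b \<in> convex hull B" "x \<in> closed_segment a b"
    using hull_Un_segment[of x A B] by blast
  have hA: "?h a \<le> 0"
  proof (rule affine_fun_hull_le[OF affine_orient _ ab(1)])
    fix y assume "y \<in> A"
    then obtain k where k: "y = pt k" "s \<le> k" "k \<le> t" by (auto simp: A_def)
    then show "?h y \<le> 0"
      using orient_inside[of s k t] st by (cases "k = s \<or> k = t") auto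
  qed
  have hB: "0 \<le> ?h b"
  proof (rule affine_fun_hull_ge[OF affine_orient _ ab(2)])
    fix y assume "y \<in> B"
    then obtain k where k: "y = pt k" "k \<in> J" "\<not> (s < k \<and> k < t)" by (auto simp: B_def)
    then show "0 \<le> ?h y"
      using orient_outside[of s t k] st J by (cases "k = s \<or> k = t") auto
  qed
  have sub: "A \<subseteq> Q0" "B \<subseteq> Q0" using J by (auto simp: A_def B_def)
  have ptne: "pt s \<noteq> pt t" using pt_eq_iff[OF st] J by simp
  have chord: "y \<in> convex hull A \<and> y \<in> convex hull B" if "y \<in> closed_segment a b" "?h y = 0" for y
  proof -
    have "a \<in> convex hull Q0" "b \<in> convex hull Q0" using ab sub hull_mono[of A Q0 convex] hull_mono[of B Q0 convex] by auto
    then have "y \<in> convex hull Q0"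
      using that(1) closed_segment_subset[of a "convex hull Q0" b] by auto
    then have "y \<in> closed_segment (pt s) (pt t)"
      using on_chord[OF _ _ ptne _ that(2)] st by auto
    moreover have "closed_segment (pt s) (pt t) \<subseteq> convex hull A" "closed_segment (pt s) (pt t) \<subseteq> convex hull B"
      using \<open>pt s \<in> A\<close> \<open>pt t \<in> A\<close> \<open>pt s \<in> B\<close> \<open>pt t \<in> B\<close> by (simp_all add: closed_segment_subset hull_inc)
    ultimately show ?thesis by blast
  qed
  have seg: "z \<in> convex hull D" if "z \<in> closed_segment y b'" "y \<in> convex hull D" "b' \<in> convex hull D" for z y b' D
    using that closed_segment_subset[of y "convex hull D" b'] by auto
  have "x \<in> convex hull A \<or> x \<in> convex hull B"
  proof (cases "0 \<le> ?h x")
    case True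
    obtain y where "y \<in> closed_segment a b" "?h y = 0" "x \<in> closed_segment y b"
      using affine_fun_zero_between[OF affine_orient hA True ab(3)] by blast
    then show ?thesis using seg[of x y b B] chord ab(2) by blast
  next
    case False
    have "x \<in> closed_segment b a" using ab(3) by (simp add: closed_segment_commute)
    then obtain y where y: "y \<in> closed_segment b a" "- ?h y = 0" "x \<in> closed_segment y a"
      using affine_fun_zero_between[of "\<lambda>w. - ?h w" b x a] affine_fun_minus[OF affine_orient] hB False by auto
    have "y \<in> closed_segment a b" "?h y = 0" using y by (auto simp: closed_segment_commute)
    then have "y \<in> convex hull A" using chord by blast
    then have "x \<in> convex hull A" using seg[OF y(3)] ab(1) by blast
    then show ?thesis by blast
  qed
  then show ?thesis by (simp add: A_def B_def)
qed

lemma chords_cross: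
  assumes "i < j" "j < k" "k < l" "l < m"
  obtains g where "g \<in> strict_hull {pt j, pt l}" "g \<in> convex hull {pt i, pt k}"
proof -
  let ?h = "orient (pt i) (pt k)"
  have h: "?h (pt j) < 0" "0 < ?h (pt l)" using orient_inside[of i j k] orient_outside[of i k l] assms by auto
  define s where "s = - ?h (pt j) / (?h (pt l) - ?h (pt j))"
  have den: "0 < ?h (pt l) - ?h (pt j)" using h by simp
  have s: "0 < s" "s < 1" using h den by (auto simp: s_def divide_simps)
  define g where "g = (1 - s) *\<^sub>R pt j + s *\<^sub>R pt l"
  have "?h g = ?h (pt j) + s * (?h (pt l) - ?h (pt j))"
    unfolding g_def affine_fun_segment[OF affine_orient] by (simp add: algebra_simps)
  also have "\<dots> = 0" using den by (simp add: s_def)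
  finally have hg: "?h g = 0" .
  have g1: "g \<in> strict_hull {pt j, pt l}" unfolding g_def using s by (rule strict_hull_pairI)
  have "g \<in> convex hull {pt j, pt l}" using g1 strict_hull_subset[of "{pt j, pt l}"] by auto
  then have "g \<in> convex hull Q0" using hull_mono[of "{pt j, pt l}" Q0 convex] assms by auto
  then have "g \<in> closed_segment (pt i) (pt k)"
    using on_chord[of "pt i" "pt k" g] hg assms pt_eq_iff[of i k] by auto
  then show ?thesis using that g1 by (simp add: segment_convex_hull)
qed

text \<open>A crossing point is interior to one chord and lies on the other, so
  \<open>is_face_strict\<close> would give the chords a common end.\<close>

lemma noncrossing_faces:
  assumes K: "face_to_face K"
  shows "noncrossing {t. t \<subseteq> {..<m} \<and> is_face K (pt ` t)}"
  unfolding noncrossing_def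
proof (intro ballI notI)
  fix s t a c b d
  assume s: "s \<in> {t. t \<subseteq> {..<m} \<and> is_face K (pt ` t)}" and t: "t \<in> {t. t \<subseteq> {..<m} \<and> is_face K (pt ` t)}"
    and el: "a \<in> s" "c \<in> t" "b \<in> s" "d \<in> t" and o: "a < c \<and> c < b \<and> b < d"
  have lt: "a < m" "b < m" "c < m" "d < m" using s t el by auto
  obtain g where g: "g \<in> strict_hull {pt c, pt d}" "g \<in> convex hull {pt a, pt b}"
    using chords_cross[of a c b d] o lt by blast
  have "is_face K {pt a, pt b}" "is_face K {pt c, pt d}"
    using s t el by (auto intro: is_face_subset)
  then have "{pt c, pt d} \<subseteq> {pt a, pt b}" using is_face_strict[OF K _ _ g] by blast
  then have "pt c = pt a \<or> pt c = pt b" by auto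
  then show False using pt_eq_iff lt o by auto
qed

section \<open>Counting triangles and diagonals in the plane of the polygon\<close>

definition base_faces :: "space set set \<Rightarrow> nat \<Rightarrow> space set set" where
  "base_faces K n = {A. A \<subseteq> Q0 \<and> card A = n \<and> is_face K A}"

definition base_index :: "space set set \<Rightarrow> nat \<Rightarrow> nat set set" where
  "base_index K n = {t. t \<subseteq> {..<m} \<and> card t = n \<and> is_face K (pt ` t)}"

lemma base_faces_image: "base_faces K n = (`) pt ` base_index K n"
proof
  show "base_faces K n \<subseteq> (`) pt ` base_index K n"
  proof
    fix A assume A: "A \<in> base_faces K n"
    then have "A \<subseteq> pt ` {..<m}" by (auto simp: base_faces_def pt_image)
    then obtain t where t: "t \<subseteq> {..<m}" "A = pt ` t" by (auto simp: subset_image_iff)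
    have "card t = n" using A t card_image[OF inj_on_subset[OF pt_inj t(1)]] by (auto simp: base_faces_def)
    then show "A \<in> (`) pt ` base_index K n" using A t by (auto simp: base_index_def base_faces_def)
  qed
  show "(`) pt ` base_index K n \<subseteq> base_faces K n"
  proof
    fix A assume "A \<in> (`) pt ` base_index K n"
    then obtain t where t: "t \<in> base_index K n" "A = pt ` t" by blast
    have "t \<subseteq> {..<m}" using t by (simp add: base_index_def)
    then have "card A = card t" "A \<subseteq> Q0" using card_image[OF inj_on_subset[OF pt_inj]] t by auto
    then show "A \<in> base_faces K n" using t by (simp add: base_index_def base_faces_def)
  qed
qed

lemma card_base_faces: "card (base_faces K n) = card (base_index K n)"
proof -
  have "inj_on ((`) pt) (base_index K n)"
    by (rule inj_on_subset[OF inj_on_image_Pow[OF pt_inj]]) (auto simp: base_index_def)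
  then show ?thesis unfolding base_faces_image by (rule card_image)
qed

lemma noncrossing_index:
  assumes "face_to_face K"
  shows "noncrossing (base_index K n \<union> base_index K n')"
  by (rule noncrossing_subset[OF noncrossing_faces[OF assms]]) (auto simp: base_index_def)

lemma triangles_le:
  assumes K: "face_to_face K"
  shows "card (base_faces K 3) + 2 \<le> m"
proof -
  have "card (base_index K 3) + 2 \<le> card {..<m}"
    using m noncrossing_index[OF K, of 3 3] by (intro card_triangles_le) (auto simp: base_index_def)
  then show ?thesis by (simp add: card_base_faces)
qed

text \<open>Holds where an edge \<open>{v, u}\<close> of the triangulation pierces the polygon. Such
  a point lies on no base triangle and no base chord, which costs a triangle in the counts
  below.\<close>

definition avoids :: "space set set \<Rightarrow> space \<Rightarrow> bool" where
  "avoids K x \<longleftrightarrow> x \<in> convex hull Q0 \<and> (\<forall>A. A \<subseteq> Q0 \<longrightarrow> is_face K A \<longrightarrow> x \<notin> convex hull A)"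

lemma triangles_avoiding_index_le:
  assumes K: "face_to_face K" and x: "avoids K x" and I: "I \<subseteq> {..<m}" "3 \<le> card I" "x \<in> convex hull (pt ` I)"
    and F: "F \<subseteq> base_index K 3" "\<And>t. t \<in> F \<Longrightarrow> t \<subseteq> I"
  shows "card F + 3 \<le> card I"
proof (rule card_triangles_avoiding_le[where R = "\<lambda>J. x \<in> convex hull (pt ` J)"])
  show "finite I" using I(1) finite_subset by blast
  show "noncrossing F" using noncrossing_subset[OF noncrossing_index[OF K, of 3 3]] F(1) by auto
  show "t \<subseteq> I \<and> card t = 3" if "t \<in> F" for t using that F by (auto simp: base_index_def)
  show "x \<in> convex hull (pt ` (J \<inter> {s..t})) \<or> x \<in> convex hull (pt ` (J - {s<..<t}))"
    if "J \<subseteq> I" "s \<in> J" "t \<in> J" "s < t" "x \<in> convex hull (pt ` J)" for J s t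
    using chord_split[of J s t x] that I(1) by blast
  show "\<not> s \<subseteq> t" if "t \<in> F" "x \<in> convex hull (pt ` s)" for t s
  proof
    assume "s \<subseteq> t"
    then have "convex hull (pt ` s) \<subseteq> convex hull (pt ` t)" by (intro hull_mono image_mono)
    then have "x \<in> convex hull (pt ` t)" using that(2) by blast
    moreover have t: "t \<subseteq> {..<m}" "is_face K (pt ` t)" using that(1) F(1) by (auto simp: base_index_def)
    moreover have "pt ` t \<subseteq> Q0" unfolding pt_image[symmetric] by (rule image_mono[OF t(1)])
    ultimately show False using x by (auto simp: avoids_def)
  qed
qed (use I in auto)

lemma triangles_avoiding_le:
  assumes K: "face_to_face K" and x: "avoids K x"
  shows "card (base_faces K 3) + 3 \<le> m"
proof -
  have "card (base_index K 3) + 3 \<le> card {..<m}"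
    by (rule triangles_avoiding_index_le[OF K x])
      (use m x in \<open>simp_all add: pt_image avoids_def base_index_def\<close>)
  then show ?thesis by (simp add: card_base_faces)
qed

text \<open>The chord cuts the polygon into two with \<open>m + 2\<close> vertices in total, each
  holding one of the avoided points. Every base triangle lies in one of them, and each part loses
  3.\<close>

lemma triangles_separated_le:
  assumes K: "face_to_face K" and x: "avoids K x1" "avoids K x2"
    and e: "e \<in> base_faces K 2" "e = {p, p'}" "orient p p' x1 * orient p p' x2 < 0"
  shows "card (base_faces K 3) + 4 \<le> m"
proof -
  have eK: "is_face K e" "p \<noteq> p'" "p \<in> Q0" "p' \<in> Q0"
    using e(1,2) by (auto simp: base_faces_def)
  obtain i j where ij: "p = pt i" "p' = pt j" "i < m" "j < m" using eK pt_image by (metis imageE lessThan_iff)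
  have "i \<noteq> j" using ij eK by auto
  define s t where "s = min i j" and "t = max i j"
  have st: "s < t" "t < m" "e = {pt s, pt t}" using ij \<open>i \<noteq> j\<close> e(2) by (auto simp: s_def t_def min_def max_def)
  have "orient p' p y = - orient p p' y" for y by (simp add: orient_def algebra_simps)
  then have "orient (pt s) (pt t) x1 * orient (pt s) (pt t) x2 = orient p p' x1 * orient p p' x2"
    using ij by (auto simp: s_def t_def min_def max_def)
  then have neg: "orient (pt s) (pt t) x1 * orient (pt s) (pt t) x2 < 0" using e(3) by simp
  obtain y z where yz: "avoids K y" "avoids K z" "orient (pt s) (pt t) y < 0" "0 < orient (pt s) (pt t) z"
    using neg x by (auto simp: mult_less_0_iff)
  define I1 where "I1 = {s..t}"
  define I2 where "I2 = {..<m} - {s<..<t}"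
  define F1 where "F1 = {a \<in> base_index K 3. a \<subseteq> I1}"
  define F2 where "F2 = {a \<in> base_index K 3. a \<subseteq> I2}"
  have sub: "I1 \<subseteq> {..<m}" "I2 \<subseteq> {..<m}" using st by (auto simp: I1_def I2_def)
  have fin: "finite I1" "finite I2" by (auto simp: I1_def I2_def)
  have split: "w \<in> convex hull (pt ` I1) \<or> w \<in> convex hull (pt ` I2)" if "avoids K w" for w
  proof -
    have "w \<in> convex hull (pt ` {..<m})" using that by (simp add: avoids_def pt_image)
    moreover have "{..<m} \<inter> {s..t} = I1" using st by (auto simp: I1_def)
    ultimately show ?thesis using chord_split[of "{..<m}" s t w] st by (simp add: I2_def)
  qed
  have h1: "orient (pt s) (pt t) w \<le> 0" if "w \<in> convex hull (pt ` I1)" for w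
  proof (rule affine_fun_hull_le[OF affine_orient _ that])
    fix y assume "y \<in> pt ` I1"
    then obtain k where "y = pt k" "s \<le> k" "k \<le> t" by (auto simp: I1_def)
    then show "orient (pt s) (pt t) y \<le> 0"
      using orient_inside[of s k t] st by (cases "k = s \<or> k = t") auto
  qed
  have h2: "0 \<le> orient (pt s) (pt t) w" if "w \<in> convex hull (pt ` I2)" for w
  proof (rule affine_fun_hull_ge[OF affine_orient _ that])
    fix y assume "y \<in> pt ` I2"
    then obtain k where "y = pt k" "k < m" "\<not> (s < k \<and> k < t)" by (auto simp: I2_def)
    then show "0 \<le> orient (pt s) (pt t) y"
      using orient_outside[of s t k] st by (cases "k = s \<or> k = t") auto
  qed
  have y1: "y \<in> convex hull (pt ` I1)" using split[OF yz(1)] h2[of y] yz(3) by auto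
  have z2: "z \<in> convex hull (pt ` I2)" using split[OF yz(2)] h1[of z] yz(4) by auto
  have three: "3 \<le> card I" if I: "finite I" "s \<in> I" "t \<in> I" "w \<in> convex hull (pt ` I)" "orient (pt s) (pt t) w \<noteq> 0" for I w
  proof (rule ccontr)
    assume "\<not> ?thesis"
    then have "card I \<le> card {s, t}" using st by simp
    then have "I = {s, t}" using card_seteq[OF I(1), of "{s, t}"] I by auto
    then have "orient (pt s) (pt t) w = 0"
      using I(4) by (intro affine_fun_hull_eq[OF affine_orient _ I(4)]) auto
    then show False using I(5) by simp
  qed
  have c1: "card F1 + 3 \<le> card I1"
    using three[of I1 y] y1 yz(3) st fin sub
    by (intro triangles_avoiding_index_le[OF K yz(1)]) (auto simp: F1_def I1_def)
  have c2: "card F2 + 3 \<le> card I2"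
    using three[of I2 z] z2 yz(4) st fin sub
    by (intro triangles_avoiding_index_le[OF K yz(2)]) (auto simp: F2_def I2_def)
  have nc: "noncrossing (base_index K 2 \<union> base_index K 3)" by (rule noncrossing_index[OF K])
  have stE: "{s, t} \<in> base_index K 2" using st eK(1) by (auto simp: base_index_def)
  have cover: "base_index K 3 \<subseteq> F1 \<union> F2"
  proof
    fix a assume a: "a \<in> base_index K 3"
    then have am: "a \<subseteq> {..<m}" by (simp add: base_index_def)
    show "a \<in> F1 \<union> F2"
    proof (rule ccontr)
      assume "a \<notin> F1 \<union> F2"
      then have "\<not> a \<subseteq> I1" "\<not> a \<subseteq> I2" using a by (auto simp: F1_def F2_def)
      then obtain k l where k: "k \<in> a" "k \<notin> I1" and l: "l \<in> a" "l \<notin> I2" by blast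
      have l2: "s < l" "l < t" using l am by (auto simp: I2_def)
      have "k < s \<or> t < k" using k by (auto simp: I1_def)
      then show False
        using noncrossingD[OF nc, of a "{s, t}" k s l t] noncrossingD[OF nc, of "{s, t}" a s l t k] a stE k l l2 by auto
    qed
  qed
  have "finite F1" "finite F2"
    by (rule finite_subset[of _ "Pow {..<m}"]; force simp: F1_def F2_def base_index_def)+
  then have "card (base_index K 3) \<le> card F1 + card F2"
    using card_mono[OF _ cover] card_Un_le[of F1 F2] by fastforce
  moreover have "card I1 + card I2 = m + 2"
  proof -
    have "I1 \<union> I2 = {..<m}" "I1 \<inter> I2 = {s, t}" using st by (auto simp: I1_def I2_def)
    then show ?thesis using card_Un_Int[OF fin] st by simp
  qed
  ultimately show ?thesis using c1 c2 by (simp add: card_base_faces)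
qed

text \<open>Neighbours in the numbering, and likewise \<open>0\<close> and \<open>m - 1\<close>,
  have the central angle of a side, so a chord that is no side satisfies the hypotheses of
  \<open>card_diagonals_le\<close>.\<close>

lemma diagonals_le:
  assumes K: "face_to_face K"
  shows "card {e \<in> base_faces K 2. \<not> side e} + 3 \<le> m"
proof -
  define E where "E = {t \<in> base_index K 2. \<not> side (pt ` t)}"
  have E: "\<exists>i j. e = {i, j} \<and> i + 2 \<le> j \<and> j < m \<and> \<not> (i = 0 \<and> j = m - 1)" if eE: "e \<in> E" for e
  proof -
    have e: "e \<subseteq> {..<m}" "card e = 2" "\<not> side (pt ` e)" using eE by (auto simp: E_def base_index_def)
    obtain a b where ab: "e = {a, b}" "a \<noteq> b" using e(2) by (auto simp: card_2_iff)
    define i j where "i = min a b" and "j = max a b"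
    have ij: "e = {i, j}" "i < j" "j < m" using ab e(1) by (auto simp: i_def j_def min_def max_def)
    define x where "x = \<theta> + 2 * pi * real j / m - (\<theta> + 2 * pi * real i / m)"
    have xe: "x = 2 * pi * real (j - i) / m" using ij by (simp add: x_def of_nat_diff diff_divide_distrib right_diff_distrib)
    have "Y (pt i) * Y (pt j) + X (pt i) * X (pt j) = r\<^sup>2 * cos x"
      unfolding x_def pt_coords cos_diff by (simp add: power2_eq_square algebra_simps)
    moreover have "pt i \<noteq> pt j" using pt_eq_iff ij by auto
    ultimately have nc: "cos x \<noteq> cos (2 * pi / m)"
      using e(3) unfolding ij(1) side_def image_insert image_empty by metis
    have "j \<noteq> i + 1"
    proof
      assume "j = i + 1"
      then have "x = 2 * pi / m" unfolding xe by simp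
      then show False using nc by simp
    qed
    moreover have "\<not> (i = 0 \<and> j = m - 1)"
    proof
      assume "i = 0 \<and> j = m - 1"
      then have "real (j - i) = real m - 1" using m by (simp add: of_nat_diff)
      then have "x = 2 * pi * (real m - 1) / m" unfolding xe by simp
      also have "\<dots> = 2 * pi - 2 * pi / m" using m by (simp add: field_simps)
      finally show False using nc by (simp add: cos_diff)
    qed
    ultimately show ?thesis using ij by (intro exI[of _ i] exI[of _ j]) auto
  qed
  have "{0, m - 1} \<notin> E"
  proof
    assume "{0, m - 1} \<in> E"
    from E[OF this] obtain i j where "{0, m - 1} = {i, j}" "i + 2 \<le> j" "\<not> (i = 0 \<and> j = m - 1)" by blast
    then show False unfolding doubleton_eq_iff by linarith
  qed
  moreover have nc: "noncrossing E" by (rule noncrossing_subset[OF noncrossing_index[OF K, of 2 2]]) (auto simp: E_def)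
  moreover have "\<exists>i j. e = {i, j} \<and> i + 2 \<le> j \<and> j < m" if "e \<in> E" for e using E[OF that] by blast
  ultimately have "card E + 3 \<le> m" using m card_diagonals_le[of m E] by simp
  moreover have "{e \<in> base_faces K 2. \<not> side e} = (`) pt ` E"
    unfolding base_faces_image E_def by auto
  then have "card {e \<in> base_faces K 2. \<not> side e} \<le> card E"
    using card_image_le[of E "(`) pt"] finite_subset[of E "Pow {..<m}"] by (auto simp: E_def base_index_def)
  ultimately show ?thesis by simp
qed

end

section \<open>Sweeping the section by the plane of the polygon\<close>

lemma card_3_sorted_by:
  fixes g :: "'a \<Rightarrow> real"
  assumes "card N = 3" "inj_on g N"
  obtains a b d where "N = {a, b, d}" "g a < g b" "g b < g d"
proof -
  obtain x y z where xyz: "N = {x, y, z}" "x \<noteq> y" "y \<noteq> z" "x \<noteq> z"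
    using assms(1) by (auto simp: card_3_iff)
  have ne: "g x \<noteq> g y" "g y \<noteq> g z" "g x \<noteq> g z"
    using assms(2) xyz by (auto simp: inj_on_def)
  consider "g x < g y \<and> g y < g z" | "g x < g z \<and> g z < g y" | "g y < g x \<and> g x < g z"
    | "g y < g z \<and> g z < g x" | "g z < g x \<and> g x < g y" | "g z < g y \<and> g y < g x"
    using ne by linarith
  then show ?thesis
    using that xyz(1) by cases (metis insert_commute)+
qed

context Pm
begin

text \<open>A tetrahedron with vertices on both sides of the plane of the polygon meets this plane in
  the hull of its polygon vertices and of the points \<open>xp v u\<close> on its edges \<open>{v, u}\<close>. A node is
  the set of vertices that spans one of these points, \<open>loc\<close> is the point.\<close>

definition cross_pairs :: "space set set" where
  "cross_pairs = {{v1, u1}, {v1, u2}, {v2, u1}, {v2, u2}}"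

definition nodes :: "space set set" where
  "nodes = (\<lambda>p. {p}) ` Q0 \<union> cross_pairs"

definition loc :: "space set \<Rightarrow> space" where
  "loc \<sigma> = (SOME x. x \<in> strict_hull \<sigma> \<and> Z x = 0)"

lemma loc_single: "p \<in> Q0 \<Longrightarrow> loc {p} = p"
  unfolding loc_def using Q0_coords by (intro some_equality) auto

lemma cross_pairs_cases:
  assumes "\<sigma> \<in> cross_pairs"
  obtains v u where "v \<in> {v1, v2}" "u \<in> {u1, u2}" "\<sigma> = {v, u}"
  using assms unfolding cross_pairs_def by blast

lemma xp_strict_hull: "xp v u \<in> strict_hull {v, u}"
  unfolding xp_def using t0 by (rule strict_hull_pairI)

lemma loc_pair:
  assumes "v \<in> {v1, v2}" "u \<in> {u1, u2}"
  shows "loc {v, u} = xp v u"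
  unfolding loc_def
proof (rule some_equality)
  show "xp v u \<in> strict_hull {v, u} \<and> Z (xp v u) = 0"
    using xp_strict_hull Z_xp[OF assms] by blast
  fix x assume x: "x \<in> strict_hull {v, u} \<and> Z x = 0"
  have Z: "Z v = Z v1" "Z u = Z u1" using assms u(3) v(3) by auto
  then have "v \<noteq> u" using u(4) v(4) by auto
  then obtain s where s: "x = (1 - s) *\<^sub>R v + s *\<^sub>R u" using strict_hull_pair x by blast
  have "Z x = (1 - s) * Z v + s * Z u" unfolding s by (rule affine_fun_segment) simp
  then have "(1 - s) * Z v1 + s * Z u1 = 0" using x Z by simp
  then have "s * (Z v1 - Z u1) = Z v1" by (simp add: algebra_simps)
  then have "s = t0" using v u by (simp add: t0_def field_simps)
  then show "x = xp v u" using s by (simp add: xp_def)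
qed

lemma node_facts:
  assumes "\<sigma> \<in> nodes"
  shows "finite \<sigma>" "\<sigma> \<noteq> {}" "loc \<sigma> \<in> strict_hull \<sigma>" "loc \<sigma> \<in> convex hull Q0" "Z (loc \<sigma>) = 0"
proof -
  have "finite \<sigma> \<and> \<sigma> \<noteq> {} \<and> loc \<sigma> \<in> strict_hull \<sigma> \<and> loc \<sigma> \<in> convex hull Q0 \<and> Z (loc \<sigma>) = 0"
  proof (cases "\<sigma> \<in> cross_pairs")
    case True
    then obtain v u where vu: "v \<in> {v1, v2}" "u \<in> {u1, u2}" "\<sigma> = {v, u}" by (rule cross_pairs_cases)
    then show ?thesis using loc_pair[OF vu(1,2)] xp_strict_hull[of v u] xp_hull[OF vu(1,2)] Z_xp[OF vu(1,2)] by auto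
  next
    case False
    then obtain p where "p \<in> Q0" "\<sigma> = {p}" using assms by (auto simp: nodes_def)
    then show ?thesis using loc_single Q0_coords by (auto intro: hull_inc)
  qed
  then show "finite \<sigma>" "\<sigma> \<noteq> {}" "loc \<sigma> \<in> strict_hull \<sigma>" "loc \<sigma> \<in> convex hull Q0" "Z (loc \<sigma>) = 0" by auto
qed

lemma finite_cross_pairs [simp]: "finite cross_pairs"
  by (simp add: cross_pairs_def)

lemma finite_nodes [simp]: "finite nodes"
  by (simp add: nodes_def)

lemma nodes_antichain:
  assumes "\<sigma> \<in> nodes" "\<sigma>' \<in> nodes" "\<sigma> \<subseteq> \<sigma>'"
  shows "\<sigma> = \<sigma>'"
  using assms distinct_apices unfolding nodes_def cross_pairs_def by auto

lemma loc_inj: "inj_on loc nodes"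
proof (rule inj_onI)
  fix \<sigma> \<sigma>' assume s: "\<sigma> \<in> nodes" "\<sigma>' \<in> nodes" and eq: "loc \<sigma> = loc \<sigma>'"
  have nq: "loc \<rho> \<notin> Q0" if cp: "\<rho> \<in> cross_pairs" for \<rho>
  proof -
    obtain v u where vu: "v \<in> {v1, v2}" "u \<in> {u1, u2}" "\<rho> = {v, u}" using cp by (rule cross_pairs_cases)
    then show ?thesis using hull_norm_less[OF xp_rel_interior[OF vu(1,2)]] loc_pair[OF vu(1,2)] Q0_coords by force
  qed
  have q: "loc \<rho> \<in> Q0 \<and> \<rho> = {loc \<rho>}" if "\<rho> \<in> nodes" "\<rho> \<notin> cross_pairs" for \<rho>
    using that loc_single by (auto simp: nodes_def)
  show "\<sigma> = \<sigma>'"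
  proof (cases "\<sigma> \<in> cross_pairs")
    case True
    then have c: "\<sigma>' \<in> cross_pairs" using nq[OF True] q[of \<sigma>'] s eq by auto
    obtain v u where vu: "v \<in> {v1, v2}" "u \<in> {u1, u2}" "\<sigma> = {v, u}" using True by (rule cross_pairs_cases)
    obtain v' u' where vu': "v' \<in> {v1, v2}" "u' \<in> {u1, u2}" "\<sigma>' = {v', u'}" using c by (rule cross_pairs_cases)
    have e: "xp v u = xp v' u'" using eq loc_pair vu vu' by simp
    have Xx: "X (xp a d) = (1 - t0) * X a + t0 * X d" "Y (xp a d) = (1 - t0) * Y a + t0 * Y d" for a d
      unfolding xp_def by (rule affine_fun_segment, simp)+
    have "X u = X u1" "X u' = X u1" "Y v = Y v1" "Y v' = Y v1" using vu vu' u(1) v(1) by auto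
    then have "(1 - t0) * X v = (1 - t0) * X v'" "t0 * Y u = t0 * Y u'"
      using Xx[of v u] Xx[of v' u'] e by auto
    then have "X v = X v'" "Y u = Y u'" using t0 by auto
    then have "v = v'" "u = u'" using vu(1,2) vu'(1,2) v(2) u(2) by auto
    then show ?thesis using vu vu' by simp
  next
    case False
    then have "\<sigma>' \<notin> cross_pairs" using nq[of \<sigma>'] q[OF s(1) False] eq by auto
    then show ?thesis using q[OF s(1) False] q[OF s(2)] eq by simp
  qed
qed

text \<open>Each pair of node points with different \<open>Y\<close> excludes one slope. For pairs
  with equal \<open>Y\<close> division by zero merely adds 0 to \<open>B\<close>; there equal values
  force equal \<open>X\<close> and \<open>loc_inj\<close> finishes.\<close>

lemma generic_direction: "\<exists>\<kappa>. inj_on (\<lambda>\<sigma>. X (loc \<sigma>) + \<kappa> * Y (loc \<sigma>)) nodes"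
proof -
  define B where "B = (\<lambda>(\<sigma>, \<sigma>'). - (X (loc \<sigma>) - X (loc \<sigma>')) / (Y (loc \<sigma>) - Y (loc \<sigma>'))) ` (nodes \<times> nodes)"
  have "finite B" by (simp add: B_def)
  then obtain \<kappa> where \<kappa>: "\<kappa> \<notin> B" using ex_new_if_finite infinite_UNIV_char_0 by blast
  have "inj_on (\<lambda>\<sigma>. X (loc \<sigma>) + \<kappa> * Y (loc \<sigma>)) nodes"
  proof (rule inj_onI)
    fix \<sigma> \<sigma>' assume s: "\<sigma> \<in> nodes" "\<sigma>' \<in> nodes" and eq: "X (loc \<sigma>) + \<kappa> * Y (loc \<sigma>) = X (loc \<sigma>') + \<kappa> * Y (loc \<sigma>')"
    have "Y (loc \<sigma>) = Y (loc \<sigma>')"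
    proof (rule ccontr)
      assume ne: "Y (loc \<sigma>) \<noteq> Y (loc \<sigma>')"
      have "\<kappa> * (Y (loc \<sigma>) - Y (loc \<sigma>')) = - (X (loc \<sigma>) - X (loc \<sigma>'))" using eq by (simp add: algebra_simps)
      then have "\<kappa> = - (X (loc \<sigma>) - X (loc \<sigma>')) / (Y (loc \<sigma>) - Y (loc \<sigma>'))" using ne by (simp add: eq_divide_eq)
      then have "\<kappa> \<in> B" unfolding B_def using s by force
      then show False using \<kappa> by simp
    qed
    then have "loc \<sigma> = loc \<sigma>'" using eq node_facts(5)[OF s(1)] node_facts(5)[OF s(2)] by (intro fr.coords_eqI) auto
    then show "\<sigma> = \<sigma>'" using loc_inj s by (auto dest: inj_onD)
  qed
  then show ?thesis by blast
qed

text \<open>For a functional \<open>g\<close> in general position, a triangle in the plane is charged to its vertex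
  \<open>loc \<sigma>\<close> with the middle value of \<open>g\<close>: the level line of \<open>g\<close> through this vertex enters the triangle
  towards \<open>y\<close>. A point inside the polygon is charged at most twice, once for each direction of
  the line, a vertex of the polygon at most once, and the two extreme vertices never.\<close>

lemma piece_charge:
  assumes K: "face_to_face K" and S: "is_face K S" and N: "N \<subseteq> nodes" "card N = 3" "\<Union>N = S"
    and g: "affine_fun g" "inj_on (\<lambda>\<sigma>. g (loc \<sigma>)) nodes"
  shows "\<exists>\<sigma> y. \<sigma> \<in> N \<and> y \<in> convex hull Q0 \<and> y \<noteq> loc \<sigma> \<and> g y = g (loc \<sigma>) \<and>
    (\<forall>s. 0 < s \<longrightarrow> s < 1 \<longrightarrow> (1 - s) *\<^sub>R loc \<sigma> + s *\<^sub>R y \<in> strict_hull S) \<and>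
    (\<exists>\<sigma>1\<in>N. g (loc \<sigma>1) < g (loc \<sigma>)) \<and> (\<exists>\<sigma>2\<in>N. g (loc \<sigma>) < g (loc \<sigma>2))"
proof -
  have "inj_on (\<lambda>\<sigma>. g (loc \<sigma>)) N" using g(2) N(1) inj_on_subset by blast
  then obtain \<alpha> \<sigma> \<gamma> where o: "N = {\<alpha>, \<sigma>, \<gamma>}" "g (loc \<alpha>) < g (loc \<sigma>)" "g (loc \<sigma>) < g (loc \<gamma>)"
    using card_3_sorted_by[OF N(2), of "\<lambda>\<sigma>. g (loc \<sigma>)"] by blast
  have nd: "\<alpha> \<in> nodes" "\<sigma> \<in> nodes" "\<gamma> \<in> nodes" using o(1) N(1) by auto
  note a = node_facts[OF nd(1)] and b = node_facts[OF nd(2)] and d = node_facts[OF nd(3)]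
  define k where "k = (g (loc \<sigma>) - g (loc \<alpha>)) / (g (loc \<gamma>) - g (loc \<alpha>))"
  have k: "0 < k" "k < 1" using o by (auto simp: k_def)
  \<comment> \<open>Where the level line through the middle point meets the opposite edge of the
    triangle.\<close>
  define y where "y = (1 - k) *\<^sub>R loc \<alpha> + k *\<^sub>R loc \<gamma>"
  have "g y = g (loc \<alpha>) + k * (g (loc \<gamma>) - g (loc \<alpha>))"
    unfolding y_def affine_fun_segment[OF g(1)] by (simp add: algebra_simps)
  also have "\<dots> = g (loc \<sigma>)" using o by (simp add: k_def)
  finally have gy: "g y = g (loc \<sigma>)" .
  have ys: "y \<in> strict_hull (\<alpha> \<union> \<gamma>)"
    unfolding y_def using a b d k by (intro strict_hull_combine) auto
  have yQ: "y \<in> convex hull Q0"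
    unfolding y_def using a(4) d(4) k by (intro convexD_alt[OF convex_convex_hull]) auto
  have SU: "S = \<sigma> \<union> (\<alpha> \<union> \<gamma>)" using N(3) o(1) by auto
  \<comment> \<open>Otherwise the point is interior to \<open>\<alpha> \<union> \<gamma>\<close> and
    lies in the hull of \<open>\<sigma>\<close>, so one node would contain another.\<close>
  have "y \<noteq> loc \<sigma>"
  proof
    assume "y = loc \<sigma>"
    then have "y \<in> convex hull \<sigma>" using strict_hull_subset[OF b(1)] b(3) by auto
    then have "\<alpha> \<union> \<gamma> \<subseteq> \<sigma>"
      using is_face_strict[OF K _ _ ys] S SU is_face_subset[of K S] by blast
    then have "\<alpha> = \<sigma>" using nodes_antichain[OF nd(1,2)] by blast
    then show False using o(2) by simp
  qed
  moreover have "(1 - s) *\<^sub>R loc \<sigma> + s *\<^sub>R y \<in> strict_hull S" if "0 < s" "s < 1" for s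
    unfolding SU using that a(1) b(1,3) d(1) ys by (intro strict_hull_combine) auto
  ultimately show ?thesis
    using o yQ gy by (intro exI[of _ \<sigma>] exI[of _ y]) auto
qed

text \<open>Within a level line of \<open>g\<close> in the plane \<open>Y\<close> is a parameter, so
  its increase from the charged node towards \<open>y S\<close> tells the two directions
  apart.\<close>

lemma pieces_le:
  assumes K: "face_to_face K"
    and P: "\<And>S. S \<in> \<P> \<Longrightarrow> is_face K S \<and> (\<exists>N. N \<subseteq> nodes \<and> card N = 3 \<and> \<Union>N = S)"
  shows "card \<P> + 2 \<le> m + 2 * card {\<sigma> \<in> cross_pairs. is_face K \<sigma>}"
proof -
  obtain \<kappa> where \<kappa>: "inj_on (\<lambda>\<sigma>. X (loc \<sigma>) + \<kappa> * Y (loc \<sigma>)) nodes" using generic_direction by blast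
  define g where "g = (\<lambda>x. 1 * X x + \<kappa> * Y x)"
  have ag: "affine_fun g" unfolding g_def by (rule affine_fun_linear_comb) simp_all
  have gi: "inj_on (\<lambda>\<sigma>. g (loc \<sigma>)) nodes" using \<kappa> by (simp add: g_def)
  have "\<forall>S\<in>\<P>. \<exists>\<sigma> y N. N \<subseteq> nodes \<and> \<Union>N = S \<and> \<sigma> \<in> N \<and> y \<in> convex hull Q0 \<and> y \<noteq> loc \<sigma> \<and> g y = g (loc \<sigma>) \<and>
    (\<forall>s. 0 < s \<longrightarrow> s < 1 \<longrightarrow> (1 - s) *\<^sub>R loc \<sigma> + s *\<^sub>R y \<in> strict_hull S) \<and>
    (\<exists>\<sigma>1\<in>N. g (loc \<sigma>1) < g (loc \<sigma>)) \<and> (\<exists>\<sigma>2\<in>N. g (loc \<sigma>) < g (loc \<sigma>2))"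
  proof
    fix S assume "S \<in> \<P>"
    then obtain N where "is_face K S" "N \<subseteq> nodes" "card N = 3" "\<Union>N = S" using P by blast
    with piece_charge[OF K this ag gi] show "\<exists>\<sigma> y N. N \<subseteq> nodes \<and> \<Union>N = S \<and> \<sigma> \<in> N \<and> y \<in> convex hull Q0 \<and> y \<noteq> loc \<sigma> \<and> g y = g (loc \<sigma>) \<and>
    (\<forall>s. 0 < s \<longrightarrow> s < 1 \<longrightarrow> (1 - s) *\<^sub>R loc \<sigma> + s *\<^sub>R y \<in> strict_hull S) \<and>
    (\<exists>\<sigma>1\<in>N. g (loc \<sigma>1) < g (loc \<sigma>)) \<and> (\<exists>\<sigma>2\<in>N. g (loc \<sigma>) < g (loc \<sigma>2))" by blast
  qed
  then obtain \<Sigma> y N where c: "\<And>S. S \<in> \<P> \<Longrightarrow> N S \<subseteq> nodes \<and> \<Union>(N S) = S \<and> \<Sigma> S \<in> N S \<and> y S \<in> convex hull Q0 \<and>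
      y S \<noteq> loc (\<Sigma> S) \<and> g (y S) = g (loc (\<Sigma> S)) \<and>
      (\<forall>s. 0 < s \<longrightarrow> s < 1 \<longrightarrow> (1 - s) *\<^sub>R loc (\<Sigma> S) + s *\<^sub>R y S \<in> strict_hull S) \<and>
      (\<exists>\<sigma>1\<in>N S. g (loc \<sigma>1) < g (loc (\<Sigma> S))) \<and> (\<exists>\<sigma>2\<in>N S. g (loc (\<Sigma> S)) < g (loc \<sigma>2))"
    by metis
  have nS: "\<Sigma> S \<in> nodes" if "S \<in> \<P>" for S using c[OF that] by blast
  have gXY: "x = x'" if "g x = g x'" "Y x = Y x'" "Z x = 0" "Z x' = 0" for x x'
    using that by (intro fr.coords_eqI) (auto simp: g_def)
  have Yne: "Y (y S) \<noteq> Y (loc (\<Sigma> S))" if "S \<in> \<P>" for S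
    using gXY[of "y S" "loc (\<Sigma> S)"] c[OF that] node_facts(5)[OF nS[OF that]] Z_hull[of "y S"] by blast
  \<comment> \<open>Both pieces contain an initial part of the same ray. \<open>s\<close> and
    \<open>s'\<close> scale the two lengths to a common point of their strict hulls.\<close>
  have uniq: "S \<subseteq> S'" if S: "S \<in> \<P>" "S' \<in> \<P>" and eq: "\<Sigma> S = \<Sigma> S'"
    and sg: "Y (loc (\<Sigma> S)) < Y (y S) \<longleftrightarrow> Y (loc (\<Sigma> S)) < Y (y S')" for S S'
  proof -
    define x where "x = loc (\<Sigma> S)"
    define \<eta> where "\<eta> = Y (y S) - Y x"
    define \<eta>' where "\<eta>' = Y (y S') - Y x"
    have ne: "\<eta> \<noteq> 0" "\<eta>' \<noteq> 0" using Yne[OF S(1)] Yne[OF S(2)] eq by (auto simp: \<eta>_def \<eta>'_def x_def)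
    have pos: "0 < \<eta>' / \<eta>" using sg ne by (auto simp: \<eta>_def \<eta>'_def x_def[symmetric] zero_less_divide_iff)
    define \<rho> where "\<rho> = \<eta>' / \<eta>"
    define s where "s = \<rho> / (1 + \<rho>)"
    define s' where "s' = 1 / (1 + \<rho>)"
    have s: "0 < s" "s < 1" "0 < s'" "s' < 1" using pos by (auto simp: s_def s'_def \<rho>_def[symmetric])
    have se: "s * \<eta> = s' * \<eta>'"
    proof -
      have "s = s' * (\<eta>' / \<eta>)" by (simp add: s_def s'_def \<rho>_def[symmetric])
      then show ?thesis using ne by simp
    qed
    define z where "z = (1 - s) *\<^sub>R x + s *\<^sub>R y S"
    define z' where "z' = (1 - s') *\<^sub>R x + s' *\<^sub>R y S'"
    have zS: "z \<in> strict_hull S" using c[OF S(1)] s by (simp add: z_def x_def)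
    have zS': "z' \<in> strict_hull S'" using c[OF S(2)] s eq by (simp add: z'_def x_def)
    have gy: "g (y S) = g x" "g (y S') = g x" using c[OF S(1)] c[OF S(2)] eq by (simp_all add: x_def)
    have Zy: "Z (y S) = 0" "Z (y S') = 0" "Z x = 0"
      using c[OF S(1)] c[OF S(2)] Z_hull node_facts(5)[OF nS[OF S(1)]] by (auto simp: x_def)
    have "z = z'"
    proof (rule gXY)
      show "g z = g z'" unfolding z_def z'_def affine_fun_segment[OF ag] gy by (simp add: algebra_simps)
      have "Y z = Y x + s * \<eta>" "Y z' = Y x + s' * \<eta>'"
        unfolding z_def z'_def \<eta>_def \<eta>'_def affine_fun_segment[OF affine_fun_coord] by (simp_all add: algebra_simps)
      then show "Y z = Y z'" using se by simp
      show "Z z = 0" "Z z' = 0" unfolding z_def z'_def affine_fun_segment[OF affine_fun_coord] Zy by simp_all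
    qed
    have fS: "is_face K S" "is_face K S'" using P S by auto
    have "finite S'"
    proof -
      obtain T where "T \<in> K" "S' \<subseteq> T" using fS(2) by (auto simp: is_face_def)
      moreover have "finite T" using K \<open>T \<in> K\<close> by (auto simp: face_to_face_def intro: aff_independent_finite)
      ultimately show ?thesis using finite_subset by blast
    qed
    then have "z' \<in> convex hull S'" using zS' strict_hull_subset by blast
    then show ?thesis using is_face_strict[OF K fS zS] \<open>z = z'\<close> by blast
  qed
  \<comment> \<open>Two opposite directions at \<open>p\<close> would put this point of the circle
    strictly between two points of the polygon.\<close>
  have single: "Y (loc (\<Sigma> S)) < Y (y S) \<longleftrightarrow> Y (loc (\<Sigma> S)) < Y (y S')"
    if S: "S \<in> \<P>" "S' \<in> \<P>" and eq: "\<Sigma> S = \<Sigma> S'" and p: "\<Sigma> S = {p}" "p \<in> Q0" for S S' p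
  proof (rule ccontr)
    assume n: "\<not> ?thesis"
    have lp: "loc (\<Sigma> S) = p" using loc_single p by simp
    have ne: "Y (y S) \<noteq> Y p" "Y (y S') \<noteq> Y p" using Yne[OF S(1)] Yne[OF S(2)] eq lp by auto
    define a where "a = Y p - Y (y S)"
    define a' where "a' = Y (y S') - Y p"
    have aa: "0 < a / (a + a')" "a / (a + a') < 1"
      using n ne unfolding lp a_def a'_def by (auto simp: divide_simps)
    have den: "a + a' \<noteq> 0" using aa by auto
    define k where "k = a / (a + a')"
    have gy: "g (y S) = g p" "g (y S') = g p" using c[OF S(1)] c[OF S(2)] eq lp by auto
    have yy: "y S \<in> convex hull Q0" "y S' \<in> convex hull Q0" using c[OF S(1)] c[OF S(2)] by auto
    have "p = (1 - k) *\<^sub>R y S + k *\<^sub>R y S'"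
    proof (rule gXY)
      show "g p = g ((1 - k) *\<^sub>R y S + k *\<^sub>R y S')" unfolding affine_fun_segment[OF ag] gy by (simp add: algebra_simps)
      have "Y ((1 - k) *\<^sub>R y S + k *\<^sub>R y S') = Y (y S) + k * (a + a')"
        unfolding affine_fun_segment[OF affine_fun_coord] a_def a'_def by (simp add: algebra_simps)
      also have "\<dots> = Y p" using den by (simp add: k_def a_def)
      finally show "Y p = Y ((1 - k) *\<^sub>R y S + k *\<^sub>R y S')" by simp
      show "Z p = 0" using Q0_coords p by simp
      show "Z ((1 - k) *\<^sub>R y S + k *\<^sub>R y S') = 0"
        unfolding affine_fun_segment[OF affine_fun_coord] using Z_hull yy by simp
    qed
    moreover have "y S \<noteq> y S'" using n unfolding lp by auto
    ultimately have "(X p)\<^sup>2 + (Y p)\<^sup>2 < r\<^sup>2" using open_segment_norm[OF yy, of k] aa by (simp add: k_def)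
    then show False using Q0_coords p by simp
  qed
  \<comment> \<open>The direction is recorded only at nodes on edges \<open>{v, u}\<close>; at
    polygon vertices \<open>single\<close> leaves no choice, and \<open>True\<close> is a
    dummy.\<close>
  define code where "code = (\<lambda>S. (\<Sigma> S, if \<Sigma> S \<in> cross_pairs then Y (loc (\<Sigma> S)) < Y (y S) else True))"
  have single_node: "\<exists>p\<in>Q0. \<sigma> = {p}" if "\<sigma> \<in> nodes" "\<sigma> \<notin> cross_pairs" for \<sigma> using that by (auto simp: nodes_def)
  have inj: "inj_on code \<P>"
  proof (rule inj_onI)
    fix S S' assume S: "S \<in> \<P>" "S' \<in> \<P>" and e: "code S = code S'"
    have eq: "\<Sigma> S = \<Sigma> S'" using e by (simp add: code_def)
    have "Y (loc (\<Sigma> S)) < Y (y S) \<longleftrightarrow> Y (loc (\<Sigma> S)) < Y (y S')"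
    proof (cases "\<Sigma> S \<in> cross_pairs")
      case True
      then show ?thesis using e eq by (auto simp: code_def)
    next
      case False
      then show ?thesis using single[OF S eq] single_node[OF nS[OF S(1)]] by blast
    qed
    then show "S = S'" using uniq[OF S eq] uniq[OF S(2,1) eq[symmetric]] eq by auto
  qed
  have Qne: "finite (g ` Q0)" "g ` Q0 \<noteq> {}" using card_Q0 m by auto
  obtain pmin where pmin: "pmin \<in> Q0" "g pmin = Min (g ` Q0)" using Min_in[OF Qne] by auto
  obtain pmax where pmax: "pmax \<in> Q0" "g pmax = Max (g ` Q0)" using Max_in[OF Qne] by auto
  have lo: "g pmin \<le> g x" if "x \<in> convex hull Q0" for x
    by (rule affine_fun_hull_ge[OF ag _ that]) (simp add: pmin(2))
  have hi: "g x \<le> g pmax" if "x \<in> convex hull Q0" for x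
    by (rule affine_fun_hull_le[OF ag _ that]) (simp add: pmax(2))
  have pne: "pmin \<noteq> pmax"
  proof
    assume e: "pmin = pmax"
    have "1 < card Q0" using card_Q0 m by simp
    then obtain p p' where pp: "p \<in> Q0" "p' \<in> Q0" "p \<noteq> p'" by (metis card_le_Suc0_iff_eq finite_Q0 not_less One_nat_def)
    have "g p = g pmin" "g p' = g pmin" using lo hi pp e hull_inc by (metis order_antisym)+
    then have "{p} = {p'}" using inj_onD[OF gi, of "{p}" "{p'}"] pp loc_single by (simp add: nodes_def)
    then show False using pp by simp
  qed
  define A where "A = (\<lambda>p. ({p}, True)) ` (Q0 - {pmin, pmax})"
  define B where "B = {\<sigma> \<in> cross_pairs. is_face K \<sigma>} \<times> (UNIV :: bool set)"
  have "code ` \<P> \<subseteq> A \<union> B"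
  proof
    fix w assume "w \<in> code ` \<P>"
    then obtain S where S: "S \<in> \<P>" "w = code S" by blast
    show "w \<in> A \<union> B"
    proof (cases "\<Sigma> S \<in> cross_pairs")
      case True
      have "\<Sigma> S \<subseteq> S" using c[OF S(1)] by blast
      then have "is_face K (\<Sigma> S)" using P[OF S(1)] is_face_subset by blast
      then show ?thesis using True S(2) by (simp add: B_def code_def)
    next
      case False
      then obtain p where p: "p \<in> Q0" "\<Sigma> S = {p}" using single_node nS[OF S(1)] by blast
      obtain \<sigma>1 \<sigma>2 where \<sigma>: "\<sigma>1 \<in> N S" "g (loc \<sigma>1) < g (loc (\<Sigma> S))" "\<sigma>2 \<in> N S" "g (loc (\<Sigma> S)) < g (loc \<sigma>2)"
        using c[OF S(1)] by blast
      have "\<sigma>1 \<in> nodes" "\<sigma>2 \<in> nodes" using c[OF S(1)] \<sigma> by blast+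
      then have "g pmin < g p" "g p < g pmax"
        using lo[OF node_facts(4)[of \<sigma>1]] hi[OF node_facts(4)[of \<sigma>2]] \<sigma> p loc_single by auto
      then show ?thesis using p False S(2) by (auto simp: A_def code_def)
    qed
  qed
  moreover have "finite (A \<union> B)" by (simp add: A_def B_def)
  ultimately have "card (code ` \<P>) \<le> card (A \<union> B)" by (intro card_mono)
  also have "\<dots> \<le> card A + card B" by (rule card_Un_le)
  also have "card A \<le> card (Q0 - {pmin, pmax})" unfolding A_def by (rule card_image_le) simp
  also have "card (Q0 - {pmin, pmax}) = m - 2"
    using card_Q0 pmin pmax pne by (simp add: card_Diff_subset)
  also have "card B = 2 * card {\<sigma> \<in> cross_pairs. is_face K \<sigma>}" by (simp add: B_def card_cartesian_product)
  finally have "card (code ` \<P>) \<le> m - 2 + 2 * card {\<sigma> \<in> cross_pairs. is_face K \<sigma>}" by simp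
  then show ?thesis using card_image[OF inj] m by simp
qed

end

section \<open>Combining the counts\<close>

lemma twice_card_le_sum:
  fixes wt :: "'a \<Rightarrow> nat"
  assumes "finite A" "\<And>e. e \<in> A \<Longrightarrow> 1 \<le> wt e"
  shows "2 * card A \<le> sum wt A + card {e \<in> A. wt e = 1}"
proof -
  have "2 * card A = (\<Sum>e\<in>A. 2)" by simp
  also have "\<dots> \<le> (\<Sum>e\<in>A. wt e + (if wt e = 1 then 1 else 0))"
  proof (rule sum_mono)
    fix e assume "e \<in> A"
    then have "1 \<le> wt e" by (rule assms(2))
    then show "2 \<le> wt e + (if wt e = 1 then 1 else 0)" by (cases "wt e = 1"; simp; linarith)
  qed
  also have "\<dots> = sum wt A + (\<Sum>e\<in>A. if wt e = 1 then 1 else 0)" by (rule sum.distrib)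
  also have "(\<Sum>e\<in>A. if wt e = 1 then 1 else 0) = card {e \<in> A. wt e = 1}"
    using sum.inter_filter[OF assms(1), of "\<lambda>_. 1 :: nat" "\<lambda>e. wt e = 1"] by simp
  finally show ?thesis .
qed

context Pm
begin

lemma tet_not_in_plane:
  assumes "\<not> affine_dependent S" "card S = 4"
  shows "\<not> S \<subseteq> Q0"
proof
  assume "S \<subseteq> Q0"
  have "aff_dim S = 3" using aff_dim_affine_independent[OF assms(1)] assms(2) by simp
  then have "affine hull S = UNIV" using aff_dim_eq_full[of S] by simp
  then have "Z v1 = 0"
    using \<open>S \<subseteq> Q0\<close> Q0_coords affine_fun_affine_hull[OF affine_fun_coord, of S c ez v1] by auto
  then show False using v by simp
qed

text \<open>Two tetrahedra on the same side of a base triangle overlap near it: the shift from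
  \<open>v1\<close> to \<open>v2\<close>, seen with small weight, is compensated by a small shift
  from \<open>x\<close> to \<open>x'\<close> within the triangle.\<close>

lemma cap_unique:
  assumes K: "face_to_face K" and t: "t \<subseteq> Q0" "card t = 3" "t \<union> {v1} \<in> K" "t \<union> {v2} \<in> K"
  shows False
proof -
  obtain p p' s where ps: "t = {p, p', s}" "p \<noteq> p'" "p' \<noteq> s" "p \<noteq> s"
    using t(2) by (auto simp: card_3_iff)
  have pQ: "p \<in> Q0" "p' \<in> Q0" "s \<in> Q0" using ps t by auto
  define a1 a2 b1 b2 where "a1 = X p' - X p" and "a2 = Y p' - Y p" and "b1 = X s - X p" and "b2 = Y s - Y p"
  define D where "D = a1 * b2 - a2 * b1"
  have D: "D \<noteq> 0" unfolding D_def a1_def a2_def b1_def b2_def orient_def[symmetric] by (rule orient_nonzero[OF pQ ps(2-4)])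
  \<comment> \<open>Cramer's rule: \<open>\<alpha>\<close> and \<open>\<beta>\<close> express the
    unit shift in direction \<open>ex\<close> through the edge vectors of the triangle at
    \<open>p\<close>.\<close>
  define \<alpha> where "\<alpha> = b2 / D"
  define \<beta> where "\<beta> = - a2 / D"
  have "\<alpha> * a1 + \<beta> * b1 = (a1 * b2 - a2 * b1) / D"
    by (simp add: \<alpha>_def \<beta>_def diff_divide_distrib mult.commute)
  moreover have "\<alpha> * a2 + \<beta> * b2 = 0" by (simp add: \<alpha>_def \<beta>_def)
  ultimately have ab: "\<alpha> * (X p' - X p) + \<beta> * (X s - X p) = 1" "\<alpha> * (Y p' - Y p) + \<beta> * (Y s - Y p) = 0"
    using D unfolding D_def[symmetric] by (simp_all add: a1_def a2_def b1_def b2_def)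
  \<comment> \<open>Small enough for the weights of \<open>x'\<close>, which start from
    \<open>1 / 3\<close> each, to stay nonnegative.\<close>
  define \<eta> where "\<eta> = 1 / (3 * (\<bar>\<alpha>\<bar> + \<bar>\<beta>\<bar> + 1))"
  have \<eta>: "0 < \<eta>" "\<eta> * (\<bar>\<alpha>\<bar> + \<bar>\<beta>\<bar>) \<le> 1 / 3" by (auto simp: \<eta>_def field_simps)
  have bounds: "\<bar>\<eta> * \<alpha>\<bar> + \<bar>\<eta> * \<beta>\<bar> \<le> 1 / 3" using \<eta> by (simp add: abs_mult distrib_left)
  define L where "L = X v2 - X v1"
  have L: "0 < L" using v by (simp add: L_def)
  define \<epsilon> where "\<epsilon> = \<eta> / (\<eta> + L)"
  have \<epsilon>: "0 < \<epsilon>" "\<epsilon> < 1" using \<eta> L by (auto simp: \<epsilon>_def)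
  have \<epsilon>L: "(1 - \<epsilon>) * \<eta> = \<epsilon> * L" using \<eta> L by (simp add: \<epsilon>_def field_simps)
  define x where "x = (1 / 3) *\<^sub>R p + (1 / 3) *\<^sub>R p' + (1 / 3) *\<^sub>R s"
  define x' where "x' = (1 / 3 - \<eta> * \<alpha> - \<eta> * \<beta>) *\<^sub>R p + (1 / 3 + \<eta> * \<alpha>) *\<^sub>R p' + (1 / 3 + \<eta> * \<beta>) *\<^sub>R s"
  have comb: "coord c e (k *\<^sub>R p + l *\<^sub>R p' + n *\<^sub>R s) = k * coord c e p + l * coord c e p' + n * coord c e s"
    if "k + l + n = 1" for k l n e
  proof -
    have "c \<bullet> e = (k + l + n) * (c \<bullet> e)" using that by simp
    then show ?thesis unfolding coord_def by (simp add: inner_add_left inner_diff_left algebra_simps)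
  qed
  have xs: "x \<in> strict_hull t"
    unfolding strict_hull_def ps(1) x_def using ps by (intro CollectI exI[of _ "\<lambda>_. 1 / 3"]) (auto simp: add.assoc)
  have x's: "x' \<in> convex hull t"
    unfolding x'_def using bounds ps(1) by (intro convex_comb3) (auto intro: hull_inc)
  define z where "z = (1 - \<epsilon>) *\<^sub>R x + \<epsilon> *\<^sub>R v2"
  have cx: "coord c e x = (coord c e p + coord c e p' + coord c e s) / 3" for e
    unfolding x_def by (subst comb) (simp_all add: field_simps)
  have cx': "coord c e x' = coord c e x + \<eta> * (\<alpha> * (coord c e p' - coord c e p) + \<beta> * (coord c e s - coord c e p))" for e
    unfolding cx x'_def by (subst comb) (simp_all add: field_simps)
  have "z = (1 - \<epsilon>) *\<^sub>R x' + \<epsilon> *\<^sub>R v1"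
  proof (rule fr.coords_eqI)
    show "X z = X ((1 - \<epsilon>) *\<^sub>R x' + \<epsilon> *\<^sub>R v1)"
      unfolding z_def affine_fun_segment[OF affine_fun_coord] cx' ab distrib_left
      using \<epsilon>L by (simp add: L_def algebra_simps)
    show "Y z = Y ((1 - \<epsilon>) *\<^sub>R x' + \<epsilon> *\<^sub>R v1)"
      unfolding z_def affine_fun_segment[OF affine_fun_coord] cx' ab using v by simp
    show "Z z = Z ((1 - \<epsilon>) *\<^sub>R x' + \<epsilon> *\<^sub>R v1)"
      unfolding z_def affine_fun_segment[OF affine_fun_coord] cx' using v Q0_coords pQ by simp
  qed
  moreover have "x' \<in> convex hull (t \<union> {v1})" using x's hull_mono[of t "t \<union> {v1}" convex] by auto
  moreover have "v1 \<in> convex hull (t \<union> {v1})" by (rule hull_inc) simp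
  ultimately have z1: "z \<in> convex hull (t \<union> {v1})"
    using convexD_alt[OF convex_convex_hull, of x' "t \<union> {v1}" v1 \<epsilon>] \<epsilon> by simp
  have "z \<in> strict_hull (t \<union> {v2})"
    unfolding z_def using ps(1) xs \<epsilon> by (intro strict_hull_combine) auto
  then have "t \<union> {v2} \<subseteq> t \<union> {v1}"
    by (rule face_to_face_strict[OF K t(4) subset_refl t(3) subset_refl _ z1])
  then show False using distinct_apices t(1) by auto
qed

lemma finite_base_faces [simp]: "finite (base_faces K n)"
  by (rule finite_subset[of _ "Pow Q0"]) (auto simp: base_faces_def)

lemma finite_link [simp]: "finite (link K)"
  by (rule finite_subset[of _ "Pow Q0"]) (auto simp: link_def)

lemma link_base_faces: "link K \<subseteq> base_faces K 2"
  unfolding link_def base_faces_def is_face_def by blast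

text \<open>No tetrahedron lies in the plane of the polygon. One with a single apex above stands on
  a base triangle, which determines it by \<open>cap_unique\<close>; one with both apices stands on
  a link chord.\<close>

lemma caps_le:
  assumes K: "face_to_face K" and S: "\<And>S. S \<in> K \<Longrightarrow> card S = 4 \<and> S \<subseteq> V"
  shows "card {S \<in> K. S \<inter> {u1, u2} = {}} \<le> card (base_faces K 3) + card (link K)"
proof -
  define A where "A = {S \<in> K. S \<inter> {u1, u2} = {} \<and> \<not> {v1, v2} \<subseteq> S}"
  define B where "B = {S \<in> K. S \<inter> {u1, u2} = {} \<and> {v1, v2} \<subseteq> S}"
  have A: "\<exists>w\<in>{v1, v2}. S = (S \<inter> Q0) \<union> {w} \<and> card (S \<inter> Q0) = 3" if SA: "S \<in> A" for S
  proof -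
    have SK: "S \<in> K" "S \<inter> {u1, u2} = {}" "\<not> {v1, v2} \<subseteq> S" using SA by (auto simp: A_def)
    have S4: "card S = 4" "S \<subseteq> V" using S[OF SK(1)] by auto
    have "\<not> affine_dependent S" using K SK(1) by (simp add: face_to_face_def)
    then have "\<not> S \<subseteq> Q0" using tet_not_in_plane S4 by blast
    then obtain w where w: "w \<in> S" "w \<notin> Q0" by blast
    have w2: "w \<in> {v1, v2}" using w S4(2) SK(2) by (auto simp: V_def)
    have e: "S = (S \<inter> Q0) \<union> {w}" using w w2 S4(2) SK(2,3) unfolding V_def by auto
    have "card S = card ((S \<inter> Q0) \<union> {w})" using arg_cong[OF e, of card] .
    then have c3: "card (S \<inter> Q0) = 3" using S4(1) w(2) by simp
    show ?thesis by (rule bexI[OF _ w2]) (rule conjI[OF e c3])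
  qed
  have "card A \<le> card (base_faces K 3)"
  proof (rule card_inj_on_le[of "\<lambda>S. S \<inter> Q0"])
    show "inj_on (\<lambda>S. S \<inter> Q0) A"
    proof (rule inj_onI)
      fix S S' assume SS: "S \<in> A" "S' \<in> A" and eq: "S \<inter> Q0 = S' \<inter> Q0"
      obtain w where w: "w \<in> {v1, v2}" "S = (S \<inter> Q0) \<union> {w}" "card (S \<inter> Q0) = 3" using A[OF SS(1)] by blast
      obtain w' where w': "w' \<in> {v1, v2}" "S' = (S' \<inter> Q0) \<union> {w'}" using A[OF SS(2)] by blast
      have SK: "S \<in> K" "S' \<in> K" using SS by (simp_all add: A_def)
      have m1: "(S \<inter> Q0) \<union> {w} \<in> K" unfolding w(2)[symmetric] by (rule SK(1))
      have m2: "(S \<inter> Q0) \<union> {w'} \<in> K" unfolding eq w'(2)[symmetric] by (rule SK(2))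
      have "w = w'"
      proof (rule ccontr)
        assume "w \<noteq> w'"
        then have "(w = v1 \<and> w' = v2) \<or> (w = v2 \<and> w' = v1)" using w(1) w'(1) by blast
        then show False using cap_unique[OF K Int_lower2 w(3)] m1 m2 by blast
      qed
      then have "(S \<inter> Q0) \<union> {w} = (S' \<inter> Q0) \<union> {w'}" by (simp only: eq)
      then show "S = S'" unfolding w(2)[symmetric] w'(2)[symmetric] .
    qed
    show "(\<lambda>S. S \<inter> Q0) ` A \<subseteq> base_faces K 3"
    proof
      fix t assume "t \<in> (\<lambda>S. S \<inter> Q0) ` A"
      then obtain S where SA: "S \<in> A" "t = S \<inter> Q0" by blast
      have "card t = 3" using A[OF SA(1)] SA(2) by blast
      moreover have "is_face K t" using SA unfolding is_face_def A_def by blast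
      ultimately show "t \<in> base_faces K 3" using SA(2) by (simp add: base_faces_def)
    qed
  qed simp
  moreover have "card B \<le> card (link K)"
  proof (rule card_inj_on_le[of "\<lambda>S. S \<inter> Q0"])
    have e: "S = (S \<inter> Q0) \<union> {v1, v2}" if "S \<in> B" for S
      using that S unfolding B_def V_def by blast
    show "inj_on (\<lambda>S. S \<inter> Q0) B"
    proof (rule inj_onI)
      fix S S' assume SB: "S \<in> B" "S' \<in> B" and eq: "S \<inter> Q0 = S' \<inter> Q0"
      have "(S \<inter> Q0) \<union> {v1, v2} = (S' \<inter> Q0) \<union> {v1, v2}" by (simp only: eq)
      then show "S = S'" unfolding e[OF SB(1), symmetric] e[OF SB(2), symmetric] .
    qed
    show "(\<lambda>S. S \<inter> Q0) ` B \<subseteq> link K"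
    proof
      fix t assume "t \<in> (\<lambda>S. S \<inter> Q0) ` B"
      then obtain S where SB: "S \<in> B" "t = S \<inter> Q0" by blast
      have "card S = 4" "S \<in> K" using SB(1) S by (auto simp: B_def)
      moreover have "card S = card ((S \<inter> Q0) \<union> {v1, v2})" using arg_cong[OF e[OF SB(1)], of card] .
      then have "card S = card (S \<inter> Q0) + 2" using distinct_apices by simp
      moreover have "(S \<inter> Q0) \<union> {v1, v2} \<in> K" unfolding e[OF SB(1), symmetric] by fact
      ultimately show "t \<in> link K" unfolding link_def SB(2) by auto
    qed
  qed simp
  moreover have "{S \<in> K. S \<inter> {u1, u2} = {}} = A \<union> B" by (auto simp: A_def B_def)
  ultimately show ?thesis using card_Un_le[of A B] by simp
qed

text \<open>The nodes of \<open>S\<close> span its section by the plane, which is a triangle except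
  for \<open>{v1, v2, u1, u2}\<close>. There the section is a parallelogram, and three of its
  corners are chosen, whose union is still all of \<open>S\<close>.\<close>

lemma mixed_nodes:
  assumes S: "card S = 4" "S \<subseteq> V" "S \<inter> {v1, v2} \<noteq> {}" "S \<inter> {u1, u2} \<noteq> {}"
  shows "\<exists>N. N \<subseteq> nodes \<and> card N = 3 \<and> \<Union>N = S"
proof -
  note ds = distinct_apices
  define T where "T = S \<inter> Q0"
  have fin: "finite T" by (simp add: T_def)
  have TQ: "v1 \<notin> T" "v2 \<notin> T" "u1 \<notin> T" "u2 \<notin> T" using ds by (auto simp: T_def)
  have Se: "S = T \<union> (S \<inter> {v1, v2}) \<union> (S \<inter> {u1, u2})" using S(2) by (auto simp: T_def V_def)
  have nd: "{p} \<in> nodes" if "p \<in> T" for p using that by (auto simp: nodes_def T_def)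
  have cp: "{w, y} \<in> nodes" if "w \<in> {v1, v2}" "y \<in> {u1, u2}" for w y
    using that by (auto simp: nodes_def cross_pairs_def)
  have "S \<inter> {v1, v2} = {v1, v2} \<or> (\<exists>w\<in>{v1, v2}. S \<inter> {v1, v2} = {w})" using S(3) by blast
  moreover have "S \<inter> {u1, u2} = {u1, u2} \<or> (\<exists>y\<in>{u1, u2}. S \<inter> {u1, u2} = {y})" using S(4) by blast
  ultimately consider (a) "S = T \<union> {v1, v2} \<union> {u1, u2}"
    | (b) y where "y \<in> {u1, u2}" "S = T \<union> {v1, v2} \<union> {y}"
    | (c) w where "w \<in> {v1, v2}" "S = T \<union> {w} \<union> {u1, u2}"
    | (d) w y where "w \<in> {v1, v2}" "y \<in> {u1, u2}" "S = T \<union> {w} \<union> {y}"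
    using Se by metis
  then show ?thesis
  proof cases
    case a
    have "card S = card T + 4" unfolding a using fin TQ ds by simp
    then have "T = {}" using S(1) fin by simp
    then show ?thesis using a cp ds
      by (intro exI[of _ "{{v1, u1}, {v1, u2}, {v2, u2}}"]) (auto simp: doubleton_eq_iff)
  next
    case (b y)
    have "card S = card T + 3" unfolding b using fin TQ ds b(1) by auto
    then obtain p where p: "T = {p}" using S(1) card_1_singletonE[of T] by auto
    have "p \<noteq> v1" "p \<noteq> v2" using TQ p by auto
    then have "{p} \<noteq> {v1, y}" "{p} \<noteq> {v2, y}" "{v1, y} \<noteq> {v2, y}" using ds b(1) by (auto simp: doubleton_eq_iff)
    then have "card {{p}, {v1, y}, {v2, y}} = 3" by simp
    then show ?thesis using b p cp nd
      by (intro exI[of _ "{{p}, {v1, y}, {v2, y}}"]) auto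
  next
    case (c w)
    have "card S = card T + 3" unfolding c using fin TQ ds c(1) by auto
    then obtain p where p: "T = {p}" using S(1) card_1_singletonE[of T] by auto
    have "p \<noteq> u1" "p \<noteq> u2" using TQ p by auto
    then have "{p} \<noteq> {w, u1}" "{p} \<noteq> {w, u2}" "{w, u1} \<noteq> {w, u2}" using ds c(1) by (auto simp: doubleton_eq_iff)
    then have "card {{p}, {w, u1}, {w, u2}} = 3" by simp
    then show ?thesis using c p cp nd
      by (intro exI[of _ "{{p}, {w, u1}, {w, u2}}"]) auto
  next
    case (d w y)
    have "card S = card T + 2" unfolding d using fin TQ ds d(1,2) by auto
    then obtain p p' where p: "T = {p, p'}" "p \<noteq> p'" using S(1) by (auto simp: card_2_iff)
    have "p \<noteq> w" "p' \<noteq> w" using TQ p d(1) by auto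
    then have "{p} \<noteq> {p'}" "{p} \<noteq> {w, y}" "{p'} \<noteq> {w, y}" using p(2) by (auto simp: doubleton_eq_iff)
    then have "card {{p}, {p'}, {w, y}} = 3" by simp
    then show ?thesis using d p cp nd
      by (intro exI[of _ "{{p}, {p'}, {w, y}}"]) auto
  qed
qed

lemma xp_avoids:
  assumes K: "face_to_face K" and vu: "v \<in> {v1, v2}" "u \<in> {u1, u2}" "is_face K {v, u}"
  shows "avoids K (xp v u)"
  unfolding avoids_def
proof (intro conjI allI impI notI)
  show "xp v u \<in> convex hull Q0" by (rule xp_hull[OF vu(1,2)])
  fix A assume A: "A \<subseteq> Q0" "is_face K A" "xp v u \<in> convex hull A"
  have "{v, u} \<subseteq> A" by (rule is_face_strict[OF K vu(3) A(2) xp_strict_hull A(3)])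
  then show False using A(1) vu(1) distinct_apices by auto
qed

text \<open>\<open>v1\<close> and \<open>v2\<close> agree in \<open>Y\<close>, hence so do
  \<open>xp v1 u1\<close> and \<open>xp v2 u1\<close>. At equal \<open>Y\<close> the value of
  \<open>orient\<close> along the separating chord is proportional to the difference in
  \<open>X\<close> from the point \<open>y\<close> on it, so the two signs differ.\<close>

lemma separates_triangles_le:
  assumes K: "face_to_face K" and f: "is_face K {v1, u1}" "is_face K {v2, u1}" and sep: "separates K"
  shows "card (base_faces K 3) + 4 \<le> m"
proof -
  obtain T1 T2 where T: "{v1, u1} \<subseteq> T1" "T1 \<in> K" "{v2, u1} \<subseteq> T2" "T2 \<in> K" using f unfolding is_face_def by blast
  have "Y (xp v1 u1) = Y (xp v2 u1)" unfolding xp_def affine_fun_segment[OF affine_fun_coord] using v by simp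
  then obtain e y where e: "e \<in> link K" "y \<in> convex hull e" "Y y = Y (xp v1 u1)"
      "(X (xp v1 u1) - X y) * (X (xp v2 u1) - X y) < 0"
    using sep T u(4) xp_strict_hull xp_hull unfolding separates_def by (meson insertI1 insertI2 singletonI)
  have eb: "e \<in> base_faces K 2" using e(1) link_base_faces by blast
  obtain p p' where p: "e = {p, p'}" "p \<noteq> p'" using e(1) by (auto simp: link_def card_2_iff)
  have pQ: "p \<in> Q0" "p' \<in> Q0" using e(1) p by (auto simp: link_def)
  have Yne: "Y p' - Y p \<noteq> 0" using generic[OF pQ p(2)] by auto
  have oy: "orient p p' y = 0"
    by (rule affine_fun_hull_eq[OF affine_orient _ e(2)]) (use p in auto)
  have o: "orient p p' x = - (Y p' - Y p) * (X x - X y)" if "Y x = Y y" for x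
  proof -
    have "orient p p' x - orient p p' y = - (Y p' - Y p) * (X x - X y)"
      unfolding orient_def using that by (simp add: algebra_simps)
    then show ?thesis using oy by simp
  qed
  define k A B where "k = Y p' - Y p" and "A = X (xp v1 u1) - X y" and "B = X (xp v2 u1) - X y"
  have "orient p p' (xp v1 u1) = - k * A" "orient p p' (xp v2 u1) = - k * B"
    unfolding k_def A_def B_def by (rule o, simp add: e(3) \<open>Y (xp v1 u1) = Y (xp v2 u1)\<close>)+
  then have "orient p p' (xp v1 u1) * orient p p' (xp v2 u1) = k\<^sup>2 * (A * B)"
    by (simp add: power2_eq_square)
  also have "\<dots> < 0"
    by (rule mult_pos_neg) (use e(4) Yne in \<open>simp_all add: k_def A_def B_def\<close>)
  finally show ?thesis
    using triangles_separated_le[OF K xp_avoids[OF K _ _ f(1)] xp_avoids[OF K _ _ f(2)] eb p(1)] by simp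
qed

text \<open>The chords of the links with weight 1 are steps of one of the two zigzag paths. No chord is a
  step of both, and at most two sides of the polygon are steps of each, so there are at most
  \<open>m - 3 + 4\<close> such chords. With \<open>k = 4\<close> edges \<open>{v, u}\<close> this is not yet enough: if the link of
  \<open>v1 v2\<close> (or of \<open>u1 u2\<close>) spans all gaps, one of its chords separates two of the points \<open>xp v u\<close>, which
  costs another triangle of the polygon.\<close>

lemma triangulation_card_le:
  assumes K: "face_to_face K" and S: "\<And>S. S \<in> K \<Longrightarrow> card S = 4 \<and> S \<subseteq> V"
  shows "2 * card K \<le> 7 * m + 2"
proof -
  interpret sw: Pm ey ex "- ez" c r "pi / 2 - \<theta>" m Q0 u1 u2 v1 v2 by (rule swap)
  define T where "T = base_faces K 3"
  define Kx where "Kx = {S \<in> K. S \<inter> {v1, v2} \<noteq> {} \<and> S \<inter> {u1, u2} \<noteq> {}}"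
  have fK: "finite K" using S by (intro finite_subset[of K "Pow V"]) auto
  have up: "card {S \<in> K. S \<inter> {u1, u2} = {}} \<le> card T + card (link K)"
    unfolding T_def by (rule caps_le[OF K S])
  have down: "card {S \<in> K. S \<inter> {v1, v2} = {}} \<le> card T + card (sw.link K)"
    unfolding T_def using sw.caps_le[OF K] S V_swap by simp
  have "{S \<in> K. S \<inter> {u1, u2} = {}} \<union> ({S \<in> K. S \<inter> {v1, v2} = {}} \<union> Kx) = K" by (auto simp: Kx_def)
  then have "card K \<le> card {S \<in> K. S \<inter> {u1, u2} = {}} + card ({S \<in> K. S \<inter> {v1, v2} = {}} \<union> Kx)"
    using card_Un_le[of "{S \<in> K. S \<inter> {u1, u2} = {}}" "{S \<in> K. S \<inter> {v1, v2} = {}} \<union> Kx"] by simp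
  also have "card ({S \<in> K. S \<inter> {v1, v2} = {}} \<union> Kx) \<le> card {S \<in> K. S \<inter> {v1, v2} = {}} + card Kx"
    by (rule card_Un_le)
  finally have cK: "card K \<le> 2 * card T + card Kx + card (link K) + card (sw.link K)" using up down by simp
  define k where "k = card {\<sigma> \<in> cross_pairs. is_face K \<sigma>}"
  \<comment> \<open>Base triangles and mixed tetrahedra both appear as pieces of the section, so one
    sweep bounds them together. Of the two copies of \<open>card T\<close> in \<open>cK\<close> one
    is absorbed here.\<close>
  have pieces: "card (T \<union> Kx) + 2 \<le> m + 2 * k"
    unfolding k_def
  proof (rule pieces_le[OF K])
    fix A assume "A \<in> T \<union> Kx"
    then show "is_face K A \<and> (\<exists>N. N \<subseteq> nodes \<and> card N = 3 \<and> \<Union>N = A)"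
    proof
      assume A: "A \<in> T"
      then have "card A = 3" "A \<subseteq> Q0" "is_face K A" by (auto simp: T_def base_faces_def)
      moreover have "(\<lambda>p. {p}) ` A \<subseteq> nodes" using \<open>A \<subseteq> Q0\<close> by (auto simp: nodes_def)
      moreover have "card ((\<lambda>p. {p}) ` A) = card A" by (rule card_image) simp
      ultimately show ?thesis by (intro conjI exI[of _ "(\<lambda>p. {p}) ` A"]) auto
    next
      assume A: "A \<in> Kx"
      then have "A \<in> K" "A \<inter> {v1, v2} \<noteq> {}" "A \<inter> {u1, u2} \<noteq> {}" by (auto simp: Kx_def)
      then show ?thesis using mixed_nodes[of A] S[of A] by (auto simp: is_face_def)
    qed
  qed
  have "T \<inter> Kx = {}" using distinct_apices by (auto simp: T_def Kx_def base_faces_def)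
  then have "card (T \<union> Kx) = card T + card Kx"
    using fK by (intro card_Un_disjoint) (auto simp: T_def Kx_def)
  then have TX: "card T + card Kx + 2 \<le> m + 2 * k" using pieces by simp
  obtain wt :: "space set \<Rightarrow> nat" where
      wt0: "\<forall>e\<in>link K. 1 \<le> wt e \<and> (wt e = 1 \<longrightarrow> (\<exists>p p'. e = {p, p'} \<and> 0 < Y p * Y p' - X p * X p'))"
      and wt: "sum wt (link K) \<le> m - 1" "card {e \<in> link K. wt e = 1 \<and> side e} \<le> 2"
        "sum wt (link K) \<le> m - 2 \<or> separates K"
    using link_weights[OF K] by (elim exE conjE) (rule that)
  obtain wt' :: "space set \<Rightarrow> nat" where
      wt0': "\<forall>e\<in>sw.link K. 1 \<le> wt' e \<and> (wt' e = 1 \<longrightarrow> (\<exists>p p'. e = {p, p'} \<and> 0 < X p * X p' - Y p * Y p'))"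
      and wt': "sum wt' (sw.link K) \<le> m - 1" "card {e \<in> sw.link K. wt' e = 1 \<and> sw.side e} \<le> 2"
        "sum wt' (sw.link K) \<le> m - 2 \<or> sw.separates K"
    using sw.link_weights[OF K] by (elim exE conjE) (rule that)
  have side: "sw.side e = side e" for e by (simp add: side_def sw.side_def add.commute)
  define A1 where "A1 = {e \<in> link K. wt e = 1}"
  define B1 where "B1 = {e \<in> sw.link K. wt' e = 1}"
  have fin: "finite A1" "finite B1" by (simp_all add: A1_def B1_def)
  \<comment> \<open>Steps of the two paths give the expression from \<open>consecutive_pos\<close>
    opposite signs.\<close>
  have "A1 \<inter> B1 = {}"
  proof (rule equals0I)
    fix e assume e: "e \<in> A1 \<inter> B1"
    obtain p p' where p: "e = {p, p'}" "0 < Y p * Y p' - X p * X p'" using e wt0 unfolding A1_def by blast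
    obtain s s' where s: "e = {s, s'}" "0 < X s * X s' - Y s * Y s'" using e wt0' unfolding B1_def by blast
    have "(p = s \<and> p' = s') \<or> (p = s' \<and> p' = s)" using p(1) s(1) by (auto simp: doubleton_eq_iff)
    then show False using p(2) s(2) by (auto simp: mult.commute)
  qed
  then have AB: "card A1 + card B1 = card (A1 \<union> B1)" using fin by (simp add: card_Un_disjoint)
  have sub: "A1 \<union> B1 \<subseteq> {e \<in> base_faces K 2. \<not> side e} \<union> ({e \<in> link K. wt e = 1 \<and> side e} \<union> {e \<in> sw.link K. wt' e = 1 \<and> sw.side e})"
    using link_base_faces[of K] sw.link_base_faces[of K] unfolding A1_def B1_def side by blast
  have "card (A1 \<union> B1) \<le> card ({e \<in> base_faces K 2. \<not> side e} \<union> ({e \<in> link K. wt e = 1 \<and> side e} \<union> {e \<in> sw.link K. wt' e = 1 \<and> sw.side e}))"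
    by (rule card_mono[OF _ sub]) simp
  also have "\<dots> \<le> card {e \<in> base_faces K 2. \<not> side e} + card ({e \<in> link K. wt e = 1 \<and> side e} \<union> {e \<in> sw.link K. wt' e = 1 \<and> sw.side e})"
    by (rule card_Un_le)
  also have "card ({e \<in> link K. wt e = 1 \<and> side e} \<union> {e \<in> sw.link K. wt' e = 1 \<and> sw.side e}) \<le> 4"
    using card_Un_le[of "{e \<in> link K. wt e = 1 \<and> side e}" "{e \<in> sw.link K. wt' e = 1 \<and> sw.side e}"] wt(2) wt'(2) by simp
  \<comment> \<open>At most \<open>m - 3\<close> diagonals, and two sides from each path.\<close>
  finally have D: "card A1 + card B1 + 3 \<le> m + 4" using diagonals_le[OF K] AB by simp
  have two: "2 * card (link K) \<le> sum wt (link K) + card A1" "2 * card (sw.link K) \<le> sum wt' (sw.link K) + card B1"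
    unfolding A1_def B1_def using wt0 wt0' by (intro twice_card_le_sum; simp)+
  have k4: "k \<le> 4"
  proof -
    have "k \<le> card cross_pairs" unfolding k_def by (intro card_mono) auto
    also have "\<dots> \<le> 4" unfolding cross_pairs_def by (simp add: card_insert_if)
    finally show ?thesis .
  qed
  have T0: "card T + 2 \<le> m" unfolding T_def by (rule triangles_le[OF K])
  have T1: "card T + 3 \<le> m" if k1: "1 \<le> k"
  proof -
    have "{\<sigma> \<in> cross_pairs. is_face K \<sigma>} \<noteq> {}" using k1 unfolding k_def by (metis card.empty not_one_le_zero)
    then obtain \<sigma> where \<sigma>: "\<sigma> \<in> cross_pairs" "is_face K \<sigma>" by blast
    obtain w y where wy: "w \<in> {v1, v2}" "y \<in> {u1, u2}" "\<sigma> = {w, y}" by (rule cross_pairs_cases[OF \<sigma>(1)])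
    show ?thesis unfolding T_def using triangles_avoiding_le[OF K xp_avoids[OF K wy(1,2)]] \<sigma>(2) wy(3) by simp
  qed
  have T4: "card T + 4 \<le> m \<or> (sum wt (link K) \<le> m - 2 \<and> sum wt' (sw.link K) \<le> m - 2)" if k4: "k = 4"
  proof -
    have "card cross_pairs \<le> 4" unfolding cross_pairs_def by (simp add: card_insert_if)
    then have "{\<sigma> \<in> cross_pairs. is_face K \<sigma>} = cross_pairs"
      using k4 unfolding k_def by (intro card_seteq) auto
    then have f: "is_face K {v1, u1}" "is_face K {v1, u2}" "is_face K {v2, u1}" "is_face K {v2, u2}"
      unfolding cross_pairs_def by auto
    have "card T + 4 \<le> m" if "separates K"
      unfolding T_def by (rule separates_triangles_le[OF K f(1,3) that])
    moreover have "card T + 4 \<le> m" if "sw.separates K"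
      unfolding T_def using sw.separates_triangles_le[OF K _ _ that] f by (simp add: insert_commute)
    ultimately show ?thesis using wt(3) wt'(3) by blast
  qed
  have m2: "m = 2 * (m div 2)" using m by simp
  have k_cases: "k = 0 \<or> (1 \<le> k \<and> k \<le> 3) \<or> k = 4" using k4 by linarith
  \<comment> \<open>The three cases allow at most \<open>7 * m - 9\<close>, \<open>7 * m + 1\<close>
    and \<open>7 * m + 3\<close>; for \<open>k = 4\<close> both alternatives of \<open>T4\<close>
    give the last value.\<close>
  have "2 * card K \<le> 7 * m + 3"
    using k_cases
  proof (elim disjE)
    assume "k = 0"
    then show ?thesis using cK TX two D wt(1) wt'(1) T0 m by linarith
  next
    assume "1 \<le> k \<and> k \<le> 3"
    then show ?thesis using cK TX two D wt(1) wt'(1) T1 m by linarith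
  next
    assume k: "k = 4"
    then show ?thesis using cK TX two D wt(1) wt'(1) T1 T4[OF k] m by linarith
  qed
  \<comment> \<open>\<open>7 * m + 3\<close> is odd because \<open>m\<close> is even, so twice the
    size is at most \<open>7 * m + 2\<close>.\<close>
  then show ?thesis using m2 by presburger
qed

lemma max_triangulation_le: "2 * max_triangulation_size P \<le> 7 * m + 2"
proof -
  obtain D where D: "triangulation_of P D" "card D = max_triangulation_size P"
    using max_triangulation_attained by blast
  have s: "3 simplex T" "vertices T \<subseteq> V" if "T \<in> D" for T
    using D(1) that vertices_P by (auto simp: triangulation_of_def dissection_def)
  have inj: "inj_on vertices D"
    using simplex_vertices(4)[OF s(1)] by (intro inj_onI) metis
  have "2 * card (vertices ` D) \<le> 7 * m + 2"
    using s simplex_vertices(3)[OF s(1)] by (intro triangulation_card_le triangulation_face_to_face[OF D(1)]) auto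
  then show ?thesis using card_image[OF inj] D(2) by simp
qed

end

subsection \<open>Choosing coordinates\<close>

lemma (in frame) circle_vertices:
  assumes A: "finite A" "\<And>p. p \<in> A \<Longrightarrow> Z p = 0 \<and> (C p)\<^sup>2 + (S p)\<^sup>2 = \<rho>"
  shows "vertices (convex hull A) = A"
proof -
  have "a \<notin> convex hull (A - {a})" if a: "a \<in> A" for a
  proof (rule not_in_hull[of "\<lambda>x. C a * C x + S a * S x"])
    show "affine_fun (\<lambda>x. C a * C x + S a * S x)" by (rule affine_fun_linear_comb) simp_all
    fix x assume x: "x \<in> A - {a}"
    then have "C a \<noteq> C x \<or> S a \<noteq> S x" using coords_eqI[of a x] A(2) a by auto
    then have "0 < (C a - C x)\<^sup>2 + (S a - S x)\<^sup>2" by (simp add: sum_power2_gt_zero_iff)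
    also have "\<dots> = 2 * (C a * C a + S a * S a) - 2 * (C a * C x + S a * S x)"
      using A(2)[OF a] A(2)[of x] x by (simp add: power2_eq_square algebra_simps)
    finally show "C a * C x + S a * S x < C a * C a + S a * S a" by simp
  qed
  then have "x extreme_point_of (convex hull A) \<longleftrightarrow> x \<in> A" for x
    using A(1) by (intro extreme_point_of_convex_hull_convex_independent) (auto simp: finite_imp_compact)
  then show ?thesis by (auto simp: vertices_def)
qed

lemma circle_pt_rotate:
  assumes "e = cos \<phi> *\<^sub>R ex - sin \<phi> *\<^sub>R ey" "f = sin \<phi> *\<^sub>R ex + cos \<phi> *\<^sub>R ey"
  shows "circle_pt c e f r a = circle_pt c ex ey r (a - \<phi>)"
  unfolding circle_pt_def assms cos_diff sin_diff by (simp add: algebra_simps)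

text \<open>As \<open>m\<close> is even, vertices \<open>0\<close> and \<open>m div 2\<close> are
  antipodal; they determine the values at \<open>c\<close> and \<open>e\<close>, and the vertex
  \<open>1\<close> then determines the value at \<open>f\<close>.\<close>

lemma circle_pt_plane:
  assumes "0 < r" "4 \<le> m" "even (m::nat)" and on: "\<And>k. k < m \<Longrightarrow> n \<bullet> circle_pt c e f r (2 * pi * real k / m) = b"
  shows "n \<bullet> c = b" "n \<bullet> e = 0" "n \<bullet> f = 0"
proof -
  have m0: "real m \<noteq> 0" using assms by simp
  have i: "n \<bullet> circle_pt c e f r a = n \<bullet> c + r * (cos a * (n \<bullet> e) + sin a * (n \<bullet> f))" for a
    by (simp add: circle_pt_def inner_add_right algebra_simps)
  have 0: "n \<bullet> c + r * (n \<bullet> e) = b" using on[of 0] assms(2) unfolding i by simp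
  have "2 * pi * real (m div 2) / m = pi" using assms(3) m0 by (simp add: real_of_nat_div)
  then have pi: "n \<bullet> c - r * (n \<bullet> e) = b" using on[of "m div 2"] assms(2) unfolding i by simp
  show c: "n \<bullet> c = b" using 0 pi by simp
  have "r * (n \<bullet> e) = 0" using 0 pi by linarith
  then show e: "n \<bullet> e = 0" using assms(1) by simp
  have "0 < 2 * pi / m" "2 * pi / m < pi" using assms(2) by (auto simp: field_simps)
  then have "0 < sin (2 * pi / m)" by (rule sin_gt_zero)
  moreover have "r * (sin (2 * pi / m) * (n \<bullet> f)) = 0" using on[of 1] assms(2) c e unfolding i by simp
  ultimately show "n \<bullet> f = 0" using assms(1) by simp
qed

text \<open>\<open>ez\<close> is the unit normal of the plane, \<open>ex\<close> the direction of
  \<open>v1 v2\<close>, and \<open>ey\<close> completes the frame. Rotating the polygon into it only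
  changes the starting angle. \<open>u2 - u1\<close> is orthogonal to \<open>ex\<close> and
  \<open>ez\<close>, hence along \<open>ey\<close>; if it points backwards, \<open>u1\<close> and
  \<open>u2\<close> exchange names.\<close>

lemma construction_Pm:
  assumes m: "4 \<le> m" "even m" and reg: "regular_polygon m Q" and con: "Pm_construction m Q P"
  obtains ex ey ez c r \<theta> Q0 v1 v2 u1 u2 where "Pm ex ey ez c r \<theta> m Q0 v1 v2 u1 u2"
    "P = convex hull (Q0 \<union> {v1, v2, u1, u2})"
proof -
  obtain c e f r where ef: "norm e = 1" "norm f = 1" "e \<bullet> f = 0" and r: "0 < r"
    and Q: "Q = convex hull ((\<lambda>k. c + r *\<^sub>R (cos (2 * pi * real k / m) *\<^sub>R e + sin (2 * pi * real k / m) *\<^sub>R f)) ` {..<m})"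
    using reg unfolding regular_polygon_def orthogonal_def by blast
  define Q0 where "Q0 = (\<lambda>k. circle_pt c e f r (0 + 2 * pi * real k / m)) ` {..<m}"
  have QQ: "Q = convex hull Q0"
    unfolding Q Q0_def circle_pt_def by (simp add: scaleR_add_right add.assoc)
  obtain v1 v2 u1 u2 n b where vu: "v1 \<noteq> v2" "u1 \<noteq> u2" "n \<noteq> 0" "affine hull Q = {x. n \<bullet> x = b}"
      "n \<bullet> v1 = n \<bullet> v2" "n \<bullet> u1 = n \<bullet> u2" "(v2 - v1) \<bullet> (u2 - u1) = 0" "b < n \<bullet> v1" "n \<bullet> u1 < b"
      and crs: "\<And>v u. v \<in> {v1, v2} \<Longrightarrow> u \<in> {u1, u2} \<Longrightarrow> closed_segment v u \<inter> rel_interior Q \<noteq> {}"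
      and par: "\<And>p q. p \<in> vertices Q \<Longrightarrow> q \<in> vertices Q \<Longrightarrow> p \<noteq> q
        \<Longrightarrow> \<not> parallel (v2 - v1) (q - p) \<and> \<not> parallel (u2 - u1) (q - p)"
      and P: "P = convex hull (Q \<union> {v1, v2, u1, u2})"
    using con unfolding Pm_construction_def orthogonal_def by blast
  have PP: "P = convex hull (Q0 \<union> {v1, v2, u1, u2})"
    unfolding P QQ by (rule hull_Un_left[symmetric])
  have "Q0 \<subseteq> affine hull Q"
    unfolding QQ affine_hull_convex_hull by (rule hull_subset)
  then have "n \<bullet> circle_pt c e f r (2 * pi * real k / m) = b" if "k < m" for k
    using that vu(4) unfolding Q0_def by auto
  note nn = circle_pt_plane[OF r m this]
  define ez where "ez = (1 / norm n) *\<^sub>R n"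
  have ez: "norm ez = 1" "e \<bullet> ez = 0" "f \<bullet> ez = 0" using vu(3) nn by (simp_all add: ez_def inner_commute)
  define ex where "ex = (1 / norm (v2 - v1)) *\<^sub>R (v2 - v1)"
  have ex: "norm ex = 1" "ex \<bullet> ez = 0" "v2 - v1 = norm (v2 - v1) *\<^sub>R ex"
    using vu(1,5) by (simp_all add: ex_def ez_def inner_diff_left inner_diff_right inner_commute[of _ n])
  have exE: "ex = (ex \<bullet> e) *\<^sub>R e + (ex \<bullet> f) *\<^sub>R f"
    using orthonormal_expand[OF ef(1,2) ez(1) ef(3) ez(2,3), of ex] ex(2) by simp
  have "ex \<bullet> ex = (ex \<bullet> e) * (ex \<bullet> e) + (ex \<bullet> f) * (ex \<bullet> f)"
    using arg_cong[OF exE, of "\<lambda>x. ex \<bullet> x"] by (simp only: inner_add_right inner_scaleR_right)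
  moreover have "ex \<bullet> ex = 1" using ex(1) by (simp add: norm_eq_1)
  ultimately have "(ex \<bullet> e)\<^sup>2 + (ex \<bullet> f)\<^sup>2 = 1" by (simp add: power2_eq_square)
  then obtain \<phi> where \<phi>: "ex \<bullet> e = cos \<phi>" "ex \<bullet> f = sin \<phi>" by (rule sincos_total_2pi)
  have exE: "ex = cos \<phi> *\<^sub>R e + sin \<phi> *\<^sub>R f" using exE unfolding \<phi> .
  define ey where "ey = cos \<phi> *\<^sub>R f - sin \<phi> *\<^sub>R e"
  have ef1: "e \<bullet> e = 1" "f \<bullet> f = 1" "f \<bullet> e = 0" using ef by (simp_all add: norm_eq_1 inner_commute)
  have "ey \<bullet> ey = (cos \<phi>)\<^sup>2 + (sin \<phi>)\<^sup>2"
    unfolding ey_def by (simp add: inner_diff_left inner_diff_right ef1 ef(3) power2_eq_square)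
  then have ey: "norm ey = 1" by (simp add: norm_eq_1)
  have exy: "ex \<bullet> ey = 0"
    unfolding exE ey_def by (simp add: inner_diff_right inner_add_left ef1 ef(3))
  have eyz: "ey \<bullet> ez = 0" unfolding ey_def by (simp add: inner_diff_left ez)
  have cs: "cos \<phi> * cos \<phi> + sin \<phi> * sin \<phi> = 1" using sin_cos_squared_add3[of \<phi>] by simp
  have eE: "e = cos \<phi> *\<^sub>R ex - sin \<phi> *\<^sub>R ey"
  proof -
    have "cos \<phi> *\<^sub>R ex - sin \<phi> *\<^sub>R ey = (cos \<phi> * cos \<phi> + sin \<phi> * sin \<phi>) *\<^sub>R e"
      unfolding exE ey_def scaleR_left_distrib
      by (simp add: scaleR_add_right scaleR_diff_right mult.commute)
    then show ?thesis unfolding cs by simp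
  qed
  have fE: "f = sin \<phi> *\<^sub>R ex + cos \<phi> *\<^sub>R ey"
  proof -
    have "sin \<phi> *\<^sub>R ex + cos \<phi> *\<^sub>R ey = (cos \<phi> * cos \<phi> + sin \<phi> * sin \<phi>) *\<^sub>R f"
      unfolding exE ey_def scaleR_left_distrib
      by (simp add: scaleR_add_right scaleR_diff_right mult.commute)
    then show ?thesis unfolding cs by simp
  qed
  have on: "norm ex = 1" "norm ey = 1" "norm ez = 1" "ex \<bullet> ey = 0" "ex \<bullet> ez = 0" "ey \<bullet> ez = 0"
    using ex ey ez exy eyz by auto
  interpret fr: frame ex ey ez c by unfold_locales (rule on)+
  have Q0r: "Q0 = range (\<lambda>k::int. circle_pt c ex ey r (- \<phi> + 2 * pi * of_int k / m))"
  proof -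
    have "Q0 = (\<lambda>k. circle_pt c ex ey r (- \<phi> + 2 * pi * real k / m)) ` {..<m}"
      unfolding Q0_def circle_pt_rotate[OF eE fE] by simp
    also have "\<dots> = range (\<lambda>k::int. circle_pt c ex ey r (- \<phi> + 2 * pi * of_int k / m))"
      using m by (intro circle_pt_image) simp
    finally show ?thesis .
  qed
  have cp: "coord c ez p = 0 \<and> (coord c ex p)\<^sup>2 + (coord c ey p)\<^sup>2 = r\<^sup>2" if "p \<in> Q0" for p
    using that unfolding Q0r by (auto simp: power_mult_distrib simp flip: distrib_left)
  have "finite Q0" by (simp add: Q0_def)
  then have vQ: "vertices Q = Q0" unfolding QQ using cp by (rule fr.circle_vertices)
  have dif: "coord c g x - coord c g y = (x - y) \<bullet> g" for g x y by (simp add: coord_def inner_diff_left)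
  have cx: "coord c ex v2 - coord c ex v1 = norm (v2 - v1)" "coord c ey v2 - coord c ey v1 = 0"
    unfolding dif using ex(3) on by (metis inner_scaleR_left mult.right_neutral norm_eq_1, metis inner_scaleR_left mult_zero_right)
  have cxu: "coord c ex u2 - coord c ex u1 = 0"
    unfolding dif ex_def using vu(7) by (simp add: inner_commute)
  have cz: "coord c ez x = (n \<bullet> x - b) / norm n" for x
    unfolding coord_def ez_def using nn(1) by (simp add: inner_diff_right inner_commute[of _ n])
  have cyu: "coord c ey u2 \<noteq> coord c ey u1"
  proof
    assume "coord c ey u2 = coord c ey u1"
    then have "u2 = u1" using cxu vu(6) by (intro fr.coords_eqI) (auto simp: cz)
    then show False using vu(2) by simp
  qed
  have crdt: "coord c g (x + k *\<^sub>R (y - z)) = coord c g x + k * (coord c g y - coord c g z)" for g x y z k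
    by (simp add: coord_def inner_diff_left inner_add_left algebra_simps)
  have gen: "coord c ex p \<noteq> coord c ex q \<and> coord c ey p \<noteq> coord c ey q" if pq: "p \<in> Q0" "q \<in> Q0" "p \<noteq> q" for p q
  proof
    \<comment> \<open>Vertices with equal \<open>X\<close> would differ by a multiple of
      \<open>u2 - u1\<close>, against the hypothesis on parallels; similarly for \<open>Y\<close>
      and \<open>v2 - v1\<close>.\<close>
    show "coord c ex p \<noteq> coord c ex q"
    proof
      assume eq: "coord c ex p = coord c ex q"
      define k where "k = (coord c ey q - coord c ey p) / (coord c ey u2 - coord c ey u1)"
      have "q = p + k *\<^sub>R (u2 - u1)"
        by (rule fr.coords_eqI; unfold crdt) (use eq cxu cp pq cyu vu(6) in \<open>auto simp: k_def cz\<close>)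
      then have "q - p = k *\<^sub>R (u2 - u1)" by simp
      moreover have "k \<noteq> 0" using calculation pq(3) by auto
      ultimately have "parallel (u2 - u1) (q - p)" unfolding parallel_def by blast
      then show False using par[of p q] pq vQ by simp
    qed
    show "coord c ey p \<noteq> coord c ey q"
    proof
      assume eq: "coord c ey p = coord c ey q"
      define k where "k = (coord c ex q - coord c ex p) / (coord c ex v2 - coord c ex v1)"
      have "coord c ex v2 - coord c ex v1 \<noteq> 0" using cx(1) vu(1) by simp
      then have "q = p + k *\<^sub>R (v2 - v1)"
        by (intro fr.coords_eqI; unfold crdt) (use eq cx(2) cp pq vu(5) in \<open>auto simp: k_def cz\<close>)
      then have "q - p = k *\<^sub>R (v2 - v1)" by simp
      moreover have "k \<noteq> 0" using calculation pq(3) by auto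
      ultimately have "parallel (v2 - v1) (q - p)" unfolding parallel_def by blast
      then show False using par[of p q] pq vQ by simp
    qed
  qed
  have "0 < norm (v2 - v1)" using vu(1) by simp
  then have "coord c ex v1 < coord c ex v2" using cx(1) by linarith
  then have vv: "coord c ey v1 = coord c ey v2" "coord c ex v1 < coord c ex v2" "coord c ez v1 = coord c ez v2" "0 < coord c ez v1"
    using cx vu(1,3,5,8) by (auto simp: cz)
  have uu: "coord c ex u1 = coord c ex u2" "coord c ez u1 = coord c ez u2" "coord c ez u1 < 0"
    using cxu vu(3,6,9) by (auto simp: cz divide_neg_pos)
  have crs0: "closed_segment v u \<inter> rel_interior (convex hull Q0) \<noteq> {}" if "v \<in> {v1, v2}" "u \<in> {u1, u2}" for v u
    using crs[OF that] unfolding QQ .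
  show ?thesis
  proof (cases "coord c ey u1 < coord c ey u2")
    case True
    have "Pm ex ey ez c r (- \<phi>) m Q0 v1 v2 u1 u2"
      by unfold_locales (fact on r m Q0r vv uu True | rule gen crs0; assumption)+
    then show ?thesis using that PP by blast
  next
    case False
    then have lt: "coord c ey u2 < coord c ey u1" using cyu by simp
    have "Pm ex ey ez c r (- \<phi>) m Q0 v1 v2 u2 u1"
    proof
      show "coord c ez u2 < 0" using uu by simp
      show "closed_segment v u \<inter> rel_interior (convex hull Q0) \<noteq> {}" if "v \<in> {v1, v2}" "u \<in> {u2, u1}" for v u
        using crs0 that by blast
    qed (use on r m Q0r vv uu lt gen in auto)
    moreover have "P = convex hull (Q0 \<union> {v1, v2, u2, u1})" using PP by (simp add: insert_commute)
    ultimately show ?thesis using that by blast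
  qed
qed

lemma Pm_bounds:
  assumes "4 \<le> m" "even m" "regular_polygon m Q" "Pm_construction m Q P"
  shows "simplicial_3polytope P" "card (vertices P) = m + 4"
    "4 * real m - 6 \<le> real (max_dissection_size P)"
    "real (max_triangulation_size P) \<le> 7 * real m / 2 + 1"
proof -
  obtain ex ey ez c r \<theta> Q0 v1 v2 u1 u2 where p: "Pm ex ey ez c r \<theta> m Q0 v1 v2 u1 u2"
    and P: "P = convex hull (Q0 \<union> {v1, v2, u1, u2})"
    using construction_Pm[OF assms] by blast
  interpret Pm ex ey ez c r \<theta> m Q0 v1 v2 u1 u2 by (rule p)
  have PP: "P = Pm.P Q0 v1 v2 u1 u2" unfolding P P_def V_def ..
  show "simplicial_3polytope P" unfolding PP by (rule simplicial_P)
  show "card (vertices P) = m + 4" unfolding PP vertices_P by (rule card_V)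
  have "real (4 * m - 6) \<le> real (max_dissection_size P)" unfolding PP using max_dissection_ge by (simp only: of_nat_le_iff)
  then show "4 * real m - 6 \<le> real (max_dissection_size P)" using assms(1) by (simp add: of_nat_diff)
  have "real (2 * max_triangulation_size P) \<le> real (7 * m + 2)" unfolding PP using max_triangulation_le by (simp only: of_nat_le_iff)
  then show "real (max_triangulation_size P) \<le> 7 * real m / 2 + 1" by simp
qed

theorem corollary2p2:
  shows "(\<forall>(m::nat) Q P. m \<ge> 4 \<and> even m \<and> regular_polygon m Q \<and> Pm_construction m Q P \<longrightarrow>
            (simplicial_3polytope P \<and> card (vertices P) = m + 4) \<and>
            real (max_dissection_size P) \<ge> 4 * real m - 6 \<and>
            real (max_triangulation_size P) \<le> 7 * real m / 2 + 1) \<and>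
         (\<exists>c>0. \<exists>N. \<forall>m\<ge>N. \<forall>Q P.
            m \<ge> 4 \<and> even m \<and> regular_polygon m Q \<and> Pm_construction m Q P \<longrightarrow>
            real (max_dissection_size P) - real (max_triangulation_size P)
              \<ge> c * real (card (vertices P)))"
proof
  show "\<forall>(m::nat) Q P. m \<ge> 4 \<and> even m \<and> regular_polygon m Q \<and> Pm_construction m Q P \<longrightarrow>
            (simplicial_3polytope P \<and> card (vertices P) = m + 4) \<and>
            real (max_dissection_size P) \<ge> 4 * real m - 6 \<and>
            real (max_triangulation_size P) \<le> 7 * real m / 2 + 1"
    using Pm_bounds by blast
  \<comment> \<open>The gap is at least \<open>m / 2 - 7\<close>, and this reaches a quarter of the
    \<open>m + 4\<close> vertices from \<open>m = 32\<close> on.\<close>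
  have "real (max_dissection_size P) - real (max_triangulation_size P) \<ge> 1 / 4 * real (card (vertices P))"
    if "m \<ge> 32" "m \<ge> 4 \<and> even m \<and> regular_polygon m Q \<and> Pm_construction m Q P" for m :: nat and Q P
  proof -
    have a: "4 \<le> m" "even m" "regular_polygon m Q" "Pm_construction m Q P" using that by auto
    show ?thesis
      using Pm_bounds(3,4)[OF a] \<open>m \<ge> 32\<close> unfolding Pm_bounds(2)[OF a] by simp
  qed
  then show "\<exists>c>0. \<exists>N. \<forall>m\<ge>N. \<forall>Q P.
            m \<ge> 4 \<and> even m \<and> regular_polygon m Q \<and> Pm_construction m Q P \<longrightarrow>
            real (max_dissection_size P) - real (max_triangulation_size P)
              \<ge> c * real (card (vertices P))"
    by (intro exI[of _ "1 / 4"] conjI exI[of _ 32]) auto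
qed

end
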